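(* Let $\lambda,\mu\ge0$ be real numbers, not both zero, and let $R>0$. Suppose $\{\Omega_i\}_{i\in\mathbb{N}}$ is a cover of $\mathbb{R}^2$ by open squares with edges parallel to the coordinate axes and side-length $R$, such that each point of $\mathbb{R}^2$ belongs to at most $3$ of the $\Omega_i$. Then there exists $C$ such that $$\sum_{i=0}^\infty\|u\|^2_{X^{1/2}(\Omega_i)}\le C\|u\|^2_{X^{1/2}}\quad\text{for all }u\in X^{1/2}.$$
   Context: $D_x^{s}$ is the Fourier multiplier $|\xi|^{s}$ and $\partial_x^{-1}$ the multiplier $(i\xi)^{-1}$ in $x$. $X^{1/2}=\{f\in L^2(\mathbb{R}^2): D_x^{1/2}f,\ D_x^{-1/2}\partial_y f\in L^2\}$ with norm $\|f\|^2_{X^{1/2}}=\int_{\mathbb{R}^2} f^2+(D_x^{1/2}f)^2+\lambda(D_x^{-1/2}f_y)^2+\mu(\partial_x^{-1}f_y)^2$. For an open connected $\Omega$, $X^{1/2}(\Omega)=\{f\in L^2(\Omega): f=g|_\Omega,\ g\in X^{1/2}\}$ with norm $\|f\|_{X^{1/2}(\Omega)}=\inf\{\|g\|_{X^{1/2}}: g\in X^{1/2},\ g|_\Omega=f\}$. *)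

theory Defs
  imports "HOL-Analysis.Analysis"
begin

type_synonym pt = "real \<times> real"

definition trunc_fourier :: "(pt \<Rightarrow> real) \<Rightarrow> nat \<Rightarrow> pt \<Rightarrow> complex" where
  "trunc_fourier f n \<xi> =
     integral\<^sup>L lborel (\<lambda>x. indicator (cbox (- real n, - real n) (real n, real n)) x *\<^sub>R
        (f x *\<^sub>R cis (- (fst x * fst \<xi> + snd x * snd \<xi>))))"

definition fourier_L2 :: "(pt \<Rightarrow> real) \<Rightarrow> (pt \<Rightarrow> complex) \<Rightarrow> bool" where
  "fourier_L2 f F \<longleftrightarrow> F \<in> borel_measurable lborel \<and>
     (\<lambda>n. \<integral>\<^sup>+ \<xi>. ennreal ((cmod (F \<xi> - trunc_fourier f n \<xi>))\<^sup>2) \<partial>lborel) \<longlonglongrightarrow> 0"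

definition L2 :: "(pt \<Rightarrow> real) \<Rightarrow> bool" where
  "L2 f \<longleftrightarrow> f \<in> borel_measurable lborel \<and> integrable lborel (\<lambda>x. (f x)\<^sup>2)"

text \<open>Membership in X^{1/2}: f, D_x^{1/2} f, D_x^{-1/2} f_y in L^2.\<close>
definition inX :: "(pt \<Rightarrow> real) \<Rightarrow> bool" where
  "inX f \<longleftrightarrow> L2 f \<and> (\<exists>F. fourier_L2 f F \<and>
      (\<integral>\<^sup>+ \<xi>. ennreal ((cmod (F \<xi>))\<^sup>2 * \<bar>fst \<xi>\<bar>) \<partial>lborel) < \<infinity> \<and>
      (\<integral>\<^sup>+ \<xi>. ennreal ((cmod (F \<xi>))\<^sup>2 * (snd \<xi>)\<^sup>2 / \<bar>fst \<xi>\<bar>) \<partial>lborel) < \<infinity>)"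

text \<open>Squared X^{1/2} norm (with parameters lambda, mu), as an extended real.
  Via Plancherel, int (M f)^2 dx = (2 pi)^-2 int |m F|^2 d xi for a multiplier m.\<close>
definition sqnormX :: "real \<Rightarrow> real \<Rightarrow> (pt \<Rightarrow> real) \<Rightarrow> ennreal" where
  "sqnormX lam mu f =
     (\<integral>\<^sup>+ x. ennreal ((f x)\<^sup>2) \<partial>lborel) +
     ennreal (1 / (2 * pi)\<^sup>2) *
     (\<integral>\<^sup>+ \<xi>. ennreal ((cmod ((SOME F. fourier_L2 f F) \<xi>))\<^sup>2 *
        (\<bar>fst \<xi>\<bar> + lam * (snd \<xi>)\<^sup>2 / \<bar>fst \<xi>\<bar> + mu * (snd \<xi>)\<^sup>2 / (fst \<xi>)\<^sup>2)) \<partial>lborel)"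

definition sqnormX_on :: "real \<Rightarrow> real \<Rightarrow> pt set \<Rightarrow> (pt \<Rightarrow> real) \<Rightarrow> ennreal" where
  "sqnormX_on lam mu \<Omega> f =
     (INF g \<in> {g. inX g \<and> (AE x in lborel. x \<in> \<Omega> \<longrightarrow> g x = f x)}. sqnormX lam mu g)"

end

(* Extend u from a square with corner (a, b) by g = d_x psi, where psi is a smooth bump times the
   x-antiderivative of u, normalised to have weighted mean zero at the right of the square.
   Writing psi rather than g as the localised object is what makes the multipliers |eta|^2 / |xi|
   and |eta|^2 / xi^2 harmless: they become |xi| |eta|^2 and |eta|^2 acting on psi. Each of the
   three Fourier weights is then controlled by real-variable quantities that live on a fixed
   enlargement of the square, namely L^2 norms of u, of its x-differences and of
   int_x^(x+k) (u(s, y+h) - u(s, y)) ds, integrated against dk / k^2. These are additive over a cover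
   with bounded overlap, and Plancherel turns their sums back into the weighted norms of u.
   The derivative in y only ever appears through difference quotients, uniformly in the step. *)

theory Submission
  imports Defs "HOL-Probability.Probability"
begin

section \<open>Fourier transform and Plancherel inequalities\<close>

text \<open>A plain product of u with a bump is useless here: its transform has no reason to vanish
  on the line \<xi> = 0, where both weights of the y-derivative blow up, whereas the transform of an
  x-derivative carries a factor \<xi>. The price is an antiderivative of u. As u_y need not be a
  function, the y-differences of this antiderivative may be estimated only through integrals of
  y-differences of u over finite x-intervals, which the norm of u controls uniformly. An
  antiderivative starting at infinity is not of this kind; one averaged over base points in a fixed
  window to the right of the square is, with intervals of length at most \<open>6 * R\<close>.
  Relative to the corner of the square, the cutoff and its increments live in [-2R, 3R], so the
  enlargement has to be [-2R, 9R]. The constant C is free, so each Plancherel step is used as an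
  inequality up to a factor, obtained by Gaussian regularisation. Infinite energies cause no case
  distinctions because the estimates are made in \<open>ennreal\<close>.\<close>

abbreviation sq_norm :: "('a::euclidean_space \<Rightarrow> real) \<Rightarrow> ennreal" where
  "sq_norm f \<equiv> \<integral>\<^sup>+x. ennreal ((f x)\<^sup>2) \<partial>lborel"

abbreviation sq_norm_on :: "'a::euclidean_space set \<Rightarrow> ('a \<Rightarrow> real) \<Rightarrow> ennreal" where
  "sq_norm_on A f \<equiv> \<integral>\<^sup>+x. indicator A x * ennreal ((f x)\<^sup>2) \<partial>lborel"

lemma cis_measurable [measurable (raw)]:
  fixes f :: "'a \<Rightarrow> real"
  assumes "f \<in> borel_measurable M"
  shows "(\<lambda>x. cis (f x)) \<in> borel_measurable M"
  by (rule borel_measurable_continuous_on[OF _ assms]) (intro continuous_intros)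

section \<open>Transforms of integrable functions and of Gaussians\<close>

definition ft :: "(pt \<Rightarrow> real) \<Rightarrow> pt \<Rightarrow> complex" where
  "ft f \<xi> = (LINT p|lborel. f p *\<^sub>R cis (- (p \<bullet> \<xi>)))"

lemma ft_measurable [measurable]:
  assumes [measurable]: "f \<in> borel_measurable borel"
  shows "ft f \<in> borel_measurable borel"
  unfolding ft_def by measurable

lemma integrable_ft:
  assumes "integrable lborel f"
  shows "integrable lborel (\<lambda>p. f p *\<^sub>R cis (- (p \<bullet> \<xi>)))"
proof (rule Bochner_Integration.integrable_bound[OF assms])
  have [measurable]: "f \<in> borel_measurable borel" using assms by auto
  show "(\<lambda>p. f p *\<^sub>R cis (- (p \<bullet> \<xi>))) \<in> borel_measurable lborel" by measurable
qed auto

lemma ft_bound: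
  assumes "integrable lborel f"
  shows "cmod (ft f \<xi>) \<le> (LINT p|lborel. \<bar>f p\<bar>)"
  unfolding ft_def using integral_norm_bound[of lborel "\<lambda>p. f p *\<^sub>R cis (- (p \<bullet> \<xi>))"] by simp

lemma ft_diff:
  assumes "integrable lborel f" "integrable lborel g"
  shows "ft (\<lambda>p. f p - g p) \<xi> = ft f \<xi> - ft g \<xi>"
  unfolding ft_def by (simp add: scaleR_diff_left Bochner_Integration.integral_diff integrable_ft assms)

text \<open>Fubini for an integrable pair. With \<open>H\<close> a Gaussian times the conjugate of
  \<open>ft f\<close>, the left side becomes a regularised energy; that is its use in
  \<open>gau_regularised\<close>.\<close>

lemma ft_mult_formula:
  fixes f :: "pt \<Rightarrow> real" and H :: "pt \<Rightarrow> complex"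
  assumes f: "integrable lborel f" and H: "integrable lborel H"
  shows "(LINT \<xi>|lborel. ft f \<xi> * H \<xi>) = (LINT p|lborel. f p *\<^sub>R (LINT \<xi>|lborel. H \<xi> * cis (- (p \<bullet> \<xi>))))"
proof -
  have [measurable]: "f \<in> borel_measurable borel" "H \<in> borel_measurable borel" using f H by auto
  have "integrable (lborel \<Otimes>\<^sub>M lborel) (\<lambda>(p,\<xi>). f p *\<^sub>R H \<xi> :: complex)"
    by (rule lborel_pair.Fubini_integrable) (auto simp: f H)
  then have i: "integrable (lborel \<Otimes>\<^sub>M lborel) (\<lambda>(p,\<xi>). f p *\<^sub>R (H \<xi> * cis (- (p \<bullet> \<xi>))))"
  proof (rule Bochner_Integration.integrable_bound)
    show "(\<lambda>(p, \<xi>). f p *\<^sub>R (H \<xi> * cis (- (p \<bullet> \<xi>)))) \<in> borel_measurable (lborel \<Otimes>\<^sub>M lborel)"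
      by measurable
  qed (auto simp: norm_mult)
  have "(LINT \<xi>|lborel. ft f \<xi> * H \<xi>) = (LINT \<xi>|lborel. (LINT p|lborel. f p *\<^sub>R (H \<xi> * cis (- (p \<bullet> \<xi>)))))"
    unfolding ft_def
    by (intro Bochner_Integration.integral_cong refl, subst integral_mult_left_zero[symmetric])
      (auto simp: mult_ac intro!: Bochner_Integration.integral_cong)
  also have "\<dots> = (LINT p|lborel. (LINT \<xi>|lborel. f p *\<^sub>R (H \<xi> * cis (- (p \<bullet> \<xi>)))))"
    by (rule lborel_pair.Fubini_integral[OF i])
  finally show ?thesis by simp
qed

lemma integrable_gauss:
  assumes "e > 0" shows "integrable lborel (\<lambda>x::real. exp (- (e * x)\<^sup>2 / 2))"
proof -
  have "integrable lborel (\<lambda>x. sqrt (2*pi) * std_normal_density x)" by simp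
  then have "integrable lborel (\<lambda>x. exp (- x\<^sup>2 / 2) :: real)" by (simp add: std_normal_density_def)
  from lborel_integrable_real_affine[OF this, of e 0] assms show ?thesis by simp
qed

text \<open>This is the characteristic function of the standard normal distribution, rescaled by
  \<open>e\<close>.\<close>

lemma gauss_ft1:
  fixes e v :: real assumes "e > 0"
  shows "(LINT x|lborel. exp (- (e * x)\<^sup>2 / 2) *\<^sub>R cis (- (v * x))) = sqrt (2 * pi) / e * exp (- (v / e)\<^sup>2 / 2)"
proof -
  have "char std_normal_distribution (- v / e) = exp (- (v / e)\<^sup>2 / 2)"
    by (simp add: char_std_normal_distribution)
  also have "char std_normal_distribution (- v / e) =
     (LINT x|lborel. (1 / sqrt (2 * pi) * exp (- x\<^sup>2 / 2)) *\<^sub>R cis (- (v * x / e)))"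
    unfolding char_def
    by (subst integral_density) (auto simp: std_normal_density_def cis_conv_exp mult_ac)
  also have "\<dots> = e *\<^sub>R (LINT x|lborel. (1 / sqrt (2 * pi) * exp (- (e*x)\<^sup>2 / 2)) *\<^sub>R cis (- (v * x)))"
    by (subst lborel_integral_real_affine[where c=e and t=0]) (use assms in auto)
  also have "\<dots> = (e / sqrt (2 * pi)) *\<^sub>R (LINT x|lborel. exp (- (e*x)\<^sup>2 / 2) *\<^sub>R cis (- (v * x)))"
    by (simp only: scaleR_scaleR[symmetric] integral_scaleR_right) (simp add: field_simps)
  finally have "of_real (sqrt (2 * pi) / e) * ((e / sqrt (2 * pi)) *\<^sub>R (LINT x|lborel. exp (- (e*x)\<^sup>2 / 2) *\<^sub>R cis (- (v * x))))
     = of_real (sqrt (2 * pi) / e) * complex_of_real (exp (- (v / e)\<^sup>2 / 2))" by simp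
  then show ?thesis using assms by (simp add: scaleR_conv_of_real)
qed

definition gau :: "real \<Rightarrow> pt \<Rightarrow> real" where
  "gau e p = exp (- (e * fst p)\<^sup>2 / 2) * exp (- (e * snd p)\<^sup>2 / 2)"

lemma gau_measurable [measurable]: "gau e \<in> borel_measurable borel"
  unfolding gau_def borel_prod[symmetric] by measurable

lemma gau_pos: "0 < gau e p" and gau_le: "gau e p \<le> 1"
  unfolding gau_def by (auto intro!: mult_le_one)

lemma integrable_gau: assumes "e > 0" shows "integrable lborel (gau e)"
proof -
  have "integrable (lborel \<Otimes>\<^sub>M lborel) (\<lambda>(x,y). exp (- (e * x)\<^sup>2 / 2) * exp (- (e * y)\<^sup>2 / 2) :: real)"
    using integrable_gauss[OF assms] by (intro lborel_pair.Fubini_integrable) auto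
  then show ?thesis unfolding lborel_prod gau_def by (simp add: case_prod_beta')
qed

lemma gau_ft:
  assumes "e > 0"
  shows "(LINT \<xi>|lborel. gau e \<xi> *\<^sub>R cis (- (v \<bullet> \<xi>))) = of_real (2 * pi / e\<^sup>2 * gau (1/e) v)"
proof -
  have i: "integrable lborel (\<lambda>\<xi>. gau e \<xi> *\<^sub>R cis (- (v \<bullet> \<xi>)))"
    by (rule Bochner_Integration.integrable_bound[OF integrable_gau[OF assms]]) auto
  obtain a b where v: "v = (a,b)" by force
  have "(LINT \<xi>|lborel. gau e \<xi> *\<^sub>R cis (- (v \<bullet> \<xi>))) =
     (LINT x|lborel. (LINT y|lborel. gau e (x,y) *\<^sub>R cis (- (v \<bullet> (x,y)))))"
    using i unfolding lborel_prod[symmetric]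
    by (subst lborel_pair.integral_fst') (auto)
  also have "\<dots> = (LINT x|lborel. (LINT y|lborel. (exp (- (e * x)\<^sup>2 / 2) *\<^sub>R cis (- (a * x))) * (exp (- (e * y)\<^sup>2 / 2) *\<^sub>R cis (- (b * y)))))"
    by (simp add: gau_def v inner_prod_def cis_mult algebra_simps)
  also have "\<dots> = (sqrt (2 * pi) / e * exp (- (a / e)\<^sup>2 / 2)) * (sqrt (2 * pi) / e * exp (- (b / e)\<^sup>2 / 2))"
    unfolding integral_mult_right_zero integral_mult_left_zero gauss_ft1[OF assms] by simp
  also have "\<dots> = of_real ((sqrt (2*pi) * sqrt (2*pi)) / e\<^sup>2 * gau (1/e) v)"
    by (simp add: gau_def v power2_eq_square del: real_sqrt_mult_self)
  finally show ?thesis by simp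
qed

section \<open>Gaussian regularisation and the Plancherel inequalities\<close>

lemma cnj_measurable [measurable (raw)]:
  assumes "f \<in> borel_measurable M"
  shows "(\<lambda>x. cnj (f x)) \<in> borel_measurable M"
  by (rule borel_measurable_continuous_on[OF _ assms]) (intro continuous_intros)

lemma integral_affine_plane:
  fixes F :: "pt \<Rightarrow> 'b::{banach, second_countable_topology}"
  assumes [measurable]: "F \<in> borel_measurable borel" and "c \<noteq> 0"
  shows "(LINT q|lborel. F q) = c\<^sup>2 *\<^sub>R (LINT z|lborel. F (p + c *\<^sub>R z))"
proof -
  have "(LINT q|lborel. F q) = (LINT q|density (distr lborel borel (\<lambda>x. p + c *\<^sub>R x)) (\<lambda>_. ennreal (\<bar>c\<bar> ^ DIM(pt))). F q)"
    by (subst lborel_affine[OF assms(2), of p]) simp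
  also have "\<dots> = c\<^sup>2 *\<^sub>R (LINT z|lborel. F (p + c *\<^sub>R z))"
    by (subst integral_density) (simp_all add: integral_distr power2_eq_square)
  finally show ?thesis .
qed

lemma nn_integral_translate_plane:
  fixes F :: "pt \<Rightarrow> ennreal"
  assumes [measurable]: "F \<in> borel_measurable borel"
  shows "(\<integral>\<^sup>+q. F (p + q) \<partial>lborel) = (\<integral>\<^sup>+q. F q \<partial>lborel)"
proof -
  have "(\<integral>\<^sup>+q. F q \<partial>lborel) = (\<integral>\<^sup>+q. F q \<partial>density (distr lborel borel (\<lambda>x. p + 1 *\<^sub>R x)) (\<lambda>_. ennreal (\<bar>1\<bar> ^ DIM(pt))))"
    by (subst lborel_affine[of 1, of p]) simp_all
  also have "\<dots> = (\<integral>\<^sup>+q. F (p + q) \<partial>lborel)"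
    by (subst nn_integral_density) (simp_all add: nn_integral_distr)
  finally show ?thesis by simp
qed

text \<open>A non-integrable function has integral 0 by convention, which makes the bound trivial in
  that case, so it can be applied under an outer integral without tracking which inner integrals
  converge.\<close>

lemma ennreal_abs_integral_le:
  fixes f :: "'a \<Rightarrow> real"
  shows "ennreal \<bar>integral\<^sup>L M f\<bar> \<le> (\<integral>\<^sup>+x. ennreal \<bar>f x\<bar> \<partial>M)"
proof (cases "integrable M f")
  case True then show ?thesis using integral_norm_bound_ennreal[OF True] by simp
next
  case False then show ?thesis by (simp add: not_integrable_integral_eq)
qed

lemma integral_gau1: "(LINT z|lborel. gau 1 z) = 2 * pi"
proof -
  have "complex_of_real (LINT z|lborel. gau 1 z) = (LINT z|lborel. gau 1 z *\<^sub>R cis (- (0 \<bullet> z)))"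
    by (simp add: scaleR_conv_of_real)
  also have "\<dots> = of_real (2 * pi)" unfolding gau_ft[OF zero_less_one] by (simp add: gau_def)
  finally have "complex_of_real (LINT z|lborel. gau 1 z) = of_real (2 * pi)" .
  then show ?thesis using of_real_eq_iff by blast
qed

lemma integrable_gau_ft:
  assumes f: "integrable lborel f" and "e > 0"
  shows "integrable lborel (\<lambda>\<xi>. gau e \<xi> * (cmod (ft f \<xi>))\<^sup>2)"
proof (rule Bochner_Integration.integrable_bound)
  have [measurable]: "f \<in> borel_measurable borel" using f by auto
  show "integrable lborel (\<lambda>\<xi>. (LINT p|lborel. \<bar>f p\<bar>)\<^sup>2 * gau e \<xi>)"
    using integrable_gau[OF assms(2)] by simp
  show "(\<lambda>\<xi>. gau e \<xi> * (cmod (ft f \<xi>))\<^sup>2) \<in> borel_measurable lborel" by measurable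
  have "norm (gau e \<xi> * (cmod (ft f \<xi>))\<^sup>2) \<le> norm ((LINT p|lborel. \<bar>f p\<bar>)\<^sup>2 * gau e \<xi>)" for \<xi>
    using power_mono[OF ft_bound[OF f, of \<xi>], of 2] gau_pos[of e \<xi>] by (simp add: mult.commute)
  then show "AE \<xi> in lborel. norm (gau e \<xi> * (cmod (ft f \<xi>))\<^sup>2) \<le> norm ((LINT p|lborel. \<bar>f p\<bar>)\<^sup>2 * gau e \<xi>)" by simp
qed

text \<open>This is the multiplication formula with \<open>H\<close> the product of
  \<open>gau e\<close> and \<open>cnj (ft f)\<close>: the transform of \<open>H\<close> at p is a
  Gaussian mean of f about p at scale e. The averaging kernel has total mass (2 pi)^2, so letting e
  tend to 0 produces Plancherel; both inequalities below start from this identity.\<close>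

lemma gau_regularised:
  assumes f: "integrable lborel f" and e: "e > 0"
  shows "(LINT \<xi>|lborel. gau e \<xi> * (cmod (ft f \<xi>))\<^sup>2) =
     (LINT p|lborel. f p * (LINT z|lborel. f (p - e *\<^sub>R z) * (2 * pi * gau 1 z)))"
proof -
  have [measurable]: "f \<in> borel_measurable borel" using f by auto
  define H where "H = (\<lambda>\<xi>. gau e \<xi> *\<^sub>R cnj (ft f \<xi>))"
  have H: "integrable lborel H"
  proof (rule Bochner_Integration.integrable_bound)
    show "integrable lborel (\<lambda>\<xi>. (LINT p|lborel. \<bar>f p\<bar>) * gau e \<xi>)"
      using integrable_gau[OF e] by simp
    show "H \<in> borel_measurable lborel" unfolding H_def by measurable
    have "norm (H \<xi>) \<le> norm ((LINT p|lborel. \<bar>f p\<bar>) * gau e \<xi>)" for \<xi>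
      using ft_bound[OF f, of \<xi>] gau_pos[of e \<xi>] by (simp add: H_def mult.commute)
    then show "AE \<xi> in lborel. norm (H \<xi>) \<le> norm ((LINT p|lborel. \<bar>f p\<bar>) * gau e \<xi>)" by simp
  qed
  have inner: "(LINT \<xi>|lborel. H \<xi> * cis (- (p \<bullet> \<xi>))) = of_real (LINT z|lborel. f (p - e *\<^sub>R z) * (2 * pi * gau 1 z))" for p
  proof -
    have i: "integrable lborel (\<lambda>\<xi>. gau e \<xi> *\<^sub>R cis (p \<bullet> \<xi>))"
      by (rule Bochner_Integration.integrable_bound[OF integrable_gau[OF e]]) auto
    have "(LINT \<xi>|lborel. H \<xi> * cis (- (p \<bullet> \<xi>))) = cnj (LINT \<xi>|lborel. ft f \<xi> * (gau e \<xi> *\<^sub>R cis (p \<bullet> \<xi>)))"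
      unfolding H_def by (subst Bochner_Integration.integral_cnj[symmetric]) (auto simp: cis_cnj intro!: Bochner_Integration.integral_cong)
    also have "\<dots> = cnj (LINT q|lborel. f q *\<^sub>R (LINT \<xi>|lborel. gau e \<xi> *\<^sub>R cis (- ((q - p) \<bullet> \<xi>))))"
      unfolding ft_mult_formula[OF f i] by (simp add: cis_mult inner_diff_left)
    also have "\<dots> = cnj (LINT q|lborel. complex_of_real (f q * (2 * pi / e\<^sup>2 * gau (1/e) (q - p))))"
      unfolding gau_ft[OF e] by (simp add: scaleR_conv_of_real)
    also have "\<dots> = of_real (LINT q|lborel. f q * (2 * pi / e\<^sup>2 * gau (1/e) (q - p)))"
      unfolding integral_complex_of_real by simp
    also have "(LINT q|lborel. f q * (2 * pi / e\<^sup>2 * gau (1/e) (q - p))) = e\<^sup>2 * (LINT z|lborel. f (p - e *\<^sub>R z) * (2 * pi / e\<^sup>2 * gau (1/e) (- e *\<^sub>R z)))"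
      by (subst integral_affine_plane[of _ "- e" p]) (use e in auto)
    also have "\<dots> = (LINT z|lborel. f (p - e *\<^sub>R z) * (2 * pi * gau 1 z))"
      using e by (subst integral_mult_right_zero[symmetric]) (simp add: gau_def mult_ac)
    finally show ?thesis .
  qed
  have "complex_of_real (LINT \<xi>|lborel. gau e \<xi> * (cmod (ft f \<xi>))\<^sup>2) = (LINT \<xi>|lborel. ft f \<xi> * H \<xi>)"
    unfolding integral_complex_of_real[symmetric] H_def
    by (intro Bochner_Integration.integral_cong refl) (simp add: complex_mult_cnj scaleR_conv_of_real cmod_power2 mult_ac flip: complex_norm_square)
  also have "\<dots> = of_real (LINT p|lborel. f p * (LINT z|lborel. f (p - e *\<^sub>R z) * (2 * pi * gau 1 z)))"
  proof -
    have "(LINT \<xi>|lborel. ft f \<xi> * H \<xi>) = (LINT p|lborel. complex_of_real (f p * (LINT z|lborel. f (p - e *\<^sub>R z) * (2 * pi * gau 1 z))))"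
      unfolding ft_mult_formula[OF f H] inner by (simp only: scaleR_conv_of_real of_real_mult)
    then show ?thesis unfolding integral_complex_of_real .
  qed
  finally show ?thesis using of_real_eq_iff by blast
qed

text \<open>Bounding a product of two values of f by half the sum of their squares and using
  translation invariance gives the same constant for the regularised energy at every e; Fatou then
  removes the Gaussian.\<close>

lemma plancherel_le:
  assumes f: "integrable lborel f"
  shows "(sq_norm (\<lambda>\<xi>. cmod (ft f \<xi>))) \<le> ennreal ((2 * pi)\<^sup>2) * (sq_norm f)"
proof -
  have [measurable]: "f \<in> borel_measurable borel" using f by auto
  define E where "E = sq_norm f"
  have reg: "(\<integral>\<^sup>+\<xi>. ennreal (gau e \<xi> * (cmod (ft f \<xi>))\<^sup>2) \<partial>lborel) \<le> ennreal ((2 * pi)\<^sup>2) * E" if e: "e > 0" for e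
  proof -
    have "(\<integral>\<^sup>+\<xi>. ennreal (gau e \<xi> * (cmod (ft f \<xi>))\<^sup>2) \<partial>lborel) = ennreal (LINT \<xi>|lborel. gau e \<xi> * (cmod (ft f \<xi>))\<^sup>2)"
      by (rule nn_integral_eq_integral[OF integrable_gau_ft[OF f e]]) (simp add: gau_pos[THEN less_imp_le])
    also have "\<dots> = ennreal (LINT p|lborel. f p * (LINT z|lborel. f (p - e *\<^sub>R z) * (2 * pi * gau 1 z)))"
      unfolding gau_regularised[OF f e] ..
    also have "\<dots> \<le> (\<integral>\<^sup>+p. ennreal \<bar>f p * (LINT z|lborel. f (p - e *\<^sub>R z) * (2 * pi * gau 1 z))\<bar> \<partial>lborel)"
      by (rule order_trans[OF _ ennreal_abs_integral_le]) (simp add: ennreal_leI)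
    also have "\<dots> \<le> (\<integral>\<^sup>+p. (\<integral>\<^sup>+z. ennreal \<bar>f p\<bar> * ennreal \<bar>f (p - e *\<^sub>R z) * (2 * pi * gau 1 z)\<bar> \<partial>lborel) \<partial>lborel)"
    proof (intro nn_integral_mono)
      fix p :: pt
      have "ennreal \<bar>f p * (LINT z|lborel. f (p - e *\<^sub>R z) * (2 * pi * gau 1 z))\<bar>
        = ennreal \<bar>f p\<bar> * ennreal \<bar>LINT z|lborel. f (p - e *\<^sub>R z) * (2 * pi * gau 1 z)\<bar>"
        unfolding abs_mult by (rule ennreal_mult) auto
      also have "\<dots> \<le> ennreal \<bar>f p\<bar> * (\<integral>\<^sup>+z. ennreal \<bar>f (p - e *\<^sub>R z) * (2 * pi * gau 1 z)\<bar> \<partial>lborel)"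
        by (intro mult_left_mono ennreal_abs_integral_le) simp
      also have "\<dots> = (\<integral>\<^sup>+z. ennreal \<bar>f p\<bar> * ennreal \<bar>f (p - e *\<^sub>R z) * (2 * pi * gau 1 z)\<bar> \<partial>lborel)"
        by (rule nn_integral_cmult[symmetric]) measurable
      finally show "ennreal \<bar>f p * (LINT z|lborel. f (p - e *\<^sub>R z) * (2 * pi * gau 1 z))\<bar> \<le> \<dots>" .
    qed
    also have "\<dots> \<le> (\<integral>\<^sup>+p. (\<integral>\<^sup>+z. ennreal (pi * gau 1 z) * (ennreal ((f p)\<^sup>2) + ennreal ((f (p - e *\<^sub>R z))\<^sup>2)) \<partial>lborel) \<partial>lborel)"
    proof (intro nn_integral_mono)
      fix p z :: pt
      have "2 * (\<bar>f p\<bar> * \<bar>f (p - e *\<^sub>R z)\<bar>) \<le> (f p)\<^sup>2 + (f (p - e *\<^sub>R z))\<^sup>2"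
        using sum_squares_bound[of "\<bar>f p\<bar>" "\<bar>f (p - e *\<^sub>R z)\<bar>"] by (simp add: power2_eq_square)
      then have "(pi * gau 1 z) * (2 * (\<bar>f p\<bar> * \<bar>f (p - e *\<^sub>R z)\<bar>)) \<le> (pi * gau 1 z) * ((f p)\<^sup>2 + (f (p - e *\<^sub>R z))\<^sup>2)"
        using gau_pos[of 1 z] by (intro mult_left_mono) auto
      then show "ennreal \<bar>f p\<bar> * ennreal \<bar>f (p - e *\<^sub>R z) * (2 * pi * gau 1 z)\<bar> \<le> ennreal (pi * gau 1 z) * (ennreal ((f p)\<^sup>2) + ennreal ((f (p - e *\<^sub>R z))\<^sup>2))"
        using gau_pos[of 1 z] by (simp add: abs_mult mult_ac flip: ennreal_plus ennreal_mult)
    qed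
    also have "\<dots> = (\<integral>\<^sup>+z. (\<integral>\<^sup>+p. ennreal (pi * gau 1 z) * (ennreal ((f p)\<^sup>2) + ennreal ((f (p - e *\<^sub>R z))\<^sup>2)) \<partial>lborel) \<partial>lborel)"
      by (rule lborel_pair.Fubini') measurable
    also have "\<dots> = (\<integral>\<^sup>+z. ennreal (pi * gau 1 z) * (E + E) \<partial>lborel)"
    proof (intro nn_integral_cong)
      fix z :: pt
      have "(sq_norm (\<lambda>p. f (p - e *\<^sub>R z))) = E"
        unfolding E_def using nn_integral_translate_plane[of "\<lambda>p. ennreal ((f p)\<^sup>2)" "- (e *\<^sub>R z)"] by simp
      then show "(\<integral>\<^sup>+p. ennreal (pi * gau 1 z) * (ennreal ((f p)\<^sup>2) + ennreal ((f (p - e *\<^sub>R z))\<^sup>2)) \<partial>lborel) = ennreal (pi * gau 1 z) * (E + E)"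
        by (simp add: nn_integral_cmult nn_integral_add E_def)
    qed
    also have "\<dots> = (\<integral>\<^sup>+z. ennreal (pi * gau 1 z) \<partial>lborel) * (E + E)"
      by (rule nn_integral_multc) simp
    also have "(\<integral>\<^sup>+z. ennreal (pi * gau 1 z) \<partial>lborel) = ennreal (LINT z|lborel. pi * gau 1 z)"
      by (rule nn_integral_eq_integral) (simp_all add: integrable_gau gau_pos[THEN less_imp_le])
    also have "\<dots> = ennreal (2 * pi\<^sup>2)" by (simp add: integral_gau1 power2_eq_square mult_ac)
    also have "ennreal (2 * pi\<^sup>2) * (E + E) = ennreal (2 * pi\<^sup>2 * 2) * E"
      by (subst ennreal_mult) (auto simp: mult_ac mult_2[symmetric])
    finally show ?thesis by (simp add: power2_eq_square mult_ac)
  qed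
  have lim: "(\<lambda>n. gau (1 / real (Suc n)) \<xi>) \<longlonglongrightarrow> 1" for \<xi>
  proof -
    have "(\<lambda>n. gau (1 / real (Suc n)) \<xi>) \<longlonglongrightarrow> exp (- (0 * fst \<xi>)\<^sup>2 / 2) * exp (- (0 * snd \<xi>)\<^sup>2 / 2)"
      unfolding gau_def by (intro tendsto_intros LIMSEQ_inverse_real_of_nat[unfolded inverse_eq_divide]) simp_all
    then show ?thesis by simp
  qed
  have "(sq_norm (\<lambda>\<xi>. cmod (ft f \<xi>))) = (\<integral>\<^sup>+\<xi>. liminf (\<lambda>n. ennreal (gau (1 / real (Suc n)) \<xi> * (cmod (ft f \<xi>))\<^sup>2)) \<partial>lborel)"
  proof (intro nn_integral_cong lim_imp_Liminf[symmetric])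
    fix \<xi> :: pt
    have "(\<lambda>n. gau (1 / real (Suc n)) \<xi> * (cmod (ft f \<xi>))\<^sup>2) \<longlonglongrightarrow> 1 * (cmod (ft f \<xi>))\<^sup>2"
      by (intro tendsto_intros lim)
    then show "(\<lambda>n. ennreal (gau (1 / real (Suc n)) \<xi> * (cmod (ft f \<xi>))\<^sup>2)) \<longlonglongrightarrow> ennreal ((cmod (ft f \<xi>))\<^sup>2)"
      by (intro tendsto_ennrealI) simp
  qed simp
  also have "\<dots> \<le> liminf (\<lambda>n. \<integral>\<^sup>+\<xi>. ennreal (gau (1 / real (Suc n)) \<xi> * (cmod (ft f \<xi>))\<^sup>2) \<partial>lborel)"
    by (rule nn_integral_liminf) measurable
  also have "\<dots> \<le> ennreal ((2 * pi)\<^sup>2) * E"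
    by (intro order_trans[OF Liminf_le_Limsup Limsup_bounded] always_eventually allI reg) simp_all
  finally show ?thesis unfolding E_def .
qed

text \<open>The regularised energy is at most the full one because \<open>gau\<close> is at most 1.
  Continuity makes the Gaussian means of f converge pointwise to (2 pi)^2 f, and boundedness
  supplies the dominating functions for passing to the limit.\<close>

lemma plancherel_ge_continuous:
  assumes f: "integrable lborel f" and c: "continuous_on UNIV f" and M: "\<And>p. \<bar>f p\<bar> \<le> M"
  shows "ennreal ((2 * pi)\<^sup>2) * (sq_norm f) \<le> (sq_norm (\<lambda>\<xi>. cmod (ft f \<xi>)))"
proof -
  have [measurable]: "f \<in> borel_measurable borel" using f by auto
  let ?e = "\<lambda>n. inverse (real (Suc n))"
  have M0: "0 \<le> M" using M[of 0] by linarith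
  have sq: "integrable lborel (\<lambda>p. (f p)\<^sup>2)"
  proof (rule Bochner_Integration.integrable_bound)
    show "integrable lborel (\<lambda>p. M * f p)" using f by simp
    have "norm ((f p)\<^sup>2) \<le> norm (M * f p)" for p
      using mult_right_mono[OF M[of p], of "\<bar>f p\<bar>"] M0 by (simp add: power2_eq_square abs_mult)
    then show "AE p in lborel. norm ((f p)\<^sup>2) \<le> norm (M * f p)" by simp
  qed measurable
  define I where "I n p = (LINT z|lborel. f (p - ?e n *\<^sub>R z) * (2 * pi * gau 1 z))" for n p
  have [measurable]: "I n \<in> borel_measurable borel" for n unfolding I_def by measurable
  have w: "integrable lborel (\<lambda>z. M * (2 * pi * gau 1 z))" by (simp add: integrable_gau)
  have bnd: "norm (f q * (2 * pi * gau 1 z)) \<le> M * (2 * pi * gau 1 z)" for q z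
    using mult_right_mono[OF M[of q], of "2 * pi * gau 1 z"] gau_pos[of 1 z] by (simp add: abs_mult)
  have lim: "(\<lambda>n. I n p) \<longlonglongrightarrow> f p * (2 * pi)\<^sup>2" for p
  proof -
    have "(\<lambda>n. I n p) \<longlonglongrightarrow> (LINT z|lborel. f p * (2 * pi * gau 1 z))"
      unfolding I_def
    proof (rule integral_dominated_convergence[OF _ _ w])
      show "AE z in lborel. (\<lambda>n. f (p - ?e n *\<^sub>R z) * (2 * pi * gau 1 z)) \<longlonglongrightarrow> f p * (2 * pi * gau 1 z)"
      proof (intro always_eventually allI)
        fix z :: pt
        have "(\<lambda>n. p - ?e n *\<^sub>R z) \<longlonglongrightarrow> p - 0 *\<^sub>R z"
          by (intro tendsto_intros LIMSEQ_inverse_real_of_nat)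
        then have "(\<lambda>n. f (p - ?e n *\<^sub>R z)) \<longlonglongrightarrow> f p"
          using c by (auto intro: continuous_on_tendsto_compose[of UNIV f])
        then show "(\<lambda>n. f (p - ?e n *\<^sub>R z) * (2 * pi * gau 1 z)) \<longlonglongrightarrow> f p * (2 * pi * gau 1 z)"
          by (intro tendsto_intros)
      qed
      show "AE z in lborel. norm (f (p - ?e n *\<^sub>R z) * (2 * pi * gau 1 z)) \<le> M * (2 * pi * gau 1 z)" for n
        using bnd by simp
    qed measurable
    then show ?thesis by (simp add: integral_gau1 power2_eq_square mult_ac)
  qed
  have Ib: "\<bar>I n p\<bar> \<le> M * (2 * pi)\<^sup>2" for n p
  proof -
    have "norm (f (p - ?e n *\<^sub>R z) * (2 * pi * gau 1 z)) \<le> norm (M * (2 * pi * gau 1 z))" for z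
      by (rule order_trans[OF bnd]) (simp only: real_norm_def abs_ge_self)
    then have "integrable lborel (\<lambda>z. f (p - ?e n *\<^sub>R z) * (2 * pi * gau 1 z))"
      by (intro Bochner_Integration.integrable_bound[OF w] always_eventually allI) measurable
    from Bochner_Integration.integral_norm_bound_integral[OF this w bnd]
    have "\<bar>I n p\<bar> \<le> (LINT z|lborel. M * (2 * pi * gau 1 z))"
      unfolding I_def real_norm_def .
    then show ?thesis by (simp add: integral_gau1 power2_eq_square mult_ac)
  qed
  have "(\<lambda>n. LINT p|lborel. f p * I n p) \<longlonglongrightarrow> (LINT p|lborel. f p * (f p * (2 * pi)\<^sup>2))"
  proof (rule integral_dominated_convergence)
    show "integrable lborel (\<lambda>p. \<bar>f p\<bar> * (M * (2 * pi)\<^sup>2))" using f by simp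
    show "AE p in lborel. (\<lambda>n. f p * I n p) \<longlonglongrightarrow> f p * (f p * (2 * pi)\<^sup>2)"
      by (intro always_eventually allI tendsto_intros lim)
    show "AE p in lborel. norm (f p * I n p) \<le> \<bar>f p\<bar> * (M * (2 * pi)\<^sup>2)" for n
      using Ib by (intro always_eventually allI) (simp only: real_norm_def abs_mult mult_left_mono abs_ge_zero)
  qed measurable
  then have "(\<lambda>n. ennreal (LINT p|lborel. f p * I n p)) \<longlonglongrightarrow> ennreal (LINT p|lborel. f p * (f p * (2 * pi)\<^sup>2))"
    by (rule tendsto_ennrealI)
  moreover have "ennreal (LINT p|lborel. f p * I n p) \<le> (sq_norm (\<lambda>\<xi>. cmod (ft f \<xi>)))" for n
  proof -
    have e: "0 < ?e n" by simp
    have "ennreal (LINT p|lborel. f p * I n p) = (\<integral>\<^sup>+\<xi>. ennreal (gau (?e n) \<xi> * (cmod (ft f \<xi>))\<^sup>2) \<partial>lborel)"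
      unfolding I_def gau_regularised[OF f e, symmetric]
      by (rule nn_integral_eq_integral[OF integrable_gau_ft[OF f e], symmetric]) (simp add: gau_pos[THEN less_imp_le])
    also have "\<dots> \<le> (sq_norm (\<lambda>\<xi>. cmod (ft f \<xi>)))"
      by (intro nn_integral_mono ennreal_leI) (simp add: mult_left_le_one_le gau_le gau_pos[THEN less_imp_le])
    finally show ?thesis .
  qed
  ultimately have "ennreal (LINT p|lborel. f p * (f p * (2 * pi)\<^sup>2)) \<le> (sq_norm (\<lambda>\<xi>. cmod (ft f \<xi>)))"
    by (intro LIMSEQ_le_const2) auto
  also have "ennreal (LINT p|lborel. f p * (f p * (2 * pi)\<^sup>2)) = ennreal ((2 * pi)\<^sup>2 * (LINT p|lborel. (f p)\<^sup>2))"
    unfolding integral_mult_right_zero[symmetric] by (simp add: power2_eq_square mult_ac)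
  also have "\<dots> = ennreal ((2 * pi)\<^sup>2) * (sq_norm f)"
    by (subst nn_integral_eq_integral[OF sq]) (simp_all add: ennreal_mult)
  finally show ?thesis .
qed

section \<open>Density of bounded continuous integrable functions\<close>

lemma power2_sum_le: "((x::real) + y)\<^sup>2 \<le> 2 * x\<^sup>2 + 2 * y\<^sup>2"
  using zero_le_power2[of "x - y"] by (simp add: power2_eq_square algebra_simps)

lemma nn_integral_power2_sum_le:
  fixes F G H :: "'a \<Rightarrow> real"
  assumes [measurable]: "G \<in> borel_measurable M" "H \<in> borel_measurable M"
    and "\<And>x. \<bar>F x\<bar> \<le> \<bar>G x\<bar> + \<bar>H x\<bar>"
  shows "(\<integral>\<^sup>+x. ennreal ((F x)\<^sup>2) \<partial>M) \<le> 2 * (\<integral>\<^sup>+x. ennreal ((G x)\<^sup>2) \<partial>M) + 2 * (\<integral>\<^sup>+x. ennreal ((H x)\<^sup>2) \<partial>M)"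
proof -
  have "(\<integral>\<^sup>+x. ennreal ((F x)\<^sup>2) \<partial>M) \<le> (\<integral>\<^sup>+x. 2 * ennreal ((G x)\<^sup>2) + 2 * ennreal ((H x)\<^sup>2) \<partial>M)"
  proof (intro nn_integral_mono)
    fix x
    have "(F x)\<^sup>2 \<le> (\<bar>G x\<bar> + \<bar>H x\<bar>)\<^sup>2" using assms(3)[of x] by (metis abs_ge_zero power2_abs power_mono)
    also have "\<dots> \<le> 2 * (G x)\<^sup>2 + 2 * (H x)\<^sup>2" using power2_sum_le[of "\<bar>G x\<bar>" "\<bar>H x\<bar>"] by simp
    finally have "ennreal ((F x)\<^sup>2) \<le> ennreal (2 * (G x)\<^sup>2 + 2 * (H x)\<^sup>2)" by (rule ennreal_leI)
    then show "ennreal ((F x)\<^sup>2) \<le> 2 * ennreal ((G x)\<^sup>2) + 2 * ennreal ((H x)\<^sup>2)"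
      by (simp add: ennreal_mult)
  qed
  also have "\<dots> = 2 * (\<integral>\<^sup>+x. ennreal ((G x)\<^sup>2) \<partial>M) + 2 * (\<integral>\<^sup>+x. ennreal ((H x)\<^sup>2) \<partial>M)"
    by (simp add: nn_integral_add nn_integral_cmult)
  finally show ?thesis .
qed

text \<open>A measurable function is an almost everywhere limit of continuous functions. Clamping
  these to [-M, M] and multiplying by the plateau function \<open>k\<close> does not disturb the
  limit, since f is itself unchanged by both operations, and it makes dominated convergence
  applicable.\<close>

lemma L2_approx_bounded:
  fixes f :: "pt \<Rightarrow> real"
  assumes [measurable]: "f \<in> borel_measurable borel" and M: "\<And>p. \<bar>f p\<bar> \<le> M"
    and N: "\<And>p. norm p > N \<Longrightarrow> f p = 0" and "\<epsilon> > 0"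
  obtains g where "continuous_on UNIV g" "integrable lborel g" "\<forall>p. \<bar>g p\<bar> \<le> M"
     "(sq_norm (\<lambda>p. f p - g p)) < \<epsilon>"
proof -
  have M0: "0 \<le> M" using M[of 0] by linarith
  have "f \<in> borel_measurable lebesgue" by (simp add: measurable_completion)
  then have "f measurable_on UNIV" by (rule lebesgue_measurable_imp_measurable_on) simp
  then obtain Z g where Z: "negligible Z" and g: "\<And>n. continuous_on UNIV (g n)"
    and lim: "\<And>x. x \<notin> Z \<Longrightarrow> (\<lambda>n. g n x) \<longlonglongrightarrow> f x"
    unfolding measurable_on_def by auto
  define k where "k p = max 0 (min 1 (N + 1 - norm p))" for p :: pt
  define h where "h n p = max (- M) (min M (g n p)) * k p" for n p
  have k: "0 \<le> k p" "k p \<le> 1" for p unfolding k_def by auto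
  have ch: "continuous_on UNIV (h n)" for n
    unfolding h_def k_def by (intro continuous_intros g)
  then have [measurable]: "h n \<in> borel_measurable borel" for n
    by (rule borel_measurable_continuous_onI)
  have hM: "\<bar>h n p\<bar> \<le> M" for n p
  proof -
    have "\<bar>h n p\<bar> = \<bar>max (- M) (min M (g n p))\<bar> * k p" unfolding h_def abs_mult using k by simp
    also have "\<dots> \<le> M * 1" using k[of p] M0 by (intro mult_mono) auto
    finally show ?thesis by simp
  qed
  have h0: "h n p = 0" if "norm p > N + 1" for n p using that unfolding h_def k_def by auto
  let ?B = "cball (0::pt) (N + 1)"
  have [measurable]: "?B \<in> sets borel" by (simp add: borel_closed)
  have B: "integrable lborel (\<lambda>p. c * indicator ?B p)" for c :: real
    by (intro integrable_mult_right integrable_real_indicator) (auto intro: emeasure_bounded_finite[unfolded infinity_ennreal_def])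
  have ih: "integrable lborel (h n)" for n
  proof (rule Bochner_Integration.integrable_bound[OF B[of M]])
    show "AE p in lborel. norm (h n p) \<le> norm (M * indicator ?B p)"
      using hM M0 h0 by (intro always_eventually allI) (auto simp: indicator_def not_le)
  qed measurable
  have "(\<lambda>n. \<integral>\<^sup>+p. ennreal ((f p - h n p)\<^sup>2) \<partial>lborel) \<longlonglongrightarrow> (\<integral>\<^sup>+p. ennreal 0 \<partial>(lborel::pt measure))"
  proof (rule nn_integral_dominated_convergence)
    show "(\<integral>\<^sup>+p. ennreal ((2 * M)\<^sup>2 * indicator ?B p) \<partial>lborel) < \<infinity>"
      using B[of "(2 * M)\<^sup>2"] by (subst nn_integral_eq_integral) auto
    show "AE p in lborel. ennreal ((f p - h n p)\<^sup>2) \<le> ennreal ((2 * M)\<^sup>2 * indicator ?B p)" for n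
    proof (intro always_eventually allI)
      fix p
      show "ennreal ((f p - h n p)\<^sup>2) \<le> ennreal ((2 * M)\<^sup>2 * indicator ?B p)"
      proof (cases "p \<in> ?B")
        case True
        have "\<bar>f p - h n p\<bar> \<le> 2 * M" using M[of p] hM[of n p] by linarith
        then have "(f p - h n p)\<^sup>2 \<le> (2 * M)\<^sup>2" by (metis abs_ge_zero power2_abs power_mono)
        then show ?thesis using True by (simp add: ennreal_leI)
      next
        case False then show ?thesis using N[of p] h0[of p n] by (simp add: not_le)
      qed
    qed
    have "Z \<in> null_sets lebesgue" using Z by (simp add: negligible_iff_null_sets)
    then have "AE p in lebesgue. p \<notin> Z" by (rule AE_not_in)
    then have "AE p in (lborel::pt measure). p \<notin> Z" by (simp add: AE_completion_iff)
    then show "AE p in lborel. (\<lambda>n. ennreal ((f p - h n p)\<^sup>2)) \<longlonglongrightarrow> ennreal 0"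
    proof eventually_elim
      case (elim p)
      have fp: "f p = max (- M) (min M (f p)) * k p"
        using M[of p] N[of p] unfolding k_def by (cases "norm p > N") auto
      have "(\<lambda>n. h n p) \<longlonglongrightarrow> f p"
        by (subst fp, unfold h_def) (intro tendsto_mult tendsto_max tendsto_min tendsto_const lim[OF elim])
      then have "(\<lambda>n. (f p - h n p)\<^sup>2) \<longlonglongrightarrow> (f p - f p)\<^sup>2" by (intro tendsto_intros)
      then show ?case by (intro tendsto_ennrealI) simp
    qed
  qed measurable
  then have "(\<lambda>n. \<integral>\<^sup>+p. ennreal ((f p - h n p)\<^sup>2) \<partial>lborel) \<longlonglongrightarrow> 0" by simp
  then have "eventually (\<lambda>n. (sq_norm (\<lambda>p. f p - h n p)) < \<epsilon>) sequentially"
    using \<open>\<epsilon> > 0\<close> by (rule order_tendstoD)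
  then obtain n where "(sq_norm (\<lambda>p. f p - h n p)) < \<epsilon>"
    by (auto simp: eventually_sequentially)
  with ch ih hM show ?thesis by (intro that) auto
qed

lemma L2_approx:
  fixes f :: "pt \<Rightarrow> real"
  assumes [measurable]: "f \<in> borel_measurable borel" and f: "(sq_norm f) < \<infinity>"
    and "\<epsilon> > 0"
  obtains g M where "continuous_on UNIV g" "integrable lborel g" "\<forall>p. \<bar>g p\<bar> \<le> M"
     "(sq_norm (\<lambda>p. f p - g p)) < ennreal \<epsilon>"
proof -
  define h where "h n p = max (- real n) (min (real n) (f p)) * indicator (cball 0 (real n)) p" for n p
  have [measurable]: "cball (0::pt) r \<in> sets borel" for r by (simp add: borel_closed)
  have [measurable]: "h n \<in> borel_measurable borel" for n unfolding h_def by measurable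
  have hn: "\<bar>h n p\<bar> \<le> real n" for n p unfolding h_def by (auto simp: indicator_def)
  have h0: "h n p = 0" if "norm p > real n" for n p using that unfolding h_def by (auto simp: indicator_def)
  have hf: "\<bar>f p - h n p\<bar> \<le> \<bar>f p\<bar>" for n p unfolding h_def by (auto simp: indicator_def)
  have "(\<lambda>n. \<integral>\<^sup>+p. ennreal ((f p - h n p)\<^sup>2) \<partial>lborel) \<longlonglongrightarrow> (\<integral>\<^sup>+p. ennreal 0 \<partial>(lborel::pt measure))"
  proof (rule nn_integral_dominated_convergence[where w="\<lambda>p. ennreal ((f p)\<^sup>2)"])
    show "(sq_norm f) < \<infinity>" by (fact f)
    show "AE p in lborel. ennreal ((f p - h n p)\<^sup>2) \<le> ennreal ((f p)\<^sup>2)" for n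
      using hf[of _ n] by (auto intro!: always_eventually ennreal_leI simp: abs_le_square_iff)
    show "AE p in lborel. (\<lambda>n. ennreal ((f p - h n p)\<^sup>2)) \<longlonglongrightarrow> ennreal 0"
    proof (rule always_eventually, rule allI, rule tendsto_eventually)
      fix p
      obtain N :: nat where N: "max \<bar>f p\<bar> (norm p) \<le> real N" using real_arch_simple by blast
      have "h n p = f p" if "n \<ge> N" for n using that N unfolding h_def by (auto simp: indicator_def)
      then show "eventually (\<lambda>n. ennreal ((f p - h n p)\<^sup>2) = ennreal 0) sequentially"
        unfolding eventually_sequentially by (intro exI[of _ N]) auto
    qed
  qed measurable
  then have L: "(\<lambda>n. \<integral>\<^sup>+p. ennreal ((f p - h n p)\<^sup>2) \<partial>lborel) \<longlonglongrightarrow> 0" by simp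
  \<comment> \<open>The inequality for squares of sums doubles each of the two errors, so each may
    be a quarter of the total.\<close>
  have e4: "0 < ennreal (\<epsilon> / 4)" using \<open>\<epsilon> > 0\<close> by simp
  from order_tendstoD(2)[OF L e4] obtain n where n: "(sq_norm (\<lambda>p. f p - h n p)) < ennreal (\<epsilon> / 4)"
    by (auto simp: eventually_sequentially)
  obtain g where g: "continuous_on UNIV g" "integrable lborel g" "\<forall>p. \<bar>g p\<bar> \<le> real n"
     "(sq_norm (\<lambda>p. h n p - g p)) < ennreal (\<epsilon> / 4)"
    by (rule L2_approx_bounded[OF \<open>h n \<in> borel_measurable borel\<close> hn h0 e4])
  have [measurable]: "g \<in> borel_measurable borel" using g by auto
  have "(sq_norm (\<lambda>p. f p - g p)) \<le> 2 * (sq_norm (\<lambda>p. f p - h n p)) + 2 * (sq_norm (\<lambda>p. h n p - g p))"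
    by (rule nn_integral_power2_sum_le) auto
  also have "\<dots> < 2 * (ennreal (\<epsilon> / 4)) + 2 * (ennreal (\<epsilon> / 4))"
    using n g(4) \<open>\<epsilon> > 0\<close> by (intro add_strict_mono ennreal_mult_strict_left_mono) auto
  also have "\<dots> = ennreal \<epsilon>"
    using \<open>\<epsilon> > 0\<close> ennreal_mult[of 2 "\<epsilon> / 4"] ennreal_plus[of "\<epsilon> / 2" "\<epsilon> / 2"] by simp
  finally show ?thesis using that g by blast
qed

text \<open>The factor 4 is the price of approximating by continuous functions with only the upper bound available for the error term.\<close>

lemma plancherel_ge:
  assumes f: "integrable lborel f" and f2: "(sq_norm f) < \<infinity>"
  shows "ennreal ((2 * pi)\<^sup>2) * (sq_norm f) \<le> 4 * (sq_norm (\<lambda>\<xi>. cmod (ft f \<xi>)))"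
proof (rule ennreal_le_epsilon)
  fix e :: real assume e: "0 < e"
  let ?c = "ennreal ((2 * pi)\<^sup>2)"
  have [measurable]: "f \<in> borel_measurable borel" using f by auto
  \<comment> \<open>The error of replacing f by g enters twice: with factor 2 in the norm of f, and
    with factor 2 * 2 in the transform of g. Together this is six times (2 pi)^2 d.\<close>
  define d where "d = e / (6 * (2 * pi)\<^sup>2)"
  have d: "0 < d" using e by (simp add: d_def)
  obtain g M where g: "continuous_on UNIV g" "integrable lborel g" "\<forall>p. \<bar>g p\<bar> \<le> M"
     "(sq_norm (\<lambda>p. f p - g p)) < ennreal d"
    by (rule L2_approx[OF \<open>f \<in> borel_measurable borel\<close> f2 d])
  have [measurable]: "g \<in> borel_measurable borel" using g by auto
  have "?c * (sq_norm f) \<le> ?c * (2 * (sq_norm (\<lambda>p. f p - g p)) + 2 * (sq_norm g))"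
    by (intro mult_left_mono nn_integral_power2_sum_le) auto
  also have "\<dots> = 2 * (?c * (sq_norm (\<lambda>p. f p - g p))) + 2 * (?c * (sq_norm g))"
    by (simp add: algebra_simps)
  also have "\<dots> \<le> 2 * (?c * ennreal d) + 2 * (2 * (sq_norm (\<lambda>\<xi>. cmod (ft f \<xi>))) + 2 * (?c * ennreal d))"
  proof (intro add_mono mult_left_mono)
    have "?c * (sq_norm g) \<le> (sq_norm (\<lambda>\<xi>. cmod (ft g \<xi>)))"
      using g by (intro plancherel_ge_continuous[where M=M]) auto
    also have "\<dots> \<le> 2 * (sq_norm (\<lambda>\<xi>. cmod (ft f \<xi>))) + 2 * (sq_norm (\<lambda>\<xi>. cmod (ft (\<lambda>p. f p - g p) \<xi>)))"
    proof (intro nn_integral_power2_sum_le)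
      show "\<bar>cmod (ft g \<xi>)\<bar> \<le> \<bar>cmod (ft f \<xi>)\<bar> + \<bar>cmod (ft (\<lambda>p. f p - g p) \<xi>)\<bar>" for \<xi>
        using norm_triangle_ineq4[of "ft f \<xi>" "ft f \<xi> - ft g \<xi>"] by (simp add: ft_diff[OF f g(2)])
    qed measurable
    also have "\<dots> \<le> 2 * (sq_norm (\<lambda>\<xi>. cmod (ft f \<xi>))) + 2 * (?c * ennreal d)"
      using g(4) f g(2) by (intro add_mono mult_left_mono order_refl order_trans[OF plancherel_le]) auto
    finally show "?c * (sq_norm g) \<le> \<dots>" .
  qed (use g(4) in auto)
  also have "\<dots> = 4 * (sq_norm (\<lambda>\<xi>. cmod (ft f \<xi>))) + 6 * (?c * ennreal d)"
  proof -
    have "2 * y + 2 * (2 * x + 2 * y) = (2 * 2) * x + (2 + 2 * 2) * y" for x y :: ennreal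
      by (simp only: distrib_left distrib_right mult.assoc add_ac)
    then show ?thesis by simp
  qed
  also have "6 * (?c * ennreal d) = ennreal (6 * ((2 * pi)\<^sup>2 * d))"
    using ennreal_mult[of 6 "(2 * pi)\<^sup>2 * d"] ennreal_mult[of "(2 * pi)\<^sup>2" d] d by simp
  also have "6 * ((2 * pi)\<^sup>2 * d) = e" by (simp add: d_def)
  finally show "?c * (sq_norm f) \<le> 4 * (sq_norm (\<lambda>\<xi>. cmod (ft f \<xi>))) + ennreal e" .
qed

section \<open>Differences and primitives as Fourier multipliers\<close>

definition shiftx :: "real \<Rightarrow> (pt \<Rightarrow> real) \<Rightarrow> pt \<Rightarrow> real" where
  "shiftx k f p = f (p + (k, 0)) - f p"

definition shifty :: "real \<Rightarrow> (pt \<Rightarrow> real) \<Rightarrow> pt \<Rightarrow> real" where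
  "shifty h f p = f (p + (0, h)) - f p"

definition primx :: "real \<Rightarrow> (pt \<Rightarrow> real) \<Rightarrow> pt \<Rightarrow> real" where
  "primx k f p = (LINT s|lborel. indicator {0..k} s * f (p + (s, 0)))"

text \<open>The Fourier multiplier of \<open>primx k\<close>. The integral form has no singularity
  at t = 0, where the closed form (exp(ikt) - 1)/(it) of \<open>mprim_eq\<close> breaks
  down.\<close>

definition mprim :: "real \<Rightarrow> real \<Rightarrow> complex" where
  "mprim k t = (LINT s|lborel. indicator {0..k} s *\<^sub>R cis (s * t))"

lemma Pair_measurable2 [measurable (raw)]:
  fixes f g :: "'a \<Rightarrow> real"
  assumes "f \<in> borel_measurable M" "g \<in> borel_measurable M"
  shows "(\<lambda>x. (f x, g x)) \<in> borel_measurable M"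
  using measurable_Pair[OF assms] by (simp add: borel_prod)

lemma fst_plane_measurable [measurable (raw)]:
  fixes f :: "'a \<Rightarrow> pt"
  assumes "f \<in> borel_measurable M" shows "(\<lambda>x. fst (f x)) \<in> borel_measurable M"
  by (rule borel_measurable_continuous_on[OF _ assms]) (intro continuous_intros)

lemma snd_plane_measurable [measurable (raw)]:
  fixes f :: "'a \<Rightarrow> pt"
  assumes "f \<in> borel_measurable M" shows "(\<lambda>x. snd (f x)) \<in> borel_measurable M"
  by (rule borel_measurable_continuous_on[OF _ assms]) (intro continuous_intros)

lemma shiftx_measurable [measurable]:
  assumes [measurable]: "f \<in> borel_measurable borel"
  shows "shiftx k f \<in> borel_measurable borel"
  unfolding shiftx_def by measurable

lemma shifty_measurable [measurable]:
  assumes [measurable]: "f \<in> borel_measurable borel"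
  shows "shifty k f \<in> borel_measurable borel"
  unfolding shifty_def by measurable

text \<open>Joint measurability in the length and the point is what Fubini asks for once k becomes
  an integration variable.\<close>

lemma primx_measurable2:
  assumes [measurable]: "f \<in> borel_measurable borel"
  shows "(\<lambda>(k, p). primx k f p) \<in> borel_measurable (borel \<Otimes>\<^sub>M borel)"
proof -
  have [measurable]: "Measurable.pred ((borel \<Otimes>\<^sub>M borel) \<Otimes>\<^sub>M borel) (\<lambda>x::(real \<times> pt) \<times> real. snd x \<in> {0..fst (fst x)})"
    unfolding atLeastAtMost_iff by measurable
  show ?thesis
    unfolding primx_def indicator_def case_prod_beta' by measurable
qed

lemma primx_measurable [measurable]:
  assumes [measurable]: "f \<in> borel_measurable borel"
  shows "primx k f \<in> borel_measurable borel"
  using measurable_compose[OF _ primx_measurable2[OF assms], of "\<lambda>p. (k, p)" borel] by simp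

lemma mprim_measurable [measurable]: "mprim k \<in> borel_measurable borel"
  unfolding mprim_def by measurable

lemma mprim_eq:
  assumes "t \<noteq> 0" "k \<ge> 0"
  shows "mprim k t = (cis (k * t) - 1) / (\<i> * t)"
proof -
  have ii: "- (\<i> * (E * \<i>)) = E" for E :: complex
  proof -
    have "\<i> * (E * \<i>) = (\<i> * \<i>) * E" by (simp only: mult_ac)
    then show ?thesis by simp
  qed
  have "((\<lambda>s. cis (s * t)) has_integral (cis (k * t) / (\<i> * t) - cis (0 * t) / (\<i> * t))) {0..k}"
  proof (rule fundamental_theorem_of_calculus[OF assms(2)])
    fix x assume "x \<in> {0..k}"
    show "((\<lambda>s. cis (s * t) / (\<i> * t)) has_vector_derivative cis (x * t)) (at x within {0..k})"
    proof -
      have "((\<lambda>z. exp (\<i> * (z * t)) / (\<i> * t)) has_field_derivative exp (\<i> * (of_real x * t))) (at (of_real x))"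
      proof (rule DERIV_cong)
        show "((\<lambda>z. exp (\<i> * (z * t)) / (\<i> * t)) has_field_derivative exp (\<i> * (of_real x * t)) * (\<i> * t) / (\<i> * t)) (at (of_real x))"
          using assms(1) by (auto intro!: derivative_eq_intros simp: ii)
      qed (use assms(1) in \<open>simp add: ii\<close>)
      from has_vector_derivative_real_field[OF this] show ?thesis unfolding cis_conv_exp by simp
    qed
  qed
  moreover have "set_integrable lborel {0..k} (\<lambda>s. cis (s * t))"
    unfolding set_integrable_def by (intro borel_integrable_compact continuous_intros) auto
  then have "((\<lambda>s. cis (s * t)) has_integral (LINT s:{0..k}|lborel. cis (s * t))) {0..k}"
    by (simp add: set_borel_integral_eq_integral integrable_integral)
  ultimately have "mprim k t = cis (k * t) / (\<i> * t) - cis (0 * t) / (\<i> * t)"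
    unfolding mprim_def set_lebesgue_integral_def by (rule has_integral_unique[rotated])
  then show ?thesis by (simp add: diff_divide_distrib)
qed

lemma cmod_cis_minus_one: "(cmod (cis a - 1))\<^sup>2 = 4 * (sin (a / 2))\<^sup>2"
proof -
  have "cos a = 1 - 2 * (sin (a / 2))\<^sup>2" using cos_double_sin[of "a / 2"] by simp
  moreover have "(cmod (cis a - 1))\<^sup>2 = (cos a - 1)\<^sup>2 + (sin a)\<^sup>2" by (simp add: cmod_power2)
  moreover have "\<dots> = 2 - 2 * cos a" using sin_cos_squared_add[of a] by (simp add: power2_diff)
  ultimately show ?thesis by simp
qed

lemma cmod_cis_minus_one_le: "(cmod (cis a - 1))\<^sup>2 \<le> a\<^sup>2" "(cmod (cis a - 1))\<^sup>2 \<le> 4"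
proof -
  have "(sin (a / 2))\<^sup>2 \<le> (a / 2)\<^sup>2" using abs_sin_x_le_abs_x[of "a / 2"] by (simp only: abs_le_square_iff)
  then show "(cmod (cis a - 1))\<^sup>2 \<le> a\<^sup>2" unfolding cmod_cis_minus_one by (simp add: power_divide)
  show "(cmod (cis a - 1))\<^sup>2 \<le> 4" unfolding cmod_cis_minus_one using abs_sin_le_one[of "a / 2"] by (simp add: abs_square_le_1)
qed

text \<open>The imaginary part alone suffices, since |sin a| is at least |a|/2 on [-1, 1]. This
  lower bound serves twice: for the half derivative in x (\<open>gagliardo_lower\<close>) and to
  recover the y-derivative from its difference quotients (\<open>vertical_limit\<close>).\<close>

lemma cmod_cis_minus_one_ge:
  assumes "\<bar>a\<bar> \<le> 1" shows "a\<^sup>2 / 4 \<le> (cmod (cis a - 1))\<^sup>2"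
proof -
  have *: "a / 2 \<le> sin a" if "0 \<le> a" "a \<le> 1" for a :: real
  proof -
    have "sin 0 - 0 / 2 \<le> sin a - a / 2"
    proof (rule DERIV_nonneg_imp_nondecreasing[OF that(1)])
      fix x assume x: "0 \<le> x" "x \<le> a"
      \<comment> \<open>As pi > 3, the interval [0, 1] lies within [0, pi/3], where the cosine is at
        least 1/2.\<close>
      have "cos (pi / 3) \<le> cos x" using x that pi_gt3 by (intro cos_monotone_0_pi_le) auto
      then have "0 \<le> cos x - 1 / 2" by (simp add: cos_60)
      then show "\<exists>y. ((\<lambda>x. sin x - x / 2) has_real_derivative y) (at x) \<and> 0 \<le> y"
        by (intro exI[of _ "cos x - 1 / 2"]) (auto intro!: derivative_eq_intros)
    qed
    then show ?thesis by simp
  qed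
  have "\<bar>a\<bar> / 2 \<le> \<bar>sin a\<bar>"
    using *[of a] *[of "- a"] assms by (cases "a \<ge> 0") auto
  then have "(\<bar>a\<bar> / 2)\<^sup>2 \<le> (\<bar>sin a\<bar>)\<^sup>2" by (intro power_mono) auto
  also have "\<dots> \<le> (cmod (cis a - 1))\<^sup>2" by (simp add: cmod_power2)
  finally show ?thesis by (simp add: power_divide)
qed

section \<open>The Gagliardo integral representing the multiplier |\<xi>|\<close>

lemma nn_integral_inverse_square:
  assumes "c > 0"
  shows "(\<integral>\<^sup>+k. ennreal (1 / k\<^sup>2) * indicator {c..} k \<partial>lborel) = ennreal (1 / c)"
proof -
  have "(\<integral>\<^sup>+k. ennreal (1 / k\<^sup>2) * indicator {c..} k \<partial>lborel) = ennreal (0 - (- 1 / c))"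
  proof (rule nn_integral_FTC_atLeast)
    show "DERIV (\<lambda>x. - 1 / x) x :> 1 / x\<^sup>2" if "c \<le> x" for x
      using that assms by (auto intro!: derivative_eq_intros simp: power2_eq_square field_simps)
    have "((\<lambda>x::real. - inverse x) \<longlongrightarrow> - 0) at_top" by (intro tendsto_intros tendsto_inverse_0_at_top filterlim_ident)
    then show "((\<lambda>x::real. - 1 / x) \<longlongrightarrow> 0) at_top" by (simp add: divide_inverse)
  qed auto
  then show ?thesis by simp
qed

text \<open>By scaling the integral is a multiple of |t|. Splitting at k = 1/|t|, the quadratic
  bound contributes |t| below this scale and the uniform bound 4 contributes 4|t| above it.\<close>

lemma gagliardo_upper:
  "(\<integral>\<^sup>+k. indicator {0<..} k * ennreal ((cmod (cis (k * t) - 1))\<^sup>2 / k\<^sup>2) \<partial>lborel) \<le> ennreal (5 * \<bar>t\<bar>)"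
proof (cases "t = 0")
  case False
  define c where "c = 1 / \<bar>t\<bar>"
  have c: "c > 0" using False by (simp add: c_def)
  have "(\<integral>\<^sup>+k. indicator {0<..} k * ennreal ((cmod (cis (k * t) - 1))\<^sup>2 / k\<^sup>2) \<partial>lborel)
     \<le> (\<integral>\<^sup>+k. ennreal (t\<^sup>2) * indicator {0..c} k + 4 * (ennreal (1 / k\<^sup>2) * indicator {c..} k) \<partial>lborel)"
  proof (intro nn_integral_mono)
    fix k :: real
    show "indicator {0<..} k * ennreal ((cmod (cis (k * t) - 1))\<^sup>2 / k\<^sup>2) \<le> ennreal (t\<^sup>2) * indicator {0..c} k + 4 * (ennreal (1 / k\<^sup>2) * indicator {c..} k)"
    proof (cases "k \<le> 0")
      case False
      consider "k \<le> c" | "c \<le> k" by linarith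
      then show ?thesis
      proof cases
        case 1
        have "(cmod (cis (k * t) - 1))\<^sup>2 / k\<^sup>2 \<le> (k * t)\<^sup>2 / k\<^sup>2" by (intro divide_right_mono cmod_cis_minus_one_le) simp
        also have "\<dots> = t\<^sup>2" using False by (simp add: power_mult_distrib)
        finally have "ennreal ((cmod (cis (k * t) - 1))\<^sup>2 / k\<^sup>2) \<le> ennreal (t\<^sup>2)" by (rule ennreal_leI)
        then show ?thesis using 1 False by (auto intro: add_increasing2)
      next
        case 2
        have "(cmod (cis (k * t) - 1))\<^sup>2 / k\<^sup>2 \<le> 4 / k\<^sup>2" by (intro divide_right_mono cmod_cis_minus_one_le) simp
        then have "ennreal ((cmod (cis (k * t) - 1))\<^sup>2 / k\<^sup>2) \<le> ennreal (4 * (1 / k\<^sup>2))" by (intro ennreal_leI) simp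
        also have "\<dots> = 4 * ennreal (1 / k\<^sup>2)" by (subst ennreal_mult) auto
        finally show ?thesis using 2 False by (auto intro: add_increasing)
      qed
    qed simp
  qed
  also have "\<dots> = ennreal (t\<^sup>2) * ennreal c + 4 * ennreal (1 / c)"
    using c by (subst nn_integral_add) (auto simp: nn_integral_cmult nn_integral_inverse_square)
  also have "\<dots> = ennreal (t\<^sup>2 * c + 4 * (1 / c))"
    using c ennreal_mult[of 4 "1 / c"] by (simp add: ennreal_mult)
  also have "t\<^sup>2 * c + 4 * (1 / c) = 5 * \<bar>t\<bar>"
    using False by (simp add: c_def power2_eq_square field_simps)
  finally show ?thesis .
qed simp

text \<open>The range k \<le> 1/|t| is enough: there the integrand is at least t^2/4.\<close>

lemma gagliardo_lower:
  "ennreal \<bar>t\<bar> \<le> 4 * (\<integral>\<^sup>+k. indicator {0<..} k * ennreal ((cmod (cis (k * t) - 1))\<^sup>2 / k\<^sup>2) \<partial>lborel)"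
proof (cases "t = 0")
  case False
  define c where "c = 1 / \<bar>t\<bar>"
  have c: "c > 0" using False by (simp add: c_def)
  have "ennreal (t\<^sup>2 / 4) * ennreal c = (\<integral>\<^sup>+k. ennreal (t\<^sup>2 / 4) * indicator {0<..c} k \<partial>lborel)"
    using c by (simp add: nn_integral_cmult)
  also have "\<dots> \<le> (\<integral>\<^sup>+k. indicator {0<..} k * ennreal ((cmod (cis (k * t) - 1))\<^sup>2 / k\<^sup>2) \<partial>lborel)"
  proof (intro nn_integral_mono)
    fix k :: real
    show "ennreal (t\<^sup>2 / 4) * indicator {0<..c} k \<le> indicator {0<..} k * ennreal ((cmod (cis (k * t) - 1))\<^sup>2 / k\<^sup>2)"
    proof (cases "k \<in> {0<..c}")
      case True
      then have "\<bar>k * t\<bar> \<le> 1" using False by (simp add: c_def abs_mult field_simps)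
      then have "(k * t)\<^sup>2 / 4 / k\<^sup>2 \<le> (cmod (cis (k * t) - 1))\<^sup>2 / k\<^sup>2"
        by (intro divide_right_mono cmod_cis_minus_one_ge) auto
      then show ?thesis using True by (auto simp: power_mult_distrib intro!: ennreal_leI)
    qed simp
  qed
  finally have "4 * (ennreal (t\<^sup>2 / 4) * ennreal c) \<le> 4 * (\<integral>\<^sup>+k. indicator {0<..} k * ennreal ((cmod (cis (k * t) - 1))\<^sup>2 / k\<^sup>2) \<partial>lborel)"
    by (rule mult_left_mono) simp
  moreover have "4 * (ennreal (t\<^sup>2 / 4) * ennreal c) = ennreal (4 * (t\<^sup>2 / 4 * c))"
    using c ennreal_mult[of 4 "t\<^sup>2 / 4 * c"] ennreal_mult[of "t\<^sup>2 / 4" c] by simp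
  moreover have "4 * (t\<^sup>2 / 4 * c) = \<bar>t\<bar>"
    using False by (simp add: c_def power2_eq_square field_simps)
  ultimately show ?thesis by simp
qed simp

lemma mprim_norm_sq:
  assumes "t \<noteq> 0" "k \<ge> 0"
  shows "(cmod (mprim k t))\<^sup>2 = (cmod (cis (k * t) - 1))\<^sup>2 / t\<^sup>2"
  by (simp add: mprim_eq[OF assms] norm_divide norm_mult power_divide)

lemma mprim_bound:
  assumes "k \<ge> 0" shows "cmod (mprim k t) \<le> k"
proof -
  have "cmod (mprim k t) \<le> (LINT s|lborel. norm (indicator {0..k} s *\<^sub>R cis (s * t) :: complex))"
    unfolding mprim_def by (rule integral_norm_bound)
  also have "\<dots> = (LINT s|lborel. indicator {0..k} s)" by (simp add: norm_scaleR)
  finally show ?thesis using assms by simp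
qed

lemma lborel_psf: "pair_sigma_finite (lborel :: 'a::euclidean_space measure) (lborel :: 'b::euclidean_space measure)"
  by (intro pair_sigma_finite.intro sigma_finite_lborel)

lemma integral_scaleR_left_complex:
  "(LINT s|M. g s *\<^sub>R (c :: complex)) = (LINT s|M. g s) *\<^sub>R c"
  by (simp only: scaleR_conv_of_real integral_mult_left_zero integral_complex_of_real)

text \<open>Cauchy-Schwarz against the indicator of S, phrased in \<open>ennreal\<close> so that it
  is also meaningful when the right side is infinite.\<close>

lemma integral_square_le:
  fixes w :: "'a \<Rightarrow> real"
  assumes [measurable]: "w \<in> borel_measurable M" "S \<in> sets M"
  shows "ennreal ((LINT s|M. indicator S s * w s)\<^sup>2) \<le> emeasure M S * (\<integral>\<^sup>+s. indicator S s * ennreal ((w s)\<^sup>2) \<partial>M)"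
proof -
  have "ennreal ((LINT s|M. indicator S s * w s)\<^sup>2) = (ennreal \<bar>LINT s|M. indicator S s * w s\<bar>)\<^sup>2"
    by (simp add: ennreal_power)
  also have "\<dots> \<le> (\<integral>\<^sup>+s. ennreal \<bar>indicator S s * w s\<bar> \<partial>M)\<^sup>2"
    by (intro power_mono ennreal_abs_integral_le) simp
  also have "\<dots> = (\<integral>\<^sup>+s. indicator S s * (indicator S s * ennreal \<bar>w s\<bar>) \<partial>M)\<^sup>2"
    by (intro arg_cong[of _ _ "\<lambda>x. x\<^sup>2"] nn_integral_cong) (auto simp: indicator_def)
  also have "\<dots> \<le> (\<integral>\<^sup>+s. (indicator S s)\<^sup>2 \<partial>M) * (\<integral>\<^sup>+s. (indicator S s * ennreal \<bar>w s\<bar>)\<^sup>2 \<partial>M)"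
    by (rule Cauchy_Schwarz_nn_integral) measurable
  also have "(\<integral>\<^sup>+s. (indicator S s)\<^sup>2 \<partial>M) = (\<integral>\<^sup>+s. indicator S s \<partial>M)"
    by (intro nn_integral_cong) (auto simp: indicator_def)
  also have "(\<integral>\<^sup>+s. (indicator S s * ennreal \<bar>w s\<bar>)\<^sup>2 \<partial>M) = (\<integral>\<^sup>+s. indicator S s * ennreal ((w s)\<^sup>2) \<partial>M)"
    by (intro nn_integral_cong) (auto simp: indicator_def ennreal_power)
  finally show ?thesis by simp
qed

text \<open>The class in which \<open>ft\<close> is an absolutely convergent integral and both
  Plancherel inequalities apply; \<open>shiftx\<close>, \<open>shifty\<close> and
  \<open>primx\<close> preserve it.\<close>

definition L12 :: "(pt \<Rightarrow> real) \<Rightarrow> bool" where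
  "L12 f \<longleftrightarrow> integrable lborel f \<and> (sq_norm f) < \<infinity>"

lemma L12_measurable: "L12 f \<Longrightarrow> f \<in> borel_measurable borel"
  unfolding L12_def by auto

lemma nn_integral_translate_plane':
  fixes F :: "pt \<Rightarrow> ennreal"
  assumes [measurable]: "F \<in> borel_measurable borel"
  shows "(\<integral>\<^sup>+q. F (q + p) \<partial>lborel) = (\<integral>\<^sup>+q. F q \<partial>lborel)"
  using nn_integral_translate_plane[OF assms, of p] by (simp add: add.commute)

lemma integrable_translate:
  assumes "integrable lborel f"
  shows "integrable lborel (\<lambda>p::pt. f (p + v) :: real)"
proof -
  have [measurable]: "f \<in> borel_measurable borel" using assms by auto
  show ?thesis using assms nn_integral_translate_plane'[of "\<lambda>p. ennreal (norm (f p))" v]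
    unfolding integrable_iff_bounded by auto
qed

lemma L12_translate:
  assumes "L12 f" shows "L12 (\<lambda>p. f (p + v))"
  using assms integrable_translate[of f v] nn_integral_translate_plane'[of "\<lambda>p. ennreal ((f p)\<^sup>2)" v] L12_measurable[OF assms]
  unfolding L12_def by auto

lemma ft_translate:
  assumes "integrable lborel f"
  shows "ft (\<lambda>p. f (p + v)) \<xi> = cis (v \<bullet> \<xi>) * ft f \<xi>"
proof -
  have [measurable]: "f \<in> borel_measurable borel" using assms by auto
  have "cis (v \<bullet> \<xi>) * ft f \<xi> = (LINT q|lborel. f q *\<^sub>R cis (- ((q - v) \<bullet> \<xi>)))"
    unfolding ft_def integral_mult_right_zero[symmetric]
    by (intro Bochner_Integration.integral_cong refl) (simp add: cis_mult inner_diff_left)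
  also have "\<dots> = (LINT q|lborel. f (v + q) *\<^sub>R cis (- (q \<bullet> \<xi>)))"
    by (subst integral_affine_plane[where c=1 and p=v]) simp_all
  finally show ?thesis by (simp add: ft_def add.commute)
qed

lemma L12_diff:
  assumes f: "L12 f" and g: "L12 g"
  shows "L12 (\<lambda>p. f p - g p)"
proof -
  note [measurable] = L12_measurable[OF f] L12_measurable[OF g]
  have "(sq_norm (\<lambda>p. f p - g p)) \<le> 2 * (sq_norm f) + 2 * (sq_norm g)"
    by (rule nn_integral_power2_sum_le) auto
  also have "\<dots> < \<infinity>" using f g by (auto simp: L12_def ennreal_mult_less_top)
  finally show ?thesis using f g by (auto simp: L12_def)
qed

lemma L12_shiftx: "L12 f \<Longrightarrow> L12 (shiftx k f)"
  unfolding shiftx_def by (intro L12_diff L12_translate)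

lemma L12_shifty: "L12 f \<Longrightarrow> L12 (shifty k f)"
  unfolding shifty_def by (intro L12_diff L12_translate)

lemma ft_shiftx: "integrable lborel f \<Longrightarrow> ft (shiftx k f) \<xi> = (cis (k * fst \<xi>) - 1) * ft f \<xi>"
  unfolding shiftx_def by (simp add: ft_diff integrable_translate ft_translate inner_prod_def algebra_simps)

lemma ft_shifty: "integrable lborel f \<Longrightarrow> ft (shifty k f) \<xi> = (cis (k * snd \<xi>) - 1) * ft f \<xi>"
  unfolding shifty_def by (simp add: ft_diff integrable_translate ft_translate inner_prod_def algebra_simps)

lemma primx_square_le:
  assumes [measurable]: "f \<in> borel_measurable borel" and "k \<ge> 0"
  shows "ennreal ((primx k f p)\<^sup>2) \<le> ennreal k * (\<integral>\<^sup>+s. indicator {0..k} s * ennreal ((f (p + (s, 0)))\<^sup>2) \<partial>lborel)"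
  unfolding primx_def using integral_square_le[of "\<lambda>s. f (p + (s, 0))" lborel "{0..k}"] assms(2) by simp

lemma primx_integrable_pair:
  fixes f :: "pt \<Rightarrow> real"
  assumes f: "integrable lborel f" and "k \<ge> 0"
  shows "integrable (lborel \<Otimes>\<^sub>M lborel) (\<lambda>(s, p). indicator {0..k} s * f (p + (s, 0)))"
proof (rule pair_sigma_finite.Fubini_integrable[OF lborel_psf])
  have [measurable]: "f \<in> borel_measurable borel" using f by auto
  show "(\<lambda>(s, p). indicator {0..k} s * f (p + (s, 0))) \<in> borel_measurable (lborel \<Otimes>\<^sub>M lborel)" by measurable
  have "(LINT p|lborel. norm (indicator {0..k} s * f (p + (s, 0)))) = indicator {0..k} s * (LINT p|lborel. \<bar>f p\<bar>)" for s
  proof -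
    have "(LINT p|lborel. \<bar>f (p + (s, 0))\<bar>) = (LINT p|lborel. \<bar>f p\<bar>)"
      using integral_affine_plane[of "\<lambda>p. \<bar>f p\<bar>" 1 "(s, 0)"] by (simp add: add.commute)
    then show ?thesis by (simp add: abs_mult)
  qed
  then show "integrable lborel (\<lambda>s. LINT p|lborel. norm (case (s, p) of (s, p) \<Rightarrow> indicator {0..k} s * f (p + (s, 0))))"
    using integrable_real_indicator[of "{0..k}" lborel] by (simp add: emeasure_lborel_Icc_eq)
  show "AE s in lborel. integrable lborel (\<lambda>p. case (s, p) of (s, p) \<Rightarrow> indicator {0..k} s * f (p + (s, 0)))"
    using integrable_translate[OF f] by simp
qed

text \<open>Cauchy-Schwarz in s costs one factor k, and integrating the translates over the interval
  of length k costs the other.\<close>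

lemma nn_integral_primx_square_le:
  assumes [measurable]: "f \<in> borel_measurable borel" and "k \<ge> 0"
  shows "(sq_norm (primx k f)) \<le> ennreal (k\<^sup>2) * (sq_norm f)"
proof -
  have "(sq_norm (primx k f)) \<le> (\<integral>\<^sup>+p. ennreal k * (\<integral>\<^sup>+s. indicator {0..k} s * ennreal ((f (p + (s, 0)))\<^sup>2) \<partial>lborel) \<partial>lborel)"
    by (intro nn_integral_mono primx_square_le assms)
  also have "\<dots> = ennreal k * (\<integral>\<^sup>+p. (\<integral>\<^sup>+s. indicator {0..k} s * ennreal ((f (p + (s, 0)))\<^sup>2) \<partial>lborel) \<partial>lborel)"
    by (rule nn_integral_cmult) measurable
  also have "(\<integral>\<^sup>+p. (\<integral>\<^sup>+s. indicator {0..k} s * ennreal ((f (p + (s, 0)))\<^sup>2) \<partial>lborel) \<partial>lborel)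
     = (\<integral>\<^sup>+s. (\<integral>\<^sup>+p. indicator {0..k} s * ennreal ((f (p + (s, 0)))\<^sup>2) \<partial>lborel) \<partial>lborel)"
    by (rule pair_sigma_finite.Fubini'[OF lborel_psf]) measurable
  also have "\<dots> = (\<integral>\<^sup>+s. indicator {0..k} s * (sq_norm f) \<partial>lborel)"
    by (intro nn_integral_cong) (simp add: nn_integral_cmult nn_integral_translate_plane'[of "\<lambda>p. ennreal ((f p)\<^sup>2)"])
  also have "\<dots> = ennreal k * (sq_norm f)"
    using assms(2) by (simp add: nn_integral_multc)
  finally show ?thesis using assms(2) by (simp add: ennreal_mult power2_eq_square mult_ac)
qed

lemma L12_primx:
  assumes f: "L12 f" and "k \<ge> 0"
  shows "L12 (primx k f)"
proof -
  have "integrable lborel (primx k f)"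
    using pair_sigma_finite.integrable_snd[OF lborel_psf primx_integrable_pair[of f k]] assms by (simp add: L12_def primx_def[abs_def])
  moreover have "(sq_norm (primx k f)) < \<infinity>"
    by (rule le_less_trans[OF nn_integral_primx_square_le])
      (use assms L12_measurable in \<open>auto simp: L12_def ennreal_mult_less_top\<close>)
  ultimately show ?thesis by (simp add: L12_def)
qed

lemma ft_primx:
  assumes f: "integrable lborel f" and k: "k \<ge> 0"
  shows "ft (primx k f) \<xi> = mprim k (fst \<xi>) * ft f \<xi>"
proof -
  have [measurable]: "f \<in> borel_measurable borel" using f by auto
  have i: "integrable (lborel \<Otimes>\<^sub>M lborel) (\<lambda>(s, p). (indicator {0..k} s * f (p + (s, 0))) *\<^sub>R cis (- (p \<bullet> \<xi>)))"
    by (rule Bochner_Integration.integrable_bound[OF primx_integrable_pair[OF f k]]) (auto simp: case_prod_beta')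
  have "ft (primx k f) \<xi> = (LINT p|lborel. (LINT s|lborel. (indicator {0..k} s * f (p + (s, 0))) *\<^sub>R cis (- (p \<bullet> \<xi>))))"
    unfolding ft_def primx_def integral_scaleR_left_complex[symmetric] ..
  also have "\<dots> = (LINT s|lborel. (LINT p|lborel. (indicator {0..k} s * f (p + (s, 0))) *\<^sub>R cis (- (p \<bullet> \<xi>))))"
    by (rule pair_sigma_finite.Fubini_integral[OF lborel_psf i])
  also have "\<dots> = (LINT s|lborel. (indicator {0..k} s *\<^sub>R cis (s * fst \<xi>)) * ft f \<xi>)"
  proof (intro Bochner_Integration.integral_cong refl)
    fix s :: real
    have "(LINT p|lborel. (indicator {0..k} s * f (p + (s, 0))) *\<^sub>R cis (- (p \<bullet> \<xi>))) = indicator {0..k} s *\<^sub>R ft (\<lambda>p. f (p + (s, 0))) \<xi>"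
      unfolding ft_def integral_scaleR_right[symmetric] by simp
    then show "(LINT p|lborel. (indicator {0..k} s * f (p + (s, 0))) *\<^sub>R cis (- (p \<bullet> \<xi>))) = (indicator {0..k} s *\<^sub>R cis (s * fst \<xi>)) * ft f \<xi>"
      by (simp add: ft_translate[OF f] inner_prod_def)
  qed
  also have "\<dots> = mprim k (fst \<xi>) * ft f \<xi>"
    unfolding mprim_def by (rule integral_mult_left_zero)
  finally show ?thesis .
qed

section \<open>Transfer from truncations to general square integrable functions\<close>

definition trunc :: "nat \<Rightarrow> (pt \<Rightarrow> real) \<Rightarrow> pt \<Rightarrow> real" where
  "trunc n u p = indicator (cbox (- real n, - real n) (real n, real n)) p * u p"

lemma trunc_fourier_eq: "trunc_fourier u n = ft (trunc n u)"
  unfolding trunc_fourier_def ft_def trunc_def by (auto simp: inner_prod_def)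

lemma trunc_measurable [measurable]:
  assumes [measurable]: "u \<in> borel_measurable borel"
  shows "trunc n u \<in> borel_measurable borel"
  unfolding trunc_def by measurable

lemma L2_nn: "L2 u \<Longrightarrow> (sq_norm u) < \<infinity>"
  unfolding L2_def integrable_iff_bounded by auto

text \<open>On a set of finite measure |u| \<le> 1 + u^2 gives integrability.\<close>

lemma L12_bounded_support:
  fixes u :: "pt \<Rightarrow> real"
  assumes [measurable]: "u \<in> borel_measurable borel" and u: "(sq_norm u) < \<infinity>"
    and B: "bounded B" "B \<in> sets borel" and z: "\<And>p. p \<notin> B \<Longrightarrow> u p = 0"
  shows "L12 u"
proof -
  have "(\<integral>\<^sup>+p. ennreal \<bar>u p\<bar> \<partial>lborel) \<le> (\<integral>\<^sup>+p. indicator B p + ennreal ((u p)\<^sup>2) \<partial>lborel)"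
  proof (intro nn_integral_mono)
    fix p :: pt
    have "\<bar>u p\<bar> \<le> 1 + (u p)\<^sup>2" using sum_squares_bound[of "\<bar>u p\<bar>" 1] by simp
    then have "ennreal \<bar>u p\<bar> \<le> 1 + ennreal ((u p)\<^sup>2)" by (simp flip: ennreal_1 ennreal_plus)
    then show "ennreal \<bar>u p\<bar> \<le> indicator B p + ennreal ((u p)\<^sup>2)" using z[of p] by (cases "p \<in> B") auto
  qed
  also have "\<dots> = emeasure lborel B + (sq_norm u)"
    using B by (subst nn_integral_add) auto
  also have "\<dots> < \<infinity>" using emeasure_bounded_finite[OF B(1)] u by simp
  finally show ?thesis using u unfolding L12_def integrable_iff_bounded by simp
qed

lemma L12_trunc:
  assumes "L2 u" shows "L12 (trunc n u)"
proof (rule L12_bounded_support[where B="cbox (- real n, - real n) (real n, real n)"])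
  have [measurable]: "u \<in> borel_measurable borel" using assms by (simp add: L2_def)
  show "trunc n u \<in> borel_measurable borel" by measurable
  have "(sq_norm (trunc n u)) \<le> (sq_norm u)"
    by (intro nn_integral_mono) (auto simp: trunc_def indicator_def)
  then show "(sq_norm (trunc n u)) < \<infinity>" using L2_nn[OF assms] by simp
qed (auto simp: trunc_def intro: bounded_cbox)

lemma trunc_eq:
  assumes "norm p \<le> real n" shows "trunc n u p = u p"
proof -
  have "\<bar>fst p\<bar> \<le> real n" "\<bar>snd p\<bar> \<le> real n"
    using assms norm_fst_le[of "fst p" "snd p"] norm_snd_le[where x="fst p" and y="snd p"] by auto
  then have "p \<in> cbox (- real n, - real n) (real n, real n)"
    by (cases p) (auto simp: cbox_Pair_eq)
  then show ?thesis by (simp add: trunc_def)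
qed

text \<open>Only the locality of T is used to reach T u from the truncations of u, so T u needs no integrability.\<close>

lemma multiplier_transfer:
  fixes T :: "(pt \<Rightarrow> real) \<Rightarrow> pt \<Rightarrow> real" and m :: "pt \<Rightarrow> complex"
  assumes u: "L2 u" and F: "fourier_L2 u F"
    and T: "\<And>f. L12 f \<Longrightarrow> L12 (T f)" "\<And>f \<xi>. L12 f \<Longrightarrow> ft (T f) \<xi> = m \<xi> * ft f \<xi>"
    and loc: "\<And>p n. norm p + c \<le> real n \<Longrightarrow> T (trunc n u) p = T u p"
    and m [measurable]: "m \<in> borel_measurable borel" and B: "\<And>\<xi>. (cmod (m \<xi>))\<^sup>2 \<le> B"
  shows "ennreal ((2 * pi)\<^sup>2) * (sq_norm (T u)) \<le> 8 * (\<integral>\<^sup>+\<xi>. ennreal ((cmod (m \<xi>))\<^sup>2 * (cmod (F \<xi>))\<^sup>2) \<partial>lborel)"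
proof -
  have [measurable]: "u \<in> borel_measurable borel" using u by (simp add: L2_def)
  have [measurable]: "F \<in> borel_measurable borel" using F by (simp add: fourier_L2_def)
  have [measurable]: "T (trunc n u) \<in> borel_measurable borel" for n
    using T(1)[OF L12_trunc[OF u]] by (rule L12_measurable)
  define W where "W = (\<integral>\<^sup>+\<xi>. ennreal ((cmod (m \<xi>))\<^sup>2 * (cmod (F \<xi>))\<^sup>2) \<partial>lborel)"
  define \<epsilon> where "\<epsilon> n = sq_norm (\<lambda>\<xi>. cmod (F \<xi> - trunc_fourier u n \<xi>))" for n
  have \<epsilon>: "\<epsilon> \<longlonglongrightarrow> 0" using F unfolding fourier_L2_def \<epsilon>_def by simp
  have B0: "0 \<le> B" using B[of 0] zero_le_power2[of "cmod (m 0)"] by linarith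
  \<comment> \<open>The 8 is the factor 4 of \<open>plancherel_ge\<close> times the 2 from splitting
    the truncated transform into F and an error. The bound B on the multiplier is what lets this
    error tend to 0.\<close>
  have step: "ennreal ((2 * pi)\<^sup>2) * (sq_norm (T (trunc n u))) \<le> 8 * W + 8 * (ennreal B * \<epsilon> n)" for n
  proof -
    have L: "L12 (T (trunc n u))" by (intro T(1) L12_trunc u)
    have "ennreal ((2 * pi)\<^sup>2) * (sq_norm (T (trunc n u))) \<le> 4 * (sq_norm (\<lambda>\<xi>. cmod (ft (T (trunc n u)) \<xi>)))"
      using L by (intro plancherel_ge) (auto simp: L12_def)
    also have "(sq_norm (\<lambda>\<xi>. cmod (ft (T (trunc n u)) \<xi>)))
       \<le> 2 * (sq_norm (\<lambda>\<xi>. cmod (m \<xi> * F \<xi>))) + 2 * (sq_norm (\<lambda>\<xi>. cmod (m \<xi> * (F \<xi> - ft (trunc n u) \<xi>))))"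
    proof (rule nn_integral_power2_sum_le)
      fix \<xi>
      have "m \<xi> * ft (trunc n u) \<xi> = m \<xi> * F \<xi> - m \<xi> * (F \<xi> - ft (trunc n u) \<xi>)" by (simp add: algebra_simps)
      then show "\<bar>cmod (ft (T (trunc n u)) \<xi>)\<bar> \<le> \<bar>cmod (m \<xi> * F \<xi>)\<bar> + \<bar>cmod (m \<xi> * (F \<xi> - ft (trunc n u) \<xi>))\<bar>"
        unfolding T(2)[OF L12_trunc[OF u]] using norm_triangle_ineq4 by (metis abs_norm_cancel)
    qed measurable
    also have "(sq_norm (\<lambda>\<xi>. cmod (m \<xi> * F \<xi>))) = W"
      unfolding W_def by (simp add: norm_mult power_mult_distrib)
    also have "(sq_norm (\<lambda>\<xi>. cmod (m \<xi> * (F \<xi> - ft (trunc n u) \<xi>)))) \<le> (\<integral>\<^sup>+\<xi>. ennreal B * ennreal ((cmod (F \<xi> - trunc_fourier u n \<xi>))\<^sup>2) \<partial>lborel)"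
    proof (intro nn_integral_mono)
      fix \<xi>
      have "(cmod (m \<xi> * (F \<xi> - ft (trunc n u) \<xi>)))\<^sup>2 \<le> B * (cmod (F \<xi> - trunc_fourier u n \<xi>))\<^sup>2"
        unfolding norm_mult power_mult_distrib trunc_fourier_eq by (intro mult_right_mono B) simp
      then show "ennreal ((cmod (m \<xi> * (F \<xi> - ft (trunc n u) \<xi>)))\<^sup>2) \<le> ennreal B * ennreal ((cmod (F \<xi> - trunc_fourier u n \<xi>))\<^sup>2)"
        using B0 by (simp flip: ennreal_mult add: ennreal_leI)
    qed
    also have "\<dots> = ennreal B * \<epsilon> n"
      unfolding \<epsilon>_def trunc_fourier_eq by (intro nn_integral_cmult) measurable
    finally show ?thesis by (simp add: distrib_left mult.assoc[symmetric] mult_left_mono)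
  qed
  \<comment> \<open>At a fixed p the values for the truncations are eventually equal to
    \<open>T u p\<close>, so Fatou carries the bound over to \<open>T u\<close>.\<close>
  have "(sq_norm (T u)) = (\<integral>\<^sup>+p. liminf (\<lambda>n. ennreal ((T (trunc n u) p)\<^sup>2)) \<partial>lborel)"
  proof (intro nn_integral_cong lim_imp_Liminf[symmetric])
    fix p :: pt
    obtain N :: nat where N: "norm p + c \<le> real N" using real_arch_simple by blast
    have "eventually (\<lambda>n. ennreal ((T (trunc n u) p)\<^sup>2) = ennreal ((T u p)\<^sup>2)) sequentially"
      unfolding eventually_sequentially
    proof (intro exI allI impI)
      fix n assume "N \<le> n"
      then have "norm p + c \<le> real n" using N by linarith
      then show "ennreal ((T (trunc n u) p)\<^sup>2) = ennreal ((T u p)\<^sup>2)" by (simp add: loc)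
    qed
    then show "(\<lambda>n. ennreal ((T (trunc n u) p)\<^sup>2)) \<longlonglongrightarrow> ennreal ((T u p)\<^sup>2)" by (rule tendsto_eventually)
  qed simp
  also have "\<dots> \<le> liminf (\<lambda>n. \<integral>\<^sup>+p. ennreal ((T (trunc n u) p)\<^sup>2) \<partial>lborel)"
    by (rule nn_integral_liminf) measurable
  finally have "ennreal ((2 * pi)\<^sup>2) * (sq_norm (T u)) \<le> ennreal ((2 * pi)\<^sup>2) * liminf (\<lambda>n. \<integral>\<^sup>+p. ennreal ((T (trunc n u) p)\<^sup>2) \<partial>lborel)"
    by (rule mult_left_mono) simp
  also have "\<dots> = liminf (\<lambda>n. ennreal ((2 * pi)\<^sup>2) * (sq_norm (T (trunc n u))))"
    by (intro Liminf_compose_continuous_mono[symmetric]) (auto intro!: monoI mult_left_mono ennreal_continuous_on_cmult continuous_on_id)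
  also have "\<dots> \<le> liminf (\<lambda>n. 8 * W + 8 * (ennreal B * \<epsilon> n))"
    by (intro Liminf_mono always_eventually allI step)
  also have "\<dots> = 8 * W"
  proof (intro lim_imp_Liminf)
    have "(\<lambda>n. 8 * W + 8 * (ennreal B * \<epsilon> n)) \<longlonglongrightarrow> 8 * W + 8 * (ennreal B * 0)"
      by (intro tendsto_add tendsto_const ennreal_tendsto_cmult \<epsilon>) auto
    then show "(\<lambda>n. 8 * W + 8 * (ennreal B * \<epsilon> n)) \<longlonglongrightarrow> 8 * W" by simp
  qed simp
  finally show ?thesis unfolding W_def .
qed

lemma shiftx_transfer:
  assumes u: "L2 u" and F: "fourier_L2 u F"
  shows "ennreal ((2 * pi)\<^sup>2) * (sq_norm (shiftx k u)) \<le>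
    8 * (\<integral>\<^sup>+\<xi>. ennreal ((cmod (cis (k * fst \<xi>) - 1))\<^sup>2 * (cmod (F \<xi>))\<^sup>2) \<partial>lborel)"
proof (rule multiplier_transfer[OF u F L12_shiftx])
  show "ft (shiftx k f) \<xi> = (cis (k * fst \<xi>) - 1) * ft f \<xi>" if "L12 f" for f \<xi>
    using that by (intro ft_shiftx) (simp add: L12_def)
  show "shiftx k (trunc n u) p = shiftx k u p" if "norm p + \<bar>k\<bar> \<le> real n" for p n
  proof -
    have "norm (p + (k, 0)) \<le> real n" using norm_triangle_ineq[of p "(k, 0)"] that by (simp add: norm_Pair)
    then show ?thesis using that unfolding shiftx_def by (simp add: trunc_eq)
  qed
  show "(\<lambda>\<xi>::pt. cis (k * fst \<xi>) - 1) \<in> borel_measurable borel" by measurable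
  show "(cmod (cis (k * fst \<xi>) - 1))\<^sup>2 \<le> 4" for \<xi> :: pt by (rule cmod_cis_minus_one_le)
qed

lemma primx_shifty_transfer:
  assumes u: "L2 u" and F: "fourier_L2 u F" and k: "k \<ge> 0"
  shows "ennreal ((2 * pi)\<^sup>2) * (sq_norm (primx k (shifty h u))) \<le>
    8 * (\<integral>\<^sup>+\<xi>. ennreal ((cmod (mprim k (fst \<xi>) * (cis (h * snd \<xi>) - 1)))\<^sup>2 * (cmod (F \<xi>))\<^sup>2) \<partial>lborel)"
\<comment> \<open>The reach \<open>c\<close> adds the length of the primitive and the vertical step;
  \<open>B\<close> multiplies the bounds k^2 for the primitive and 4 for the difference.\<close>
proof (rule multiplier_transfer[OF u F, where T="\<lambda>f. primx k (shifty h f)" and c="k + \<bar>h\<bar>" and B="k\<^sup>2 * 4"])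
  show "L12 (primx k (shifty h f))" if "L12 f" for f
    using that k by (intro L12_primx L12_shifty)
  show "ft (primx k (shifty h f)) \<xi> = mprim k (fst \<xi>) * (cis (h * snd \<xi>) - 1) * ft f \<xi>" if "L12 f" for f \<xi>
    using that L12_shifty[OF that, of h] k by (simp add: ft_primx ft_shifty L12_def)
  show "primx k (shifty h (trunc n u)) p = primx k (shifty h u) p" if n: "norm p + (k + \<bar>h\<bar>) \<le> real n" for p n
    unfolding primx_def
  proof (intro Bochner_Integration.integral_cong refl)
    fix s :: real
    show "indicator {0..k} s * shifty h (trunc n u) (p + (s, 0)) = indicator {0..k} s * shifty h u (p + (s, 0))"
    proof (cases "s \<in> {0..k}")
      case True
      have a: "norm (p + (s, 0)) \<le> norm p + k" using norm_triangle_ineq[of p "(s, 0)"] True by (simp add: norm_Pair)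
      moreover have "norm (p + (s, 0) + (0, h)) \<le> norm (p + (s, 0)) + \<bar>h\<bar>" using norm_triangle_ineq[of "p + (s, 0)" "(0, h)"] by (simp add: norm_Pair)
      ultimately have "norm (p + (s, 0)) \<le> real n" "norm (p + (s, 0) + (0, h)) \<le> real n" using n by linarith+
      then show ?thesis by (simp add: shifty_def trunc_eq)
    qed simp
  qed
  show "(\<lambda>\<xi>::pt. mprim k (fst \<xi>) * (cis (h * snd \<xi>) - 1)) \<in> borel_measurable borel" by measurable
  show "(cmod (mprim k (fst \<xi>) * (cis (h * snd \<xi>) - 1)))\<^sup>2 \<le> k\<^sup>2 * 4" for \<xi> :: pt
    unfolding norm_mult power_mult_distrib
    by (intro mult_mono cmod_cis_minus_one_le power_mono mprim_bound k) auto
qed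

lemma AE_fst_nonzero: "AE \<xi> in (lborel :: pt measure). fst \<xi> \<noteq> 0"
proof -
  have "{\<xi>::pt. fst \<xi> = 0} = {0} \<times> UNIV" by auto
  then have "emeasure lborel {\<xi>::pt. fst \<xi> = 0} = emeasure (lborel \<Otimes>\<^sub>M lborel) ({0::real} \<times> (UNIV :: real set))"
    by (simp only: lborel_prod)
  also have "\<dots> = 0" by (subst lborel.emeasure_pair_measure_Times) auto
  finally have "emeasure lborel {\<xi>::pt. fst \<xi> = 0} = 0" .
  then show ?thesis by (intro AE_I[of _ _ "{\<xi>::pt. fst \<xi> = 0}"]) auto
qed

text \<open>After Fubini the k-integral turns the difference multiplier into |\<xi>|. The density
  \<open>A\<close> is left free so that horizontal differences and primitives of vertical
  differences share the computation; the 8 is the loss of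
  \<open>multiplier_transfer\<close>.\<close>

lemma gagliardo_kernel:
  assumes [measurable]: "A \<in> borel_measurable borel"
  shows "(\<integral>\<^sup>+k. indicator {0<..} k * (ennreal (1 / k\<^sup>2) * (8 * (\<integral>\<^sup>+\<xi>. A \<xi> * ennreal ((cmod (cis (k * fst (\<xi>::pt)) - 1))\<^sup>2) \<partial>lborel))) \<partial>lborel)
    \<le> (\<integral>\<^sup>+\<xi>. 8 * A \<xi> * ennreal (5 * \<bar>fst \<xi>\<bar>) \<partial>lborel)"
proof -
  have "(\<integral>\<^sup>+k. indicator {0<..} k * (ennreal (1 / k\<^sup>2) * (8 * (\<integral>\<^sup>+\<xi>. A \<xi> * ennreal ((cmod (cis (k * fst (\<xi>::pt)) - 1))\<^sup>2) \<partial>lborel))) \<partial>lborel)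
    = (\<integral>\<^sup>+k. (\<integral>\<^sup>+\<xi>. 8 * A \<xi> * (indicator {0<..} k * ennreal ((cmod (cis (k * fst \<xi>) - 1))\<^sup>2 / k\<^sup>2)) \<partial>lborel) \<partial>lborel)"
  proof (intro nn_integral_cong)
    fix k :: real
    have "indicator {0<..} k * (ennreal (1 / k\<^sup>2) * (8 * (\<integral>\<^sup>+\<xi>. A \<xi> * ennreal ((cmod (cis (k * fst (\<xi>::pt)) - 1))\<^sup>2) \<partial>lborel)))
      = indicator {0<..} k * ennreal (1 / k\<^sup>2) * 8 * (\<integral>\<^sup>+\<xi>. A \<xi> * ennreal ((cmod (cis (k * fst (\<xi>::pt)) - 1))\<^sup>2) \<partial>lborel)"
      by (simp only: mult.assoc)
    also have "\<dots> = (\<integral>\<^sup>+\<xi>. indicator {0<..} k * ennreal (1 / k\<^sup>2) * 8 * (A \<xi> * ennreal ((cmod (cis (k * fst (\<xi>::pt)) - 1))\<^sup>2)) \<partial>lborel)"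
      by (rule nn_integral_cmult[symmetric]) measurable
    also have "\<dots> = (\<integral>\<^sup>+\<xi>. 8 * A \<xi> * (indicator {0<..} k * ennreal ((cmod (cis (k * fst \<xi>) - 1))\<^sup>2 / k\<^sup>2)) \<partial>lborel)"
    proof (intro nn_integral_cong)
      fix \<xi> :: pt
      have "ennreal ((cmod (cis (k * fst \<xi>) - 1))\<^sup>2 / k\<^sup>2) = ennreal (1 / k\<^sup>2) * ennreal ((cmod (cis (k * fst \<xi>) - 1))\<^sup>2)"
        by (subst ennreal_mult[symmetric]) auto
      then show "indicator {0<..} k * ennreal (1 / k\<^sup>2) * 8 * (A \<xi> * ennreal ((cmod (cis (k * fst (\<xi>::pt)) - 1))\<^sup>2)) = 8 * A \<xi> * (indicator {0<..} k * ennreal ((cmod (cis (k * fst \<xi>) - 1))\<^sup>2 / k\<^sup>2))"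
        by (simp only: mult_ac)
    qed
    finally show "indicator {0<..} k * (ennreal (1 / k\<^sup>2) * (8 * (\<integral>\<^sup>+\<xi>. A \<xi> * ennreal ((cmod (cis (k * fst (\<xi>::pt)) - 1))\<^sup>2) \<partial>lborel))) = \<dots>" .
  qed
  also have "\<dots> = (\<integral>\<^sup>+\<xi>. (\<integral>\<^sup>+k. 8 * A \<xi> * (indicator {0<..} k * ennreal ((cmod (cis (k * fst \<xi>) - 1))\<^sup>2 / k\<^sup>2)) \<partial>lborel) \<partial>lborel)"
    by (rule pair_sigma_finite.Fubini'[OF lborel_psf, symmetric]) measurable
  also have "\<dots> = (\<integral>\<^sup>+\<xi>. 8 * A \<xi> * (\<integral>\<^sup>+k. indicator {0<..} k * ennreal ((cmod (cis (k * fst \<xi>) - 1))\<^sup>2 / k\<^sup>2) \<partial>lborel) \<partial>lborel)"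
    by (intro nn_integral_cong nn_integral_cmult) measurable
  also have "\<dots> \<le> (\<integral>\<^sup>+\<xi>. 8 * A \<xi> * ennreal (5 * \<bar>fst \<xi>\<bar>) \<partial>lborel)"
    by (intro nn_integral_mono mult_left_mono gagliardo_upper) simp
  finally show ?thesis .
qed

text \<open>The kernel estimate with density |F|^2, where 40 = 8 * 5. The left side is the Gagliardo
  form of the norm of D_x^{1/2} u, which, unlike the multiplier, can be restricted to a region of
  the plane.\<close>

lemma gagliardo_shiftx:
  assumes u: "L2 u" and F: "fourier_L2 u F"
  shows "ennreal ((2 * pi)\<^sup>2) * (\<integral>\<^sup>+k. indicator {0<..} k * (ennreal (1 / k\<^sup>2) * (sq_norm (shiftx k u))) \<partial>lborel) \<le>
    40 * (\<integral>\<^sup>+\<xi>. ennreal ((cmod (F \<xi>))\<^sup>2 * \<bar>fst \<xi>\<bar>) \<partial>lborel)"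
proof -
  have [measurable]: "u \<in> borel_measurable borel" using u by (simp add: L2_def)
  have [measurable]: "F \<in> borel_measurable borel" using F by (simp add: fourier_L2_def)
  have [measurable]: "(\<lambda>k. \<integral>\<^sup>+p. ennreal ((shiftx k u p)\<^sup>2) \<partial>lborel) \<in> borel_measurable borel"
    unfolding shiftx_def by measurable
  have "ennreal ((2 * pi)\<^sup>2) * (\<integral>\<^sup>+k. indicator {0<..} k * (ennreal (1 / k\<^sup>2) * (sq_norm (shiftx k u))) \<partial>lborel)
    = (\<integral>\<^sup>+k. indicator {0<..} k * (ennreal (1 / k\<^sup>2) * (ennreal ((2 * pi)\<^sup>2) * (sq_norm (shiftx k u)))) \<partial>lborel)"
    by (subst nn_integral_cmult[symmetric]) (auto simp: mult_ac intro!: nn_integral_cong)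
  also have "\<dots> \<le> (\<integral>\<^sup>+k. indicator {0<..} k * (ennreal (1 / k\<^sup>2) * (8 * (\<integral>\<^sup>+\<xi>. ennreal ((cmod (cis (k * fst \<xi>) - 1))\<^sup>2 * (cmod (F \<xi>))\<^sup>2) \<partial>lborel))) \<partial>lborel)"
    by (intro nn_integral_mono mult_left_mono shiftx_transfer u F) auto
  also have "\<dots> = (\<integral>\<^sup>+k. indicator {0<..} k * (ennreal (1 / k\<^sup>2) * (8 * (\<integral>\<^sup>+\<xi>. ennreal ((cmod (F \<xi>))\<^sup>2) * ennreal ((cmod (cis (k * fst \<xi>) - 1))\<^sup>2) \<partial>lborel))) \<partial>lborel)"
    by (simp add: ennreal_mult mult.commute[of "ennreal ((cmod (F _))\<^sup>2)"])
  also have "\<dots> \<le> (\<integral>\<^sup>+\<xi>. 8 * ennreal ((cmod (F \<xi>))\<^sup>2) * ennreal (5 * \<bar>fst \<xi>\<bar>) \<partial>lborel)"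
    by (rule gagliardo_kernel) measurable
  also have "\<dots> = (\<integral>\<^sup>+\<xi>. 40 * ennreal ((cmod (F \<xi>))\<^sup>2 * \<bar>fst \<xi>\<bar>) \<partial>lborel)"
  proof (intro nn_integral_cong)
    fix \<xi> :: pt
    have "ennreal (5 * \<bar>fst \<xi>\<bar>) = 5 * ennreal \<bar>fst \<xi>\<bar>" using ennreal_mult[of 5 "\<bar>fst \<xi>\<bar>"] by simp
    moreover have "8 * a * (5 * b) = (8 * 5) * (a * b)" for a b :: ennreal by (simp only: mult_ac)
    ultimately show "8 * ennreal ((cmod (F \<xi>))\<^sup>2) * ennreal (5 * \<bar>fst \<xi>\<bar>) = 40 * ennreal ((cmod (F \<xi>))\<^sup>2 * \<bar>fst \<xi>\<bar>)"
      by (simp add: ennreal_mult)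
  qed
  also have "\<dots> = 40 * (\<integral>\<^sup>+\<xi>. ennreal ((cmod (F \<xi>))\<^sup>2 * \<bar>fst \<xi>\<bar>) \<partial>lborel)"
    by (rule nn_integral_cmult) measurable
  finally show ?thesis .
qed

text \<open>The multiplier has modulus |exp(ik\<xi>) - 1| |exp(ih\<eta>) - 1| / |\<xi>|. Integrating
  its square against dk/k^2 leaves |\<xi>|/\<xi>^2 = 1/|\<xi>|, and the vertical factor is at most
  h^2 \<eta>^2. Primitives of vertical differences thus stand in for D_x^{-1/2} u_y, uniformly in
  the step h.\<close>

lemma gagliardo_primx:
  assumes u: "L2 u" and F: "fourier_L2 u F"
  shows "ennreal ((2 * pi)\<^sup>2) * (\<integral>\<^sup>+k. indicator {0<..} k * (ennreal (1 / k\<^sup>2) * (sq_norm (primx k (shifty h u)))) \<partial>lborel) \<le>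
    40 * (ennreal (h\<^sup>2) * (\<integral>\<^sup>+\<xi>. ennreal ((cmod (F \<xi>))\<^sup>2 * (snd \<xi>)\<^sup>2 / \<bar>fst \<xi>\<bar>) \<partial>lborel))"
proof -
  have [measurable]: "u \<in> borel_measurable borel" using u by (simp add: L2_def)
  have [measurable]: "F \<in> borel_measurable borel" using F by (simp add: fourier_L2_def)
  have [measurable]: "(\<lambda>(k, p). primx k (shifty h u) p) \<in> borel_measurable (borel \<Otimes>\<^sub>M borel)"
    by (rule primx_measurable2) measurable
  have [measurable]: "(\<lambda>k. \<integral>\<^sup>+p. ennreal ((primx k (shifty h u) p)\<^sup>2) \<partial>lborel) \<in> borel_measurable borel"
    by measurable
  let ?A = "\<lambda>\<xi>::pt. ennreal ((h * snd \<xi>)\<^sup>2 * (cmod (F \<xi>))\<^sup>2 / (fst \<xi>)\<^sup>2)"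
  have "ennreal ((2 * pi)\<^sup>2) * (\<integral>\<^sup>+k. indicator {0<..} k * (ennreal (1 / k\<^sup>2) * (sq_norm (primx k (shifty h u)))) \<partial>lborel)
    = (\<integral>\<^sup>+k. indicator {0<..} k * (ennreal (1 / k\<^sup>2) * (ennreal ((2 * pi)\<^sup>2) * (sq_norm (primx k (shifty h u))))) \<partial>lborel)"
    by (subst nn_integral_cmult[symmetric]) (auto simp: mult_ac intro!: nn_integral_cong)
  also have "\<dots> \<le> (\<integral>\<^sup>+k. indicator {0<..} k * (ennreal (1 / k\<^sup>2) * (8 * (\<integral>\<^sup>+\<xi>. ?A \<xi> * ennreal ((cmod (cis (k * fst \<xi>) - 1))\<^sup>2) \<partial>lborel))) \<partial>lborel)"
  proof (intro nn_integral_mono)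
    fix k :: real
    show "indicator {0<..} k * (ennreal (1 / k\<^sup>2) * (ennreal ((2 * pi)\<^sup>2) * (sq_norm (primx k (shifty h u)))))
      \<le> indicator {0<..} k * (ennreal (1 / k\<^sup>2) * (8 * (\<integral>\<^sup>+\<xi>. ?A \<xi> * ennreal ((cmod (cis (k * fst \<xi>) - 1))\<^sup>2) \<partial>lborel)))"
    proof (cases "k > 0")
      case True
      have "(\<integral>\<^sup>+\<xi>. ennreal ((cmod (mprim k (fst \<xi>) * (cis (h * snd \<xi>) - 1)))\<^sup>2 * (cmod (F \<xi>))\<^sup>2) \<partial>lborel)
        \<le> (\<integral>\<^sup>+\<xi>. ?A \<xi> * ennreal ((cmod (cis (k * fst \<xi>) - 1))\<^sup>2) \<partial>lborel)"
      \<comment> \<open>On the line \<xi> = 0 the right side is 0 by the convention for division,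
        while the primitive multiplier equals k there; the line is discarded as a null set.\<close>
      proof (rule nn_integral_mono_AE, rule AE_mp[OF AE_fst_nonzero], rule AE_I2, rule impI)
        fix \<xi> :: pt assume \<xi>: "fst \<xi> \<noteq> 0"
        have "(cmod (mprim k (fst \<xi>) * (cis (h * snd \<xi>) - 1)))\<^sup>2 * (cmod (F \<xi>))\<^sup>2
           \<le> ((cmod (cis (k * fst \<xi>) - 1))\<^sup>2 / (fst \<xi>)\<^sup>2 * (h * snd \<xi>)\<^sup>2) * (cmod (F \<xi>))\<^sup>2"
          unfolding norm_mult power_mult_distrib[of "cmod _"] mprim_norm_sq[OF \<xi> less_imp_le[OF True]]
          by (intro mult_mono cmod_cis_minus_one_le) auto
        also have "\<dots> = (h * snd \<xi>)\<^sup>2 * (cmod (F \<xi>))\<^sup>2 / (fst \<xi>)\<^sup>2 * (cmod (cis (k * fst \<xi>) - 1))\<^sup>2" by simp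
        finally show "ennreal ((cmod (mprim k (fst \<xi>) * (cis (h * snd \<xi>) - 1)))\<^sup>2 * (cmod (F \<xi>))\<^sup>2) \<le> ?A \<xi> * ennreal ((cmod (cis (k * fst \<xi>) - 1))\<^sup>2)"
          by (subst ennreal_mult[symmetric]) (auto intro: ennreal_leI)
      qed
      then show ?thesis using True
        by (intro mult_left_mono order_trans[OF primx_shifty_transfer[OF u F]]) auto
    qed simp
  qed
  also have "\<dots> \<le> (\<integral>\<^sup>+\<xi>. 8 * ?A \<xi> * ennreal (5 * \<bar>fst \<xi>\<bar>) \<partial>lborel)"
    by (rule gagliardo_kernel) measurable
  also have "\<dots> = (\<integral>\<^sup>+\<xi>. 40 * ennreal (h\<^sup>2) * ennreal ((cmod (F \<xi>))\<^sup>2 * (snd \<xi>)\<^sup>2 / \<bar>fst \<xi>\<bar>) \<partial>lborel)"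
  proof (intro nn_integral_cong)
    fix \<xi> :: pt
    have "8 * ?A \<xi> * ennreal (5 * \<bar>fst \<xi>\<bar>) = ennreal (8 * ((h * snd \<xi>)\<^sup>2 * (cmod (F \<xi>))\<^sup>2 / (fst \<xi>)\<^sup>2) * (5 * \<bar>fst \<xi>\<bar>))"
      by (subst ennreal_mult, simp, simp, subst ennreal_mult, simp_all)
    also have "8 * ((h * snd \<xi>)\<^sup>2 * (cmod (F \<xi>))\<^sup>2 / (fst \<xi>)\<^sup>2) * (5 * \<bar>fst \<xi>\<bar>) = 40 * h\<^sup>2 * ((cmod (F \<xi>))\<^sup>2 * (snd \<xi>)\<^sup>2 / \<bar>fst \<xi>\<bar>)"
      by (cases "fst \<xi> = 0") (simp_all add: power2_eq_square field_simps)
    also have "ennreal \<dots> = 40 * ennreal (h\<^sup>2) * ennreal ((cmod (F \<xi>))\<^sup>2 * (snd \<xi>)\<^sup>2 / \<bar>fst \<xi>\<bar>)"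
      by (subst ennreal_mult, simp, simp, subst ennreal_mult, simp_all)
    finally show "8 * ?A \<xi> * ennreal (5 * \<bar>fst \<xi>\<bar>) = \<dots>" .
  qed
  also have "\<dots> = 40 * ennreal (h\<^sup>2) * (\<integral>\<^sup>+\<xi>. ennreal ((cmod (F \<xi>))\<^sup>2 * (snd \<xi>)\<^sup>2 / \<bar>fst \<xi>\<bar>) \<partial>lborel)"
    by (rule nn_integral_cmult) measurable
  finally show ?thesis by (simp add: mult.assoc)
qed

text \<open>For a single k the numerator |exp(ik\<xi>) - 1|^2 is at most 4, so the multiplier
  1/\<xi>^2 of the operator inverse to d_x appears without integrating in k, with a bound uniform in
  k; 32 = 8 * 4.\<close>

lemma primx_local:
  assumes u: "L2 u" and F: "fourier_L2 u F" and k: "k \<ge> 0"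
  shows "ennreal ((2 * pi)\<^sup>2) * (sq_norm (primx k (shifty h u))) \<le>
    32 * (ennreal (h\<^sup>2) * (\<integral>\<^sup>+\<xi>. ennreal ((cmod (F \<xi>))\<^sup>2 * (snd \<xi>)\<^sup>2 / (fst \<xi>)\<^sup>2) \<partial>lborel))"
proof -
  have [measurable]: "F \<in> borel_measurable borel" using F by (simp add: fourier_L2_def)
  have "(\<integral>\<^sup>+\<xi>. ennreal ((cmod (mprim k (fst \<xi>) * (cis (h * snd \<xi>) - 1)))\<^sup>2 * (cmod (F \<xi>))\<^sup>2) \<partial>lborel)
    \<le> (\<integral>\<^sup>+\<xi>. ennreal (4 * h\<^sup>2) * ennreal ((cmod (F \<xi>))\<^sup>2 * (snd \<xi>)\<^sup>2 / (fst \<xi>)\<^sup>2) \<partial>lborel)"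
  proof (rule nn_integral_mono_AE, rule AE_mp[OF AE_fst_nonzero], rule AE_I2, rule impI)
    fix \<xi> :: pt assume \<xi>: "fst \<xi> \<noteq> 0"
    have "(cmod (mprim k (fst \<xi>) * (cis (h * snd \<xi>) - 1)))\<^sup>2 * (cmod (F \<xi>))\<^sup>2
       \<le> (4 / (fst \<xi>)\<^sup>2 * (h * snd \<xi>)\<^sup>2) * (cmod (F \<xi>))\<^sup>2"
      unfolding norm_mult power_mult_distrib[of "cmod _"] mprim_norm_sq[OF \<xi> k]
      by (intro mult_mono divide_right_mono cmod_cis_minus_one_le) auto
    also have "\<dots> = (4 * h\<^sup>2) * ((cmod (F \<xi>))\<^sup>2 * (snd \<xi>)\<^sup>2 / (fst \<xi>)\<^sup>2)" by (simp add: power_mult_distrib)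
    finally show "ennreal ((cmod (mprim k (fst \<xi>) * (cis (h * snd \<xi>) - 1)))\<^sup>2 * (cmod (F \<xi>))\<^sup>2) \<le> ennreal (4 * h\<^sup>2) * ennreal ((cmod (F \<xi>))\<^sup>2 * (snd \<xi>)\<^sup>2 / (fst \<xi>)\<^sup>2)"
      by (subst ennreal_mult[symmetric]) (auto intro: ennreal_leI)
  qed
  also have "\<dots> = ennreal (4 * h\<^sup>2) * (\<integral>\<^sup>+\<xi>. ennreal ((cmod (F \<xi>))\<^sup>2 * (snd \<xi>)\<^sup>2 / (fst \<xi>)\<^sup>2) \<partial>lborel)"
    by (rule nn_integral_cmult) measurable
  finally have "8 * (\<integral>\<^sup>+\<xi>. ennreal ((cmod (mprim k (fst \<xi>) * (cis (h * snd \<xi>) - 1)))\<^sup>2 * (cmod (F \<xi>))\<^sup>2) \<partial>lborel)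
    \<le> 8 * (ennreal (4 * h\<^sup>2) * (\<integral>\<^sup>+\<xi>. ennreal ((cmod (F \<xi>))\<^sup>2 * (snd \<xi>)\<^sup>2 / (fst \<xi>)\<^sup>2) \<partial>lborel))"
    by (rule mult_left_mono) simp
  also have "\<dots> = 32 * (ennreal (h\<^sup>2) * (\<integral>\<^sup>+\<xi>. ennreal ((cmod (F \<xi>))\<^sup>2 * (snd \<xi>)\<^sup>2 / (fst \<xi>)\<^sup>2) \<partial>lborel))"
    using ennreal_mult[of 4 "h\<^sup>2"] by (simp add: mult.assoc[symmetric])
  finally show ?thesis using primx_shifty_transfer[OF u F k, of h] by (rule order_trans[rotated])
qed

section \<open>Antiderivatives and cutoffs in one variable\<close>

definition prim1 :: "real \<Rightarrow> (real \<Rightarrow> real) \<Rightarrow> real \<Rightarrow> real" where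
  "prim1 k w x = (LINT s|lborel. indicator {0..k} s * w (x + s))"

lemma primx_section: "primx k f (x, y) = prim1 k (\<lambda>s. f (s, y)) x"
  by (simp add: primx_def prim1_def)

definition lsq :: "(real \<Rightarrow> real) \<Rightarrow> bool" where
  "lsq w \<longleftrightarrow> w \<in> borel_measurable borel \<and> (sq_norm w) < \<infinity>"

lemma lsq_measurable [measurable_dest]: "lsq w \<Longrightarrow> w \<in> borel_measurable borel"
  by (simp add: lsq_def)

lemma lsq_integrable:
  assumes "lsq w" shows "integrable lborel (\<lambda>s. indicator {c..d} s * w s)"
proof -
  note [measurable] = lsq_measurable[OF assms]
  have "(\<integral>\<^sup>+s. ennreal (norm (indicator {c..d} s * w s)) \<partial>lborel) \<le> (\<integral>\<^sup>+s. indicator {c..d} s + ennreal ((w s)\<^sup>2) \<partial>lborel)"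
  proof (intro nn_integral_mono)
    fix s :: real
    have "\<bar>w s\<bar> \<le> 1 + (w s)\<^sup>2" using sum_squares_bound[of "\<bar>w s\<bar>" 1] by simp
    then have "ennreal \<bar>w s\<bar> \<le> 1 + ennreal ((w s)\<^sup>2)" by (simp flip: ennreal_1 ennreal_plus)
    then show "ennreal (norm (indicator {c..d} s * w s)) \<le> indicator {c..d} s + ennreal ((w s)\<^sup>2)" by (cases "s \<in> {c..d}") auto
  qed
  also have "\<dots> < \<infinity>" using assms unfolding lsq_def
    by (subst nn_integral_add) (auto simp: emeasure_lborel_Icc_eq)
  finally show ?thesis unfolding integrable_iff_bounded by auto
qed

lemma prim1_eq: "prim1 k w x = (LINT s|lborel. indicator {x..x + k} s * w s)"
  unfolding prim1_def
  by (subst lborel_integral_real_affine[where c=1 and t=x and f="\<lambda>s. indicator {x..x + k} s * w s"])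
    (auto simp: indicator_def intro!: Bochner_Integration.integral_cong)

lemma prim1_square_le:
  assumes [measurable]: "w \<in> borel_measurable borel" and "k \<ge> 0"
  shows "ennreal ((prim1 k w x)\<^sup>2) \<le> ennreal k * (\<integral>\<^sup>+s. indicator {0..k} s * ennreal ((w (x + s))\<^sup>2) \<partial>lborel)"
  unfolding prim1_def using integral_square_le[of "\<lambda>s. w (x + s)" lborel "{0..k}"] assms(2) by simp

lemma prim1_measurable2 [measurable]:
  assumes [measurable]: "w \<in> borel_measurable borel"
  shows "(\<lambda>(k, x). prim1 k w x) \<in> borel_measurable (borel \<Otimes>\<^sub>M borel)"
proof -
  have [measurable]: "Measurable.pred ((borel \<Otimes>\<^sub>M borel) \<Otimes>\<^sub>M borel) (\<lambda>x::(real \<times> real) \<times> real. snd x \<in> {0..fst (fst x)})"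
    unfolding atLeastAtMost_iff by measurable
  show ?thesis
    unfolding prim1_def indicator_def case_prod_beta' by measurable
qed

lemma nn_integral_translate_real:
  fixes F :: "real \<Rightarrow> ennreal"
  assumes [measurable]: "F \<in> borel_measurable borel"
  shows "(\<integral>\<^sup>+x. F (x + c) \<partial>lborel) = (\<integral>\<^sup>+x. F x \<partial>lborel)"
  using nn_integral_real_affine[of F 1 c] by (simp add: add.commute)

text \<open>One bump serves both variables. Besides \<alpha> also \<alpha>' has to be Lipschitz,
  because the half-derivative energy of \<alpha>' times an antiderivative involves increments of
  \<alpha>'.\<close>

locale cutoff =
  fixes R M :: real and \<alpha> \<alpha>' :: "real \<Rightarrow> real"
  assumes R: "R > 0" and M: "M > 0"
    and deriv: "\<And>t. (\<alpha> has_real_derivative \<alpha>' t) (at t)"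
    and bounds: "\<And>t. \<bar>\<alpha> t\<bar> \<le> M" "\<And>t. \<bar>\<alpha>' t\<bar> \<le> M"
    and lip: "\<And>s t. \<bar>\<alpha> s - \<alpha> t\<bar> \<le> M * \<bar>s - t\<bar>" "\<And>s t. \<bar>\<alpha>' s - \<alpha>' t\<bar> \<le> M * \<bar>s - t\<bar>"
    and supp: "\<And>t. t < - R \<or> 2 * R < t \<Longrightarrow> \<alpha> t = 0 \<and> \<alpha>' t = 0"
    and one: "\<And>t. 0 < t \<Longrightarrow> t < R \<Longrightarrow> \<alpha> t = 1 \<and> \<alpha>' t = 0"
begin

lemma continuous_cutoff: "continuous_on S \<alpha>" "continuous_on S \<alpha>'"
proof -
  show "continuous_on S \<alpha>" by (meson DERIV_continuous_on deriv has_field_derivative_at_within)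
  have "M-lipschitz_on S \<alpha>'" using lip(2) M by (intro lipschitz_onI) (auto simp: dist_real_def)
  then show "continuous_on S \<alpha>'" by (rule lipschitz_on_continuous_on)
qed

lemma cutoff_measurable [measurable]: "\<alpha> \<in> borel_measurable borel" "\<alpha>' \<in> borel_measurable borel"
  by (intro borel_measurable_continuous_onI continuous_cutoff)+

definition \<kappa> :: "real \<Rightarrow> real" where "\<kappa> t = max 0 (min 1 (4 - t / R))"

lemma \<kappa>_measurable [measurable]: "\<kappa> \<in> borel_measurable borel"
  unfolding \<kappa>_def[abs_def] by measurable

lemma \<kappa>_bounds: "0 \<le> \<kappa> t" "\<kappa> t \<le> 1" by (auto simp: \<kappa>_def)

lemma \<kappa>_one: "t \<le> 3 * R \<Longrightarrow> \<kappa> t = 1" using R by (auto simp: \<kappa>_def min_def max_def field_simps)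
lemma \<kappa>_zero: "4 * R \<le> t \<Longrightarrow> \<kappa> t = 0" using R by (auto simp: \<kappa>_def min_def max_def field_simps)

text \<open>Since \<open>\<kappa> (s - a)\<close> is 1 up to \<open>a + 3 * R\<close> and decreases linearly to 0 at \<open>a + 4 * R\<close>, this is minus the average
  over z in \<open>[a + 3 * R, a + 4 * R]\<close> of the integral of w from x to z, hence an antiderivative of w near the square.\<close>

definition anti :: "real \<Rightarrow> (real \<Rightarrow> real) \<Rightarrow> real \<Rightarrow> real" where
  "anti a w x = - (LINT s|lborel. indicator {x..} s * \<kappa> (s - a) * w s)"

lemma integrable_anti:
  assumes "lsq w" shows "integrable lborel (\<lambda>s. indicator {x..} s * \<kappa> (s - a) * w s)"
proof (rule Bochner_Integration.integrable_bound[OF lsq_integrable[OF assms, of x "a + 4 * R"]])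
  note [measurable] = lsq_measurable[OF assms]
  show "(\<lambda>s. indicator {x..} s * \<kappa> (s - a) * w s) \<in> borel_measurable lborel" by measurable
  have "norm (indicator {x..} s * \<kappa> (s - a) * w s) \<le> norm (indicator {x..a + 4 * R} s * w s)" for s
    using \<kappa>_zero[of "s - a"] \<kappa>_bounds[of "s - a"] mult_right_mono[OF \<kappa>_bounds(2)[of "s - a"], of "\<bar>w s\<bar>"]
    by (cases "a + 4 * R < s") (auto simp: indicator_def abs_mult)
  then show "AE s in lborel. norm (indicator {x..} s * \<kappa> (s - a) * w s) \<le> norm (indicator {x..a + 4 * R} s * w s)" by simp
qed

lemma anti_diff:
  assumes w: "lsq w" and k: "0 \<le> k" "x + k \<le> a + 3 * R"
  shows "anti a w (x + k) - anti a w x = prim1 k w x"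
proof -
  note [measurable] = lsq_measurable[OF w]
  have "anti a w (x + k) - anti a w x = (LINT s|lborel. indicator {x..} s * \<kappa> (s - a) * w s - indicator {x + k..} s * \<kappa> (s - a) * w s)"
    unfolding anti_def by (simp add: Bochner_Integration.integral_diff integrable_anti[OF w])
  also have "\<dots> = (LINT s|lborel. indicator {x..x + k} s * w s)"
  proof (rule integral_cong_AE)
    \<comment> \<open>The difference of the two closed half-lines omits the endpoint x + k, which
      the interval contains; elsewhere up to a + 3R the weight \<kappa> is 1, and beyond x + k the
      two terms cancel.\<close>
    show "AE s in lborel. indicator {x..} s * \<kappa> (s - a) * w s - indicator {x + k..} s * \<kappa> (s - a) * w s = indicator {x..x + k} s * w s"
      using AE_lborel_singleton[of "x + k"]
    proof eventually_elim
      case (elim s)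
      then show ?case using k \<kappa>_one[of "s - a"] by (auto simp: indicator_def)
    qed
  qed measurable
  finally show ?thesis by (simp add: prim1_eq)
qed

text \<open>R \<kappa>(s - a) is the length of the part of [a + 3R, a + 4R] to the right of s;
  inserting this and exchanging integrals gives the average. Only in this form is
  \<open>anti\<close> visibly controlled by primitives over finite intervals.\<close>

lemma anti_average:
  assumes w: "lsq w" and x: "x \<le> a + 3 * R"
  shows "anti a w x = - (1 / R) * (LINT z|lborel. indicator {a + 3 * R..a + 4 * R} z * prim1 (z - x) w x)"
proof -
  note [measurable] = lsq_measurable[OF w]
  have len: "(LINT z|lborel. indicator {a + 3 * R..a + 4 * R} z * indicator {s..} z) = R * \<kappa> (s - a)" for s
  proof -
    have "(LINT z|lborel. indicator {a + 3 * R..a + 4 * R} z * indicator {s..} z) = (LINT z|lborel. indicator {max s (a + 3 * R)..a + 4 * R} z :: real)"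
      by (intro Bochner_Integration.integral_cong) (auto simp: indicator_def)
    also have "\<dots> = max 0 (a + 4 * R - max s (a + 3 * R))"
      by (simp add: measure_def emeasure_lborel_Icc_eq max_def)
    also have "\<dots> = R * \<kappa> (s - a)"
      using R by (auto simp: \<kappa>_def max_def min_def field_simps)
    finally show ?thesis .
  qed
  have [measurable]: "Measurable.pred (borel \<Otimes>\<^sub>M borel) (\<lambda>x::real \<times> real. fst x \<le> snd x)"
    "Measurable.pred (borel \<Otimes>\<^sub>M borel) (\<lambda>x::real \<times> real. snd x \<le> fst x)" by measurable
  have i: "integrable (lborel \<Otimes>\<^sub>M lborel) (\<lambda>(z, s). indicator {a + 3 * R..a + 4 * R} z * indicator {s..} z * (indicator {x..a + 4 * R} s * w s))"
  proof (rule Bochner_Integration.integrable_bound)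
    show "integrable (lborel \<Otimes>\<^sub>M lborel) (\<lambda>(z, s). indicator {a + 3 * R..a + 4 * R} z * (indicator {x..a + 4 * R} s * w s) :: real)"
    proof (rule pair_sigma_finite.Fubini_integrable[OF lborel_psf])
      have "integrable lborel (indicat_real {a + 3 * R..a + 4 * R})" by (intro integrable_real_indicator) (auto simp: emeasure_lborel_Icc_eq)
      then show "integrable lborel (\<lambda>z. LINT s|lborel. norm (case (z, s) of (z, s) \<Rightarrow> indicat_real {a + 3 * R..a + 4 * R} z * (indicator {x..a + 4 * R} s * w s)))"
        by (simp add: abs_mult)
      show "AE z in lborel. integrable lborel (\<lambda>s. case (z, s) of (z, s) \<Rightarrow> indicat_real {a + 3 * R..a + 4 * R} z * (indicator {x..a + 4 * R} s * w s))"
        using lsq_integrable[OF w] by simp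
    qed measurable
    show "(\<lambda>(z, s). indicator {a + 3 * R..a + 4 * R} z * indicator {s..} z * (indicator {x..a + 4 * R} s * w s)) \<in> borel_measurable (lborel \<Otimes>\<^sub>M lborel)"
      unfolding indicator_def atLeast_iff by measurable
  qed (auto simp: indicator_def)
  have "(LINT z|lborel. indicator {a + 3 * R..a + 4 * R} z * prim1 (z - x) w x)
     = (LINT z|lborel. (LINT s|lborel. indicator {a + 3 * R..a + 4 * R} z * indicator {s..} z * (indicator {x..a + 4 * R} s * w s)))"
  proof (intro Bochner_Integration.integral_cong refl)
    fix z :: real
    have "(LINT s|lborel. indicator {a + 3 * R..a + 4 * R} z * indicator {s..} z * (indicator {x..a + 4 * R} s * w s)) = (LINT s|lborel. indicator {a + 3 * R..a + 4 * R} z * (indicator {x..z} s * w s))"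
      by (intro Bochner_Integration.integral_cong) (auto simp: indicator_def)
    then show "indicator {a + 3 * R..a + 4 * R} z * prim1 (z - x) w x = (LINT s|lborel. indicator {a + 3 * R..a + 4 * R} z * indicator {s..} z * (indicator {x..a + 4 * R} s * w s))"
      by (simp add: prim1_eq)
  qed
  also have "\<dots> = (LINT s|lborel. (LINT z|lborel. indicator {a + 3 * R..a + 4 * R} z * indicator {s..} z * (indicator {x..a + 4 * R} s * w s)))"
    by (rule pair_sigma_finite.Fubini_integral[OF lborel_psf i, symmetric])
  also have "\<dots> = (LINT s|lborel. R * (indicator {x..} s * \<kappa> (s - a) * w s))"
  proof (intro Bochner_Integration.integral_cong refl)
    fix s :: real
    show "(LINT z|lborel. indicator {a + 3 * R..a + 4 * R} z * indicator {s..} z * (indicator {x..a + 4 * R} s * w s)) = R * (indicator {x..} s * \<kappa> (s - a) * w s)"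
      unfolding integral_mult_left_zero len using \<kappa>_zero[of "s - a"] by (auto simp: indicator_def)
  qed
  also have "\<dots> = - R * anti a w x" unfolding integral_mult_right_zero anti_def by simp
  finally show ?thesis using R by simp
qed

text \<open>Cauchy-Schwarz over the base points z of the average. With x at least a - 2R and z at
  most a + 4R, the length z - x never exceeds 6R, which fixes the range of k from here on.\<close>

lemma anti_square_le:
  assumes w: "lsq w" and x: "a - 2 * R \<le> x" "x \<le> a + 3 * R"
  shows "ennreal ((anti a w x)\<^sup>2) \<le> ennreal (1 / R) * (\<integral>\<^sup>+k. indicator {0<..6 * R} k * ennreal ((prim1 k w x)\<^sup>2) \<partial>lborel)"
proof -
  note [measurable] = lsq_measurable[OF w]
  have [measurable]: "(\<lambda>z. prim1 (z - x) w x) \<in> borel_measurable borel" "(\<lambda>z. prim1 z w x) \<in> borel_measurable borel"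
    using measurable_compose[OF _ prim1_measurable2[OF lsq_measurable[OF w]], of "\<lambda>z. (z - x, x)" borel]
      measurable_compose[OF _ prim1_measurable2[OF lsq_measurable[OF w]], of "\<lambda>z. (z, x)" borel] by simp_all
  let ?S = "{a + 3 * R..a + 4 * R}"
  have "(anti a w x)\<^sup>2 = (1 / R\<^sup>2) * (LINT z|lborel. indicator ?S z * prim1 (z - x) w x)\<^sup>2"
    unfolding anti_average[OF w x(2)] by (simp add: power_mult_distrib power_divide)
  then have "ennreal ((anti a w x)\<^sup>2) = ennreal (1 / R\<^sup>2) * ennreal ((LINT z|lborel. indicator ?S z * prim1 (z - x) w x)\<^sup>2)"
    by (simp only: ennreal_mult zero_le_power2 zero_le_divide_1_iff)
  also have "\<dots> \<le> ennreal (1 / R\<^sup>2) * (ennreal R * (\<integral>\<^sup>+z. indicator ?S z * ennreal ((prim1 (z - x) w x)\<^sup>2) \<partial>lborel))"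
    using integral_square_le[of "\<lambda>z. prim1 (z - x) w x" lborel ?S] R by (intro mult_left_mono) auto
  also have "\<dots> = ennreal (1 / R) * (\<integral>\<^sup>+z. indicator ?S z * ennreal ((prim1 (z - x) w x)\<^sup>2) \<partial>lborel)"
    using R by (subst mult.assoc[symmetric], subst ennreal_mult[symmetric]) (auto simp: power2_eq_square)
  also have "(\<integral>\<^sup>+z. indicator ?S z * ennreal ((prim1 (z - x) w x)\<^sup>2) \<partial>lborel) = (\<integral>\<^sup>+k. indicator ?S (k + x) * ennreal ((prim1 k w x)\<^sup>2) \<partial>lborel)"
    by (subst nn_integral_translate_real[where c=x, symmetric]) auto
  also have "\<dots> \<le> (\<integral>\<^sup>+k. indicator {0<..6 * R} k * ennreal ((prim1 k w x)\<^sup>2) \<partial>lborel)"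
  proof (intro nn_integral_mono)
    fix k :: real
    \<comment> \<open>The length k = 0 can occur at x = a + 3R but lies outside the half-open range;
      the primitive vanishes there.\<close>
    have "prim1 0 w x = 0"
    proof -
      have "AE s in lborel. indicator {0..0} s * w (x + s) = 0"
        using AE_lborel_singleton[of 0] by eventually_elim auto
      then show ?thesis unfolding prim1_def by (rule integral_eq_zero_AE)
    qed
    then show "indicator ?S (k + x) * ennreal ((prim1 k w x)\<^sup>2) \<le> indicator {0<..6 * R} k * ennreal ((prim1 k w x)\<^sup>2)"
      using x by (cases "k = 0") (auto simp: indicator_def)
  qed
  finally show ?thesis by (simp add: mult_left_mono)
qed

section \<open>Local energies of a horizontal section\<close>

definition J :: "real \<Rightarrow> real set" where "J a = {a - 2 * R..a + 3 * R}"

text \<open>The right end is 3R + 6R: a primitive based in \<open>J a\<close> looks at most 6R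
  further to the right.\<close>

definition sqI :: "real \<Rightarrow> (real \<Rightarrow> real) \<Rightarrow> ennreal" where
  "sqI a w = (\<integral>\<^sup>+s. indicator {a - 2 * R..a + 9 * R} s * ennreal ((w s)\<^sup>2) \<partial>lborel)"

definition primJ :: "real \<Rightarrow> (real \<Rightarrow> real) \<Rightarrow> real \<Rightarrow> ennreal" where
  "primJ a w k = (\<integral>\<^sup>+x. indicator (J a) x * ennreal ((prim1 k w x)\<^sup>2) \<partial>lborel)"

text \<open>The unweighted integral of the primitives answers to the multiplier 1/\<xi>^2, and
  \<open>V2\<close> with its weight 1/k^2 to 1/|\<xi>|.\<close>

definition V1 :: "real \<Rightarrow> (real \<Rightarrow> real) \<Rightarrow> ennreal" where
  "V1 a w = (\<integral>\<^sup>+k. indicator {0<..6 * R} k * primJ a w k \<partial>lborel)"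

definition V2 :: "real \<Rightarrow> (real \<Rightarrow> real) \<Rightarrow> ennreal" where
  "V2 a w = (\<integral>\<^sup>+k. indicator {0<..6 * R} k * (ennreal (1 / k\<^sup>2) * primJ a w k) \<partial>lborel)"

definition antiJ :: "real \<Rightarrow> (real \<Rightarrow> real) \<Rightarrow> ennreal" where
  "antiJ a w = (\<integral>\<^sup>+x. indicator (J a) x * ennreal ((anti a w x)\<^sup>2) \<partial>lborel)"

lemma J_measurable [measurable]: "J a \<in> sets borel" by (simp add: J_def)

lemma anti_measurable [measurable]:
  assumes [measurable]: "w \<in> borel_measurable borel"
  shows "anti a w \<in> borel_measurable borel"
proof -
  have [measurable]: "Measurable.pred (borel \<Otimes>\<^sub>M borel) (\<lambda>x::real \<times> real. fst x \<le> snd x)" by measurable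
  show ?thesis unfolding anti_def[abs_def] indicator_def atLeast_iff by measurable
qed

lemma primJ_measurable [measurable]:
  assumes [measurable]: "w \<in> borel_measurable borel"
  shows "primJ a w \<in> borel_measurable borel"
  unfolding primJ_def[abs_def] using prim1_measurable2[OF assms] by measurable

lemma antiJ_le:
  assumes w: "lsq w" shows "antiJ a w \<le> ennreal (1 / R) * V1 a w"
proof -
  note [measurable] = lsq_measurable[OF w] prim1_measurable2[OF lsq_measurable[OF w]]
  have "antiJ a w \<le> (\<integral>\<^sup>+x. ennreal (1 / R) * (\<integral>\<^sup>+k. indicator (J a) x * (indicator {0<..6 * R} k * ennreal ((prim1 k w x)\<^sup>2)) \<partial>lborel) \<partial>lborel)"
    unfolding antiJ_def
  proof (intro nn_integral_mono)
    fix x :: real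
    show "indicator (J a) x * ennreal ((anti a w x)\<^sup>2) \<le> ennreal (1 / R) * (\<integral>\<^sup>+k. indicator (J a) x * (indicator {0<..6 * R} k * ennreal ((prim1 k w x)\<^sup>2)) \<partial>lborel)"
      using anti_square_le[OF w, of a x] by (cases "x \<in> J a") (auto simp: J_def)
  qed
  also have "\<dots> = ennreal (1 / R) * (\<integral>\<^sup>+x. (\<integral>\<^sup>+k. indicator (J a) x * (indicator {0<..6 * R} k * ennreal ((prim1 k w x)\<^sup>2)) \<partial>lborel) \<partial>lborel)"
    by (rule nn_integral_cmult) measurable
  also have "(\<integral>\<^sup>+x. (\<integral>\<^sup>+k. indicator (J a) x * (indicator {0<..6 * R} k * ennreal ((prim1 k w x)\<^sup>2)) \<partial>lborel) \<partial>lborel)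
    = (\<integral>\<^sup>+k. (\<integral>\<^sup>+x. indicator (J a) x * (indicator {0<..6 * R} k * ennreal ((prim1 k w x)\<^sup>2)) \<partial>lborel) \<partial>lborel)"
    by (rule pair_sigma_finite.Fubini'[OF lborel_psf]) measurable
  also have "\<dots> = (\<integral>\<^sup>+k. (\<integral>\<^sup>+x. indicator {0<..6 * R} k * (indicator (J a) x * ennreal ((prim1 k w x)\<^sup>2)) \<partial>lborel) \<partial>lborel)"
    by (intro nn_integral_cong) (simp only: mult_ac)
  also have "\<dots> = V1 a w"
    unfolding V1_def primJ_def by (intro nn_integral_cong nn_integral_cmult) measurable
  finally show ?thesis .
qed

lemma V1_le:
  assumes w: "lsq w" shows "V1 a w \<le> ennreal (36 * R\<^sup>2) * V2 a w"
proof -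
  note [measurable] = lsq_measurable[OF w]
  have "V1 a w \<le> (\<integral>\<^sup>+k. ennreal (36 * R\<^sup>2) * (indicator {0<..6 * R} k * (ennreal (1 / k\<^sup>2) * primJ a w k)) \<partial>lborel)"
    unfolding V1_def
  proof (intro nn_integral_mono)
    fix k :: real
    show "indicator {0<..6 * R} k * primJ a w k \<le> ennreal (36 * R\<^sup>2) * (indicator {0<..6 * R} k * (ennreal (1 / k\<^sup>2) * primJ a w k))"
    proof (cases "k \<in> {0<..6 * R}")
      case True
      then have "k\<^sup>2 \<le> (6 * R)\<^sup>2" by (intro power_mono) auto
      then have "1 \<le> 36 * R\<^sup>2 * (1 / k\<^sup>2)" using True by (simp add: power_mult_distrib field_simps)
      then have "1 \<le> ennreal (36 * R\<^sup>2) * ennreal (1 / k\<^sup>2)" by (subst ennreal_mult[symmetric]) auto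
      from mult_right_mono[OF this, of "primJ a w k"] show ?thesis using True by (simp add: mult.assoc)
    qed simp
  qed
  also have "\<dots> = ennreal (36 * R\<^sup>2) * V2 a w"
    unfolding V2_def by (rule nn_integral_cmult) measurable
  finally show ?thesis .
qed

text \<open>Cauchy-Schwarz and Fubini each give a factor k, which together cancel the singular
  weight. This makes \<open>V2\<close> finite for sections that are merely square
  integrable.\<close>

lemma primJ_le:
  assumes w: "lsq w" and k: "0 < k" "k \<le> 6 * R" shows "ennreal (1 / k\<^sup>2) * primJ a w k \<le> sqI a w"
proof -
  note [measurable] = lsq_measurable[OF w]
  have "primJ a w k \<le> (\<integral>\<^sup>+x. ennreal k * (\<integral>\<^sup>+s. indicator (J a) x * (indicator {0..k} s * ennreal ((w (x + s))\<^sup>2)) \<partial>lborel) \<partial>lborel)"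
    unfolding primJ_def
  proof (intro nn_integral_mono)
    fix x :: real
    show "indicator (J a) x * ennreal ((prim1 k w x)\<^sup>2) \<le> ennreal k * (\<integral>\<^sup>+s. indicator (J a) x * (indicator {0..k} s * ennreal ((w (x + s))\<^sup>2)) \<partial>lborel)"
      using prim1_square_le[OF lsq_measurable[OF w], of k x] k by (cases "x \<in> J a") auto
  qed
  also have "\<dots> = ennreal k * (\<integral>\<^sup>+x. (\<integral>\<^sup>+s. indicator (J a) x * (indicator {0..k} s * ennreal ((w (x + s))\<^sup>2)) \<partial>lborel) \<partial>lborel)"
    by (rule nn_integral_cmult) measurable
  also have "(\<integral>\<^sup>+x. (\<integral>\<^sup>+s. indicator (J a) x * (indicator {0..k} s * ennreal ((w (x + s))\<^sup>2)) \<partial>lborel) \<partial>lborel)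
    = (\<integral>\<^sup>+s. (\<integral>\<^sup>+x. indicator (J a) x * (indicator {0..k} s * ennreal ((w (x + s))\<^sup>2)) \<partial>lborel) \<partial>lborel)"
    by (rule pair_sigma_finite.Fubini'[OF lborel_psf]) measurable
  also have "\<dots> \<le> (\<integral>\<^sup>+s. indicator {0..k} s * sqI a w \<partial>lborel)"
  proof (intro nn_integral_mono)
    fix s :: real
    show "(\<integral>\<^sup>+x. indicator (J a) x * (indicator {0..k} s * ennreal ((w (x + s))\<^sup>2)) \<partial>lborel) \<le> indicator {0..k} s * sqI a w"
    proof (cases "s \<in> {0..k}")
      case True
      have "(\<integral>\<^sup>+x. indicator (J a) x * ennreal ((w (x + s))\<^sup>2) \<partial>lborel) \<le> (\<integral>\<^sup>+x. indicator {a - 2 * R..a + 9 * R} (x + s) * ennreal ((w (x + s))\<^sup>2) \<partial>lborel)"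
        using True k by (intro nn_integral_mono mult_right_mono) (auto simp: J_def indicator_def)
      also have "\<dots> = sqI a w" unfolding sqI_def by (rule nn_integral_translate_real) measurable
      finally show ?thesis using True by simp
    qed simp
  qed
  also have "\<dots> = ennreal k * sqI a w" using k by (simp add: nn_integral_multc)
  finally have "primJ a w k \<le> ennreal k * (ennreal k * sqI a w)" by (simp add: mult_left_mono)
  then have "ennreal (1 / k\<^sup>2) * primJ a w k \<le> ennreal (1 / k\<^sup>2) * (ennreal k * (ennreal k * sqI a w))" by (rule mult_left_mono) simp
  also have "\<dots> = ennreal (1 / k\<^sup>2 * (k * k)) * sqI a w"
    using k by (simp only: ennreal_mult zero_le_power2 zero_le_divide_1_iff mult_nonneg_nonneg less_imp_le mult.assoc)
  also have "1 / k\<^sup>2 * (k * k) = 1" using k by (simp add: power2_eq_square)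
  finally show ?thesis by simp
qed

lemma V2_le:
  assumes w: "lsq w" shows "V2 a w \<le> ennreal (6 * R) * sqI a w"
proof -
  have "V2 a w \<le> (\<integral>\<^sup>+k. indicator {0<..6 * R} k * sqI a w \<partial>lborel)"
    unfolding V2_def using primJ_le[OF w] by (intro nn_integral_mono) (auto simp: indicator_def)
  also have "\<dots> = ennreal (6 * R) * sqI a w" using R by (simp add: nn_integral_multc)
  finally show ?thesis .
qed

text \<open>Steps k \<le> R are handled by the pointwise hypothesis, whose part proportional to k^2
  cancels the kernel and integrates to R. For k > R the increments are bounded by four times the
  norm of G, and the tail of the kernel has mass 1/R.\<close>

lemma gagliardo_split:
  assumes [measurable]: "G \<in> borel_measurable borel" "A \<in> borel_measurable borel" "(\<lambda>(k, x). B k x) \<in> borel_measurable (borel \<Otimes>\<^sub>M borel)"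
    and G: "\<And>x. x < a - R \<or> a + 2 * R < x \<Longrightarrow> G x = 0"
    and H: "\<And>k x. 0 < k \<Longrightarrow> k \<le> R \<Longrightarrow> x \<in> J a \<Longrightarrow> x + k \<in> J a \<Longrightarrow> ennreal ((G (x + k) - G x)\<^sup>2) \<le> c * (ennreal (k\<^sup>2) * A (x + k) + B k x)"
  shows "(\<integral>\<^sup>+k. indicator {0<..} k * (ennreal (1 / k\<^sup>2) * (sq_norm (\<lambda>x. G (x + k) - G x))) \<partial>lborel)
    \<le> c * (ennreal R * (\<integral>\<^sup>+x. indicator (J a) x * A x \<partial>lborel)
        + (\<integral>\<^sup>+k. indicator {0<..R} k * (ennreal (1 / k\<^sup>2) * (\<integral>\<^sup>+x. indicator (J a) x * B k x \<partial>lborel)) \<partial>lborel))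
      + ennreal (4 / R) * (sq_norm G)"
proof -
  let ?IA = "(\<integral>\<^sup>+x. indicator (J a) x * A x \<partial>lborel)"
  let ?IB = "\<lambda>k. (\<integral>\<^sup>+x. indicator (J a) x * B k x \<partial>lborel)"
  let ?N = "(sq_norm G)"
  have small: "ennreal (1 / k\<^sup>2) * (sq_norm (\<lambda>x. G (x + k) - G x)) \<le> c * (?IA + ennreal (1 / k\<^sup>2) * ?IB k)" if k: "0 < k" "k \<le> R" for k
  proof -
    have [measurable]: "(\<lambda>x. B k x) \<in> borel_measurable borel"
      using measurable_compose[OF _ assms(3), of "\<lambda>x. (k, x)" borel] by simp
    have "(sq_norm (\<lambda>x. G (x + k) - G x)) \<le> (\<integral>\<^sup>+x. c * (ennreal (k\<^sup>2) * (indicator (J a) (x + k) * A (x + k)) + indicator (J a) x * B k x) \<partial>lborel)"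
    proof (intro nn_integral_mono)
      fix x :: real
      show "ennreal ((G (x + k) - G x)\<^sup>2) \<le> c * (ennreal (k\<^sup>2) * (indicator (J a) (x + k) * A (x + k)) + indicator (J a) x * B k x)"
      \<comment> \<open>Outside this interval neither x nor x + k meets the support of G in
        [a - R, a + 2R], because 0 < k \<le> R.\<close>
      proof (cases "x \<in> {a - 2 * R..a + 2 * R}")
        case True
        then have "x \<in> J a" "x + k \<in> J a" using k R by (auto simp: J_def)
        then show ?thesis using H[OF k, of x] by simp
      next
        case False
        then have "G x = 0" "G (x + k) = 0" using k R by (auto intro!: G)
        then show ?thesis by simp
      qed
    qed
    also have "\<dots> = c * (ennreal (k\<^sup>2) * (\<integral>\<^sup>+x. indicator (J a) (x + k) * A (x + k) \<partial>lborel) + ?IB k)"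
      by (simp add: nn_integral_cmult nn_integral_add)
    also have "(\<integral>\<^sup>+x. indicator (J a) (x + k) * A (x + k) \<partial>lborel) = ?IA"
      by (rule nn_integral_translate_real) measurable
    finally have "ennreal (1 / k\<^sup>2) * (sq_norm (\<lambda>x. G (x + k) - G x)) \<le> ennreal (1 / k\<^sup>2) * (c * (ennreal (k\<^sup>2) * ?IA + ?IB k))"
      by (rule mult_left_mono) simp
    also have "\<dots> = c * ((ennreal (1 / k\<^sup>2) * ennreal (k\<^sup>2)) * ?IA + ennreal (1 / k\<^sup>2) * ?IB k)"
      by (simp only: distrib_left mult_ac)
    also have "ennreal (1 / k\<^sup>2) * ennreal (k\<^sup>2) = 1"
      using k by (subst ennreal_mult[symmetric]) auto
    finally show ?thesis by simp
  qed
  have large: "(sq_norm (\<lambda>x. G (x + k) - G x)) \<le> 4 * ?N" for k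
  proof -
    have "(sq_norm (\<lambda>x. G (x + k) - G x)) \<le> 2 * (sq_norm (\<lambda>x. G (x + k))) + 2 * ?N"
      by (rule nn_integral_power2_sum_le) auto
    also have "(sq_norm (\<lambda>x. G (x + k))) = ?N"
      by (rule nn_integral_translate_real) measurable
    finally show ?thesis by (simp flip: distrib_right)
  qed
  have "(\<integral>\<^sup>+k. indicator {0<..} k * (ennreal (1 / k\<^sup>2) * (sq_norm (\<lambda>x. G (x + k) - G x))) \<partial>lborel)
    \<le> (\<integral>\<^sup>+k. c * (indicator {0<..R} k * ?IA + indicator {0<..R} k * (ennreal (1 / k\<^sup>2) * ?IB k)) + (4 * ?N) * (ennreal (1 / k\<^sup>2) * indicator {R..} k) \<partial>lborel)"
  proof (intro nn_integral_mono)
    fix k :: real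
    consider "k \<le> 0" | "0 < k" "k \<le> R" | "R < k" by linarith
    then show "indicator {0<..} k * (ennreal (1 / k\<^sup>2) * (sq_norm (\<lambda>x. G (x + k) - G x))) \<le> c * (indicator {0<..R} k * ?IA + indicator {0<..R} k * (ennreal (1 / k\<^sup>2) * ?IB k)) + (4 * ?N) * (ennreal (1 / k\<^sup>2) * indicator {R..} k)"
    proof cases
      case 2
      then show ?thesis using small[OF 2] by (auto intro: add_increasing2)
    next
      case 3
      then show ?thesis using mult_left_mono[OF large[of k], of "ennreal (1 / k\<^sup>2)"] R by (auto simp: mult.commute intro: add_increasing)
    qed simp
  qed
  also have "\<dots> = c * (ennreal R * ?IA + (\<integral>\<^sup>+k. indicator {0<..R} k * (ennreal (1 / k\<^sup>2) * ?IB k) \<partial>lborel)) + (4 * ?N) * ennreal (1 / R)"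
    using R by (simp add: nn_integral_cmult nn_integral_add nn_integral_multc nn_integral_inverse_square)
  also have "(4 * ?N) * ennreal (1 / R) = ennreal (4 / R) * ?N"
    using R ennreal_mult[of 4 "1 / R"] by (simp add: mult_ac)
  finally show ?thesis .
qed

end

section \<open>Seminorms of functions of one variable\<close>

definition gagl :: "(real \<Rightarrow> real) \<Rightarrow> ennreal" where
  "gagl G = (\<integral>\<^sup>+k. indicator {0<..} k * (ennreal (1 / k\<^sup>2) * (sq_norm (\<lambda>x. G (x + k) - G x))) \<partial>lborel)"

definition sqint :: "(real \<Rightarrow> real) \<Rightarrow> ennreal" where
  "sqint G = sq_norm G"

text \<open>Together with \<open>gagl_combination\<close>, this common shape lets
  \<open>psi_shifty_le\<close> treat both functionals by one argument.\<close>

lemma sqint_combination: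
  assumes [measurable]: "G \<in> borel_measurable borel" "H \<in> borel_measurable borel"
  shows "sqint (\<lambda>x. c * G x + d * H x) \<le> 2 * (ennreal (c\<^sup>2) * sqint G) + 2 * (ennreal (d\<^sup>2) * sqint H)"
proof -
  have "sqint (\<lambda>x. c * G x + d * H x) \<le> 2 * (sq_norm (\<lambda>x. c * G x)) + 2 * (sq_norm (\<lambda>x. d * H x))"
    unfolding sqint_def by (rule nn_integral_power2_sum_le) auto
  then show ?thesis by (simp add: power_mult_distrib ennreal_mult nn_integral_cmult sqint_def)
qed

lemma gagl_combination:
  assumes [measurable]: "G \<in> borel_measurable borel" "H \<in> borel_measurable borel"
  shows "gagl (\<lambda>x. c * G x + d * H x) \<le> 2 * (ennreal (c\<^sup>2) * gagl G) + 2 * (ennreal (d\<^sup>2) * gagl H)"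
proof -
  let ?w = "\<lambda>k::real. indicator {0<..} k * ennreal (1 / k\<^sup>2)"
  have g: "gagl F = (\<integral>\<^sup>+k. ?w k * sqint (\<lambda>x. F (x + k) - F x) \<partial>lborel)" for F
    unfolding gagl_def sqint_def by (simp only: mult.assoc)
  have [measurable]: "(\<lambda>k. sqint (\<lambda>x. F (x + k) - F x)) \<in> borel_measurable borel" if [measurable]: "F \<in> borel_measurable borel" for F
    unfolding sqint_def by measurable
  have "gagl (\<lambda>x. c * G x + d * H x) \<le> (\<integral>\<^sup>+k. ?w k * (2 * (ennreal (c\<^sup>2) * sqint (\<lambda>x. G (x + k) - G x)) + 2 * (ennreal (d\<^sup>2) * sqint (\<lambda>x. H (x + k) - H x))) \<partial>lborel)"
    unfolding g
  proof (intro nn_integral_mono mult_left_mono)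
    fix k :: real
    have "c * G (x + k) + d * H (x + k) - (c * G x + d * H x) = c * (G (x + k) - G x) + d * (H (x + k) - H x)" for x
      by (simp add: algebra_simps)
    then show "sqint (\<lambda>x. c * G (x + k) + d * H (x + k) - (c * G x + d * H x)) \<le> 2 * (ennreal (c\<^sup>2) * sqint (\<lambda>x. G (x + k) - G x)) + 2 * (ennreal (d\<^sup>2) * sqint (\<lambda>x. H (x + k) - H x))"
      by (simp only:) (rule sqint_combination, measurable)
  qed simp
  also have "\<dots> = (\<integral>\<^sup>+k. 2 * (ennreal (c\<^sup>2) * (?w k * sqint (\<lambda>x. G (x + k) - G x))) + 2 * (ennreal (d\<^sup>2) * (?w k * sqint (\<lambda>x. H (x + k) - H x))) \<partial>lborel)"
    by (intro nn_integral_cong) (simp only: distrib_left mult_ac)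
  also have "\<dots> = 2 * (ennreal (c\<^sup>2) * gagl G) + 2 * (ennreal (d\<^sup>2) * gagl H)"
    unfolding g by (simp add: nn_integral_add nn_integral_cmult)
  finally show ?thesis .
qed

lemma gagl_cmult:
  assumes [measurable]: "G \<in> borel_measurable borel"
  shows "gagl (\<lambda>x. c * G x) = ennreal (c\<^sup>2) * gagl G"
proof -
  have "(sq_norm (\<lambda>x. c * G (x + k) - c * G x)) = ennreal (c\<^sup>2) * (sq_norm (\<lambda>x. G (x + k) - G x))" for k
    unfolding right_diff_distrib[symmetric] power_mult_distrib by (simp add: ennreal_mult nn_integral_cmult)
  then have "gagl (\<lambda>x. c * G x) = (\<integral>\<^sup>+k. ennreal (c\<^sup>2) * (indicator {0<..} k * (ennreal (1 / k\<^sup>2) * (sq_norm (\<lambda>x. G (x + k) - G x)))) \<partial>lborel)"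
    unfolding gagl_def by (intro nn_integral_cong) (simp only: mult_ac)
  also have "\<dots> = ennreal (c\<^sup>2) * gagl G" unfolding gagl_def by (rule nn_integral_cmult) measurable
  finally show ?thesis .
qed

lemma power2_sum4_le: "((x::real) + y + z + t)\<^sup>2 \<le> 4 * (x\<^sup>2 + y\<^sup>2 + z\<^sup>2 + t\<^sup>2)"
  using power2_sum_le[of "x + y" "z + t"] power2_sum_le[of x y] power2_sum_le[of z t] by (simp add: add.assoc)

context cutoff
begin

section \<open>The localised antiderivative of a section and its derivative\<close>

definition g0 :: "real \<Rightarrow> (real \<Rightarrow> real) \<Rightarrow> real \<Rightarrow> real" where
  "g0 a w x = \<alpha> (x - a) * anti a w x"

text \<open>The formal derivative of \<open>g0 a w\<close>. As w is only square integrable, the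
  relation is established on the Fourier side, in \<open>ft1_g1\<close>.\<close>

definition g1 :: "real \<Rightarrow> (real \<Rightarrow> real) \<Rightarrow> real \<Rightarrow> real" where
  "g1 a w x = \<alpha>' (x - a) * anti a w x + \<alpha> (x - a) * w x"

definition gaglI :: "real \<Rightarrow> (real \<Rightarrow> real) \<Rightarrow> ennreal" where
  "gaglI a w = (\<integral>\<^sup>+k. indicator {0<..} k * (ennreal (1 / k\<^sup>2) * (\<integral>\<^sup>+x. indicator {a - 2 * R..a + 9 * R} x * ennreal ((w (x + k) - w x)\<^sup>2) \<partial>lborel)) \<partial>lborel)"

lemma g_measurable [measurable]:
  assumes [measurable]: "w \<in> borel_measurable borel"
  shows "g0 a w \<in> borel_measurable borel" "g1 a w \<in> borel_measurable borel"
  unfolding g0_def[abs_def] g1_def[abs_def] by measurable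

lemma g_zero: "x < a - R \<or> a + 2 * R < x \<Longrightarrow> g0 a w x = 0" "x < a - R \<or> a + 2 * R < x \<Longrightarrow> g1 a w x = 0"
  using supp[of "x - a"] by (auto simp: g0_def g1_def)

lemma J_subset: "J a \<subseteq> {a - 2 * R..a + 9 * R}" using R by (auto simp: J_def)

lemma square_le_M: "\<bar>x\<bar> \<le> M * c \<Longrightarrow> x\<^sup>2 \<le> M\<^sup>2 * c\<^sup>2"
  by (metis abs_ge_zero power2_abs power_mono power_mult_distrib)

lemma sqint_g0:
  assumes w: "lsq w" shows "sqint (g0 a w) \<le> ennreal (M\<^sup>2) * antiJ a w"
proof -
  note [measurable] = lsq_measurable[OF w]
  have "sqint (g0 a w) \<le> (\<integral>\<^sup>+x. ennreal (M\<^sup>2) * (indicator (J a) x * ennreal ((anti a w x)\<^sup>2)) \<partial>lborel)"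
    unfolding sqint_def
  proof (intro nn_integral_mono)
    fix x :: real
    show "ennreal ((g0 a w x)\<^sup>2) \<le> ennreal (M\<^sup>2) * (indicator (J a) x * ennreal ((anti a w x)\<^sup>2))"
    proof (cases "x \<in> J a")
      case True
      have "(\<alpha> (x - a))\<^sup>2 \<le> M\<^sup>2" using square_le_M[of "\<alpha> (x - a)" 1] bounds by simp
      then have "(g0 a w x)\<^sup>2 \<le> M\<^sup>2 * (anti a w x)\<^sup>2" unfolding g0_def power_mult_distrib by (intro mult_right_mono) auto
      then show ?thesis using True by (simp add: ennreal_mult[symmetric] ennreal_leI)
    qed (use R in \<open>auto simp: J_def g_zero not_le\<close>)
  qed
  also have "\<dots> = ennreal (M\<^sup>2) * antiJ a w" unfolding antiJ_def by (rule nn_integral_cmult) measurable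
  finally show ?thesis .
qed

lemma sqint_g1:
  assumes w: "lsq w" shows "sqint (g1 a w) \<le> ennreal (2 * M\<^sup>2) * (antiJ a w + sqI a w)"
proof -
  note [measurable] = lsq_measurable[OF w]
  have "sqint (g1 a w) \<le> (\<integral>\<^sup>+x. ennreal (2 * M\<^sup>2) * (indicator (J a) x * ennreal ((anti a w x)\<^sup>2) + indicator {a - 2 * R..a + 9 * R} x * ennreal ((w x)\<^sup>2)) \<partial>lborel)"
    unfolding sqint_def
  proof (intro nn_integral_mono)
    fix x :: real
    show "ennreal ((g1 a w x)\<^sup>2) \<le> ennreal (2 * M\<^sup>2) * (indicator (J a) x * ennreal ((anti a w x)\<^sup>2) + indicator {a - 2 * R..a + 9 * R} x * ennreal ((w x)\<^sup>2))"
    proof (cases "x \<in> J a")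
      case True
      have "(\<alpha> (x - a))\<^sup>2 \<le> M\<^sup>2" "(\<alpha>' (x - a))\<^sup>2 \<le> M\<^sup>2" using square_le_M[of _ 1] bounds by auto
      then have "(g1 a w x)\<^sup>2 \<le> 2 * (M\<^sup>2 * (anti a w x)\<^sup>2) + 2 * (M\<^sup>2 * (w x)\<^sup>2)"
        unfolding g1_def by (intro order_trans[OF power2_sum_le] add_mono) (auto simp: power_mult_distrib mult_right_mono)
      then have "(g1 a w x)\<^sup>2 \<le> 2 * M\<^sup>2 * ((anti a w x)\<^sup>2 + (w x)\<^sup>2)" by (simp add: algebra_simps)
      then have "ennreal ((g1 a w x)\<^sup>2) \<le> ennreal (2 * M\<^sup>2) * (ennreal ((anti a w x)\<^sup>2) + ennreal ((w x)\<^sup>2))"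
        by (subst ennreal_plus[symmetric], simp, simp, subst ennreal_mult[symmetric], simp, simp, rule ennreal_leI)
      then show ?thesis using True J_subset[of a] by auto
    qed (use R in \<open>auto simp: J_def g_zero not_le\<close>)
  qed
  also have "\<dots> = ennreal (2 * M\<^sup>2) * (antiJ a w + sqI a w)" unfolding antiJ_def sqI_def
    by (subst nn_integral_cmult) (simp_all add: nn_integral_add)
  finally show ?thesis .
qed

text \<open>The increment of a product splits into an increment of \<alpha>, of size k, and an
  increment of \<open>anti\<close>, which is a primitive of w. No norm of w itself enters, which is
  essential when w is a vertical difference.\<close>

lemma gagl_g0:
  assumes w: "lsq w"
  shows "gagl (g0 a w) \<le> ennreal (2 * M\<^sup>2) * (ennreal R * antiJ a w + V2 a w) + ennreal (4 / R) * (ennreal (M\<^sup>2) * antiJ a w)"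
proof -
  note [measurable] = lsq_measurable[OF w]
  note pm = prim1_measurable2[OF lsq_measurable[OF w]]
  have "gagl (g0 a w) \<le> ennreal (2 * M\<^sup>2) * (ennreal R * (\<integral>\<^sup>+x. indicator (J a) x * ennreal ((anti a w x)\<^sup>2) \<partial>lborel)
        + (\<integral>\<^sup>+k. indicator {0<..R} k * (ennreal (1 / k\<^sup>2) * (\<integral>\<^sup>+x. indicator (J a) x * ennreal ((prim1 k w x)\<^sup>2) \<partial>lborel)) \<partial>lborel))
      + ennreal (4 / R) * (sq_norm (g0 a w))"
    unfolding gagl_def
  proof (rule gagliardo_split)
    show "(\<lambda>(k, x). ennreal ((prim1 k w x)\<^sup>2)) \<in> borel_measurable (borel \<Otimes>\<^sub>M borel)" using pm by measurable
    fix k x assume k: "0 < k" "k \<le> R" and x: "x \<in> J a" "x + k \<in> J a"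
    have d: "anti a w (x + k) - anti a w x = prim1 k w x" using k x by (intro anti_diff w) (auto simp: J_def)
    have e: "g0 a w (x + k) - g0 a w x = (\<alpha> (x + k - a) - \<alpha> (x - a)) * anti a w (x + k) + \<alpha> (x - a) * prim1 k w x"
      unfolding d[symmetric] g0_def by (simp add: algebra_simps)
    have 1: "(\<alpha> (x + k - a) - \<alpha> (x - a))\<^sup>2 \<le> M\<^sup>2 * k\<^sup>2"
      using lip(1)[of "x + k - a" "x - a"] k by (intro square_le_M) simp
    have 2: "(\<alpha> (x - a))\<^sup>2 \<le> M\<^sup>2" using square_le_M[of _ 1] bounds by auto
    have "(g0 a w (x + k) - g0 a w x)\<^sup>2 \<le> 2 * (M\<^sup>2 * k\<^sup>2 * (anti a w (x + k))\<^sup>2) + 2 * (M\<^sup>2 * (prim1 k w x)\<^sup>2)"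
      unfolding e using 1 2 by (intro order_trans[OF power2_sum_le] add_mono) (auto simp: power_mult_distrib mult_right_mono)
    then have "(g0 a w (x + k) - g0 a w x)\<^sup>2 \<le> 2 * M\<^sup>2 * (k\<^sup>2 * (anti a w (x + k))\<^sup>2 + (prim1 k w x)\<^sup>2)" by (simp add: algebra_simps)
    then show "ennreal ((g0 a w (x + k) - g0 a w x)\<^sup>2) \<le> ennreal (2 * M\<^sup>2) * (ennreal (k\<^sup>2) * ennreal ((anti a w (x + k))\<^sup>2) + ennreal ((prim1 k w x)\<^sup>2))"
      by (subst ennreal_mult[symmetric], simp, simp, subst ennreal_plus[symmetric], simp, simp, subst ennreal_mult[symmetric], simp, simp, rule ennreal_leI)
  qed (auto simp: g_zero)
  also have "\<dots> \<le> ennreal (2 * M\<^sup>2) * (ennreal R * antiJ a w + V2 a w) + ennreal (4 / R) * (ennreal (M\<^sup>2) * antiJ a w)"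
  proof (intro add_mono mult_left_mono)
    show "(sq_norm (g0 a w)) \<le> ennreal (M\<^sup>2) * antiJ a w"
      using sqint_g0[OF w] unfolding sqint_def .
    show "(\<integral>\<^sup>+k. indicator {0<..R} k * (ennreal (1 / k\<^sup>2) * (\<integral>\<^sup>+x. indicator (J a) x * ennreal ((prim1 k w x)\<^sup>2) \<partial>lborel)) \<partial>lborel) \<le> V2 a w"
      unfolding V2_def primJ_def using R by (intro nn_integral_mono mult_right_mono) (auto simp: indicator_def)
  qed (auto simp: antiJ_def)
  finally show ?thesis .
qed

text \<open>The same product expansion, now with four terms. The increments of w produce
  \<open>gaglI\<close>, the local half-derivative energy; those of the two cutoff factors cost a
  factor k each.\<close>

lemma gagl_g1:
  assumes w: "lsq w"
  shows "gagl (g1 a w) \<le> ennreal (4 * M\<^sup>2) * (ennreal R * (antiJ a w + sqI a w) + (V2 a w + gaglI a w)) + ennreal (4 / R) * (ennreal (2 * M\<^sup>2) * (antiJ a w + sqI a w))"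
proof -
  note [measurable] = lsq_measurable[OF w]
  note pm = prim1_measurable2[OF lsq_measurable[OF w]]
  let ?A = "\<lambda>x. ennreal ((anti a w x)\<^sup>2) + ennreal ((w x)\<^sup>2)"
  let ?B = "\<lambda>k x. ennreal ((prim1 k w x)\<^sup>2) + ennreal ((w (x + k) - w x)\<^sup>2)"
  have "gagl (g1 a w) \<le> ennreal (4 * M\<^sup>2) * (ennreal R * (\<integral>\<^sup>+x. indicator (J a) x * ?A x \<partial>lborel)
        + (\<integral>\<^sup>+k. indicator {0<..R} k * (ennreal (1 / k\<^sup>2) * (\<integral>\<^sup>+x. indicator (J a) x * ?B k x \<partial>lborel)) \<partial>lborel))
      + ennreal (4 / R) * (sq_norm (g1 a w))"
    unfolding gagl_def
  proof (rule gagliardo_split)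
    show "(\<lambda>(k, x). ?B k x) \<in> borel_measurable (borel \<Otimes>\<^sub>M borel)" using pm by measurable
    fix k x assume k: "0 < k" "k \<le> R" and x: "x \<in> J a" "x + k \<in> J a"
    have d: "anti a w (x + k) - anti a w x = prim1 k w x" using k x by (intro anti_diff w) (auto simp: J_def)
    have e: "g1 a w (x + k) - g1 a w x = (\<alpha>' (x + k - a) - \<alpha>' (x - a)) * anti a w (x + k) + \<alpha>' (x - a) * prim1 k w x
       + (\<alpha> (x + k - a) - \<alpha> (x - a)) * w (x + k) + \<alpha> (x - a) * (w (x + k) - w x)"
      unfolding d[symmetric] g1_def by (simp add: algebra_simps)
    have 1: "(\<alpha> (x + k - a) - \<alpha> (x - a))\<^sup>2 \<le> M\<^sup>2 * k\<^sup>2" "(\<alpha>' (x + k - a) - \<alpha>' (x - a))\<^sup>2 \<le> M\<^sup>2 * k\<^sup>2"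
      using lip[of "x + k - a" "x - a"] k by (auto intro!: square_le_M)
    have 2: "(\<alpha> (x - a))\<^sup>2 \<le> M\<^sup>2" "(\<alpha>' (x - a))\<^sup>2 \<le> M\<^sup>2" using square_le_M[of _ 1] bounds by auto
    have "(g1 a w (x + k) - g1 a w x)\<^sup>2 \<le> 4 * (M\<^sup>2 * k\<^sup>2 * (anti a w (x + k))\<^sup>2 + M\<^sup>2 * (prim1 k w x)\<^sup>2 + M\<^sup>2 * k\<^sup>2 * (w (x + k))\<^sup>2 + M\<^sup>2 * (w (x + k) - w x)\<^sup>2)"
      unfolding e using 1 2
      by (intro order_trans[OF power2_sum4_le] mult_left_mono add_mono) (auto simp: power_mult_distrib mult_right_mono)
    then have "(g1 a w (x + k) - g1 a w x)\<^sup>2 \<le> 4 * M\<^sup>2 * (k\<^sup>2 * ((anti a w (x + k))\<^sup>2 + (w (x + k))\<^sup>2) + ((prim1 k w x)\<^sup>2 + (w (x + k) - w x)\<^sup>2))" by (simp add: algebra_simps)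
    then have "ennreal ((g1 a w (x + k) - g1 a w x)\<^sup>2) \<le> ennreal (4 * M\<^sup>2 * (k\<^sup>2 * ((anti a w (x + k))\<^sup>2 + (w (x + k))\<^sup>2) + ((prim1 k w x)\<^sup>2 + (w (x + k) - w x)\<^sup>2)))"
      by (rule ennreal_leI)
    also have "\<dots> = ennreal (4 * M\<^sup>2) * (ennreal (k\<^sup>2) * ?A (x + k) + ?B k x)"
      by (simp only: ennreal_mult ennreal_plus zero_le_power2 add_nonneg_nonneg mult_nonneg_nonneg zero_le_numeral)
    finally show "ennreal ((g1 a w (x + k) - g1 a w x)\<^sup>2) \<le> ennreal (4 * M\<^sup>2) * (ennreal (k\<^sup>2) * ?A (x + k) + ?B k x)" .
  qed (auto simp: g_zero)
  also have "\<dots> \<le> ennreal (4 * M\<^sup>2) * (ennreal R * (antiJ a w + sqI a w) + (V2 a w + gaglI a w)) + ennreal (4 / R) * (ennreal (2 * M\<^sup>2) * (antiJ a w + sqI a w))"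
  proof (intro add_mono mult_left_mono)
    have "(\<integral>\<^sup>+x. indicator (J a) x * ?A x \<partial>lborel) = antiJ a w + (\<integral>\<^sup>+x. indicator (J a) x * ennreal ((w x)\<^sup>2) \<partial>lborel)"
      unfolding antiJ_def by (simp add: distrib_left nn_integral_add)
    also have "\<dots> \<le> antiJ a w + sqI a w"
      unfolding sqI_def using J_subset[of a] by (intro add_left_mono nn_integral_mono mult_right_mono) (auto simp: indicator_def)
    finally show "(\<integral>\<^sup>+x. indicator (J a) x * ?A x \<partial>lborel) \<le> antiJ a w + sqI a w" .
    have pk [measurable]: "(\<lambda>x. prim1 k w x) \<in> borel_measurable borel" for k
      using measurable_compose[OF _ pm, of "\<lambda>x. (k, x)" borel] by simp
    let ?D = "\<lambda>k. (\<integral>\<^sup>+x. indicator (J a) x * ennreal ((w (x + k) - w x)\<^sup>2) \<partial>lborel)"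
    have "(\<integral>\<^sup>+k. indicator {0<..R} k * (ennreal (1 / k\<^sup>2) * (\<integral>\<^sup>+x. indicator (J a) x * ?B k x \<partial>lborel)) \<partial>lborel)
      = (\<integral>\<^sup>+k. indicator {0<..R} k * (ennreal (1 / k\<^sup>2) * primJ a w k) + indicator {0<..R} k * (ennreal (1 / k\<^sup>2) * ?D k) \<partial>lborel)"
      unfolding primJ_def by (simp add: distrib_left nn_integral_add)
    also have "\<dots> = (\<integral>\<^sup>+k. indicator {0<..R} k * (ennreal (1 / k\<^sup>2) * primJ a w k) \<partial>lborel) + (\<integral>\<^sup>+k. indicator {0<..R} k * (ennreal (1 / k\<^sup>2) * ?D k) \<partial>lborel)"
      by (rule nn_integral_add) measurable
    also have "\<dots> \<le> V2 a w + gaglI a w"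
    proof (intro add_mono)
      show "(\<integral>\<^sup>+k. indicator {0<..R} k * (ennreal (1 / k\<^sup>2) * primJ a w k) \<partial>lborel) \<le> V2 a w"
        unfolding V2_def using R by (intro nn_integral_mono mult_right_mono) (auto simp: indicator_def)
      show "(\<integral>\<^sup>+k. indicator {0<..R} k * (ennreal (1 / k\<^sup>2) * ?D k) \<partial>lborel) \<le> gaglI a w"
        unfolding gaglI_def using J_subset[of a]
        by (intro nn_integral_mono mult_mono) (auto simp: indicator_def)
    qed
    finally show "(\<integral>\<^sup>+k. indicator {0<..R} k * (ennreal (1 / k\<^sup>2) * (\<integral>\<^sup>+x. indicator (J a) x * ?B k x \<partial>lborel)) \<partial>lborel) \<le> V2 a w + gaglI a w" .
    show "(sq_norm (g1 a w)) \<le> ennreal (2 * M\<^sup>2) * (antiJ a w + sqI a w)"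
      using sqint_g1[OF w] unfolding sqint_def .
  qed auto
  finally show ?thesis .
qed

section \<open>Constants depending only on R and M\<close>

definition Kc :: ennreal where "Kc = ennreal (1 / R) * ennreal (36 * R\<^sup>2)"
definition Kd :: ennreal where "Kd = Kc * ennreal (6 * R)"
definition K1 :: ennreal where "K1 = ennreal (2 * M\<^sup>2) * (Kd + 1)"
definition K2 :: ennreal where "K2 = ennreal (4 * M\<^sup>2) * (ennreal R * (Kd + 1) + (ennreal (6 * R) + 1)) + ennreal (4 / R) * K1"
definition K3 :: ennreal where "K3 = ennreal (2 * M\<^sup>2) * (ennreal R * Kc + 1) + ennreal (4 / R) * (ennreal (M\<^sup>2) * Kc)"
definition K4 :: ennreal where "K4 = ennreal (M\<^sup>2) * ennreal (1 / R)"
definition K :: ennreal where "K = K1 + K2 + K3 + K4"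

lemma K_finite: "K < \<infinity>"
  by (simp add: K_def K1_def K2_def K3_def K4_def Kd_def Kc_def ennreal_mult_less_top)

lemma K_ge: "K1 \<le> K" "K2 \<le> K" "K3 \<le> K" "K4 \<le> K"
  by (auto simp: K_def add_increasing add_increasing2)

lemma antiJ_V2: assumes w: "lsq w" shows "antiJ a w \<le> Kc * V2 a w"
  unfolding Kc_def mult.assoc by (rule order_trans[OF antiJ_le[OF w]], rule mult_left_mono[OF V1_le[OF w]]) simp

lemma antiJ_sqI: assumes w: "lsq w" shows "antiJ a w + sqI a w \<le> (Kd + 1) * sqI a w"
proof -
  have "antiJ a w \<le> Kd * sqI a w"
    unfolding Kd_def mult.assoc by (rule order_trans[OF antiJ_V2[OF w]], rule mult_left_mono[OF V2_le[OF w]]) simp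
  then show ?thesis by (simp add: distrib_right add_right_mono)
qed

text \<open>The first two bounds will be applied to sections of u, so they may spend its L2 and
  half-derivative energies. The last two will also be applied to vertical differences of u, for
  which only the primitive energies \<open>V2\<close> and \<open>V1\<close> are affordable.\<close>

lemma section_bounds:
  assumes w: "lsq w"
  shows "sqint (g1 a w) \<le> K * sqI a w" "gagl (g1 a w) \<le> K * (sqI a w + gaglI a w)"
    "gagl (g0 a w) \<le> K * V2 a w" "sqint (g0 a w) \<le> K * V1 a w"
proof -
  have 1: "ennreal (2 * M\<^sup>2) * (antiJ a w + sqI a w) \<le> K1 * sqI a w"
    unfolding K1_def mult.assoc by (intro mult_left_mono antiJ_sqI[OF w]) simp
  have "sqint (g1 a w) \<le> K1 * sqI a w" by (rule order_trans[OF sqint_g1[OF w] 1])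
  also have "\<dots> \<le> K * sqI a w" by (intro mult_right_mono K_ge) simp
  finally show "sqint (g1 a w) \<le> K * sqI a w" .
  have "V2 a w + gaglI a w \<le> (ennreal (6 * R) + 1) * (sqI a w + gaglI a w)"
    using V2_le[OF w, of a] by (simp add: algebra_simps add_mono add_increasing add_increasing2)
  moreover have "antiJ a w + sqI a w \<le> (Kd + 1) * (sqI a w + gaglI a w)"
    by (rule order_trans[OF antiJ_sqI[OF w]]) (simp add: mult_left_mono)
  moreover have "ennreal (2 * M\<^sup>2) * (antiJ a w + sqI a w) \<le> K1 * (sqI a w + gaglI a w)"
    by (rule order_trans[OF 1]) (simp add: mult_left_mono)
  ultimately have "gagl (g1 a w) \<le> ennreal (4 * M\<^sup>2) * (ennreal R * ((Kd + 1) * (sqI a w + gaglI a w)) + (ennreal (6 * R) + 1) * (sqI a w + gaglI a w)) + ennreal (4 / R) * (K1 * (sqI a w + gaglI a w))"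
    by (intro order_trans[OF gagl_g1[OF w]] add_mono mult_left_mono) auto
  also have "\<dots> = K2 * (sqI a w + gaglI a w)"
    unfolding K2_def by (simp only: distrib_right mult.assoc)
  also have "\<dots> \<le> K * (sqI a w + gaglI a w)" by (intro mult_right_mono K_ge) simp
  finally show "gagl (g1 a w) \<le> K * (sqI a w + gaglI a w)" .
  have "gagl (g0 a w) \<le> ennreal (2 * M\<^sup>2) * (ennreal R * (Kc * V2 a w) + V2 a w) + ennreal (4 / R) * (ennreal (M\<^sup>2) * (Kc * V2 a w))"
    by (intro order_trans[OF gagl_g0[OF w]] add_mono mult_left_mono antiJ_V2[OF w] order_refl) auto
  also have "\<dots> = K3 * V2 a w" unfolding K3_def by (simp only: distrib_right mult.assoc distrib_left mult_1_left)
  also have "\<dots> \<le> K * V2 a w" by (intro mult_right_mono K_ge) simp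
  finally show "gagl (g0 a w) \<le> K * V2 a w" .
  have "sqint (g0 a w) \<le> K4 * V1 a w"
    unfolding K4_def mult.assoc by (rule order_trans[OF sqint_g0[OF w]], intro mult_left_mono antiJ_le[OF w]) simp
  also have "\<dots> \<le> K * V1 a w" by (intro mult_right_mono K_ge) simp
  finally show "sqint (g0 a w) \<le> K * V1 a w" .
qed


section \<open>Differentiation of the localised antiderivative on the Fourier side\<close>

lemma integrable_anti_kernel:
  assumes w: "lsq w" and [measurable]: "A \<in> borel_measurable borel" and A: "\<And>x. \<bar>A x\<bar> \<le> M" "\<And>x. x < a - R \<or> a + 2 * R < x \<Longrightarrow> A x = 0"
  shows "integrable (lborel \<Otimes>\<^sub>M lborel) (\<lambda>(x, s). (indicator {x..} s * \<kappa> (s - a) * w s) *\<^sub>R (A x *\<^sub>R cis (- (x * \<xi>))))"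
proof (rule Bochner_Integration.integrable_bound)
  note [measurable] = lsq_measurable[OF w]
  let ?I = "{a - R..a + 4 * R}"
  show "integrable (lborel \<Otimes>\<^sub>M lborel) (\<lambda>(x, s). M * indicat_real ?I x * (indicator ?I s * w s))"
  proof (rule pair_sigma_finite.Fubini_integrable[OF lborel_psf])
    have "integrable lborel (indicat_real ?I)" by (intro integrable_real_indicator) (auto simp: emeasure_lborel_Icc_eq)
    then show "integrable lborel (\<lambda>z. LINT s|lborel. norm (case (z, s) of (x, s) \<Rightarrow> M * indicat_real ?I x * (indicator ?I s * w s)))"
      by (simp add: abs_mult)
    show "AE z in lborel. integrable lborel (\<lambda>s. case (z, s) of (x, s) \<Rightarrow> M * indicat_real ?I x * (indicator ?I s * w s))"
      using lsq_integrable[OF w] by simp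
  qed measurable
  have [measurable]: "Measurable.pred (borel \<Otimes>\<^sub>M borel) (\<lambda>x::real \<times> real. fst x \<le> snd x)" by measurable
  show "(\<lambda>(x, s). (indicator {x..} s * \<kappa> (s - a) * w s) *\<^sub>R (A x *\<^sub>R cis (- (x * \<xi>)))) \<in> borel_measurable (lborel \<Otimes>\<^sub>M lborel)"
    unfolding indicator_def atLeast_iff by measurable
  have "norm ((indicator {x..} s * \<kappa> (s - a) * w s) *\<^sub>R (A x *\<^sub>R cis (- (x * \<xi>)))) \<le> norm (M * indicat_real ?I x * (indicator ?I s * w s))" for x s
  proof (cases "x \<le> s \<and> s \<le> a + 4 * R \<and> a - R \<le> x \<and> x \<le> a + 2 * R")
    case True
    then have "x \<in> ?I" "s \<in> ?I" using R by auto
    moreover have "\<kappa> (s - a) * \<bar>w s\<bar> * \<bar>A x\<bar> \<le> 1 * \<bar>w s\<bar> * M"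
      using A(1)[of x] \<kappa>_bounds[of "s - a"] by (intro mult_mono) auto
    ultimately show ?thesis using True M \<kappa>_bounds[of "s - a"] by (simp add: abs_mult mult_ac)
  next
    case False
    then have "indicator {x..} s * \<kappa> (s - a) * A x = 0" using A(2)[of x] \<kappa>_zero[of "s - a"] by (auto simp: indicator_def)
    then have eq: "(indicator {x..} s * \<kappa> (s - a) * w s) *\<^sub>R (A x *\<^sub>R cis (- (x * \<xi>))) = 0" by auto
    show ?thesis by (subst eq) simp
  qed
  then show "AE p in lborel \<Otimes>\<^sub>M lborel. norm (case p of (x, s) \<Rightarrow> (indicator {x..} s * \<kappa> (s - a) * w s) *\<^sub>R (A x *\<^sub>R cis (- (x * \<xi>)))) \<le> norm (case p of (x, s) \<Rightarrow> M * indicat_real ?I x * (indicator ?I s * w s))"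
    by auto
qed

text \<open>Exchanging the integrals moves the inner integration from w to the cutoff factor
  \<open>A\<close>, so that integration by parts can be carried out on a continuously differentiable
  function.\<close>

lemma anti_kernel:
  assumes w: "lsq w" and [measurable]: "A \<in> borel_measurable borel" and A: "\<And>x. \<bar>A x\<bar> \<le> M" "\<And>x. x < a - R \<or> a + 2 * R < x \<Longrightarrow> A x = 0"
  shows "(LINT x|lborel. (A x * anti a w x) *\<^sub>R cis (- (x * \<xi>))) = - (LINT s|lborel. (\<kappa> (s - a) * w s) *\<^sub>R (LINT x|lborel. indicator {..s} x *\<^sub>R (A x *\<^sub>R cis (- (x * \<xi>)))))" (is ?eq)
    and "integrable lborel (\<lambda>s. (\<kappa> (s - a) * w s) *\<^sub>R (LINT x|lborel. indicator {..s} x *\<^sub>R (A x *\<^sub>R cis (- (x * \<xi>)))))" (is ?int)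
    and "integrable lborel (\<lambda>x. (A x * anti a w x) *\<^sub>R cis (- (x * \<xi>)))"
proof -
  note i = integrable_anti_kernel[where a=a and \<xi>=\<xi>, OF assms]
  have s: "(LINT x|lborel. (indicator {x..} s * \<kappa> (s - a) * w s) *\<^sub>R (A x *\<^sub>R cis (- (x * \<xi>)))) = (\<kappa> (s - a) * w s) *\<^sub>R (LINT x|lborel. indicator {..s} x *\<^sub>R (A x *\<^sub>R cis (- (x * \<xi>))))" for s
    unfolding integral_scaleR_right[symmetric] by (intro Bochner_Integration.integral_cong) (auto simp: indicator_def)
  have x: "(LINT s|lborel. (indicator {x..} s * \<kappa> (s - a) * w s) *\<^sub>R (A x *\<^sub>R cis (- (x * \<xi>)))) = - ((A x * anti a w x) *\<^sub>R cis (- (x * \<xi>)))" for x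
    unfolding integral_scaleR_left_complex anti_def by simp
  have "(LINT x|lborel. (LINT s|lborel. (indicator {x..} s * \<kappa> (s - a) * w s) *\<^sub>R (A x *\<^sub>R cis (- (x * \<xi>))))) = (LINT s|lborel. (LINT x|lborel. (indicator {x..} s * \<kappa> (s - a) * w s) *\<^sub>R (A x *\<^sub>R cis (- (x * \<xi>)))))"
    by (rule pair_sigma_finite.Fubini_integral[OF lborel_psf i, symmetric])
  then have "- (- (LINT x|lborel. (A x * anti a w x) *\<^sub>R cis (- (x * \<xi>)))) = - (LINT s|lborel. (\<kappa> (s - a) * w s) *\<^sub>R (LINT x|lborel. indicator {..s} x *\<^sub>R (A x *\<^sub>R cis (- (x * \<xi>)))))"
    unfolding s x Bochner_Integration.integral_minus by (rule arg_cong)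
  then show ?eq unfolding minus_minus .
  show ?int using pair_sigma_finite.integrable_snd[OF lborel_psf i] unfolding s .
  show "integrable lborel (\<lambda>x. (A x * anti a w x) *\<^sub>R cis (- (x * \<xi>)))"
    using pair_sigma_finite.integrable_fst[OF lborel_psf i] unfolding x by simp
qed

lemma cutoff_by_parts:
  "(LINT x|lborel. indicator {..s} x *\<^sub>R (\<alpha>' (x - a) *\<^sub>R cis (- (x * \<xi>)))) = \<alpha> (s - a) *\<^sub>R cis (- (s * \<xi>)) + \<i> * \<xi> * (LINT x|lborel. indicator {..s} x *\<^sub>R (\<alpha> (x - a) *\<^sub>R cis (- (x * \<xi>))))"
proof -
  \<comment> \<open>A lower limit that is at most s and to the left of the support, so the lower
    boundary term vanishes and the half-line can be replaced by a compact interval.\<close>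
  define c where "c = min s (a - R - 1)"
  have c: "c \<le> s" "\<alpha> (c - a) = 0" using supp[of "c - a"] R by (auto simp: c_def min_def split: if_splits)
  have out: "\<alpha> (x - a) = 0 \<and> \<alpha>' (x - a) = 0" if "x < c" for x using that by (intro supp) (auto simp: c_def)
  have cc: "continuous_on {c..s} (\<lambda>x. \<alpha> (x - a))" "continuous_on {c..s} (\<lambda>x. \<alpha>' (x - a))"
    by (intro continuous_on_compose2[OF continuous_cutoff(1)[of UNIV]] continuous_on_compose2[OF continuous_cutoff(2)[of UNIV]] continuous_intros; simp)+
  have e: "continuous_on {c..s} (\<lambda>x. cis (- (x * \<xi>)))" by (intro continuous_intros)
  have i1: "integrable lborel (\<lambda>x. indicator {c..s} x *\<^sub>R (\<alpha>' (x - a) *\<^sub>R cis (- (x * \<xi>))))"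
    by (intro borel_integrable_compact continuous_intros cc) auto
  have i0: "integrable lborel (\<lambda>x. \<i> * \<xi> * (indicator {c..s} x *\<^sub>R (\<alpha> (x - a) *\<^sub>R cis (- (x * \<xi>)))))"
    by (intro integrable_mult_right borel_integrable_compact continuous_intros cc) auto
  have ind: "(LINT x|lborel. indicator {..s} x *\<^sub>R (\<alpha> (x - a) *\<^sub>R cis (- (x * \<xi>)))) = (LINT x|lborel. indicator {c..s} x *\<^sub>R (\<alpha> (x - a) *\<^sub>R cis (- (x * \<xi>))))"
    "(LINT x|lborel. indicator {..s} x *\<^sub>R (\<alpha>' (x - a) *\<^sub>R cis (- (x * \<xi>)))) = (LINT x|lborel. indicator {c..s} x *\<^sub>R (\<alpha>' (x - a) *\<^sub>R cis (- (x * \<xi>))))"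
    using out by (auto intro!: Bochner_Integration.integral_cong simp: indicator_def not_le)
  have "(LINT x|lborel. indicator {c..s} x *\<^sub>R (\<alpha>' (x - a) *\<^sub>R cis (- (x * \<xi>)) - \<i> * \<xi> * (\<alpha> (x - a) *\<^sub>R cis (- (x * \<xi>)))))
    = \<alpha> (s - a) *\<^sub>R cis (- (s * \<xi>)) - \<alpha> (c - a) *\<^sub>R cis (- (c * \<xi>))"
  proof (rule integral_FTC_Icc[OF c(1)])
    fix x assume "c \<le> x" "x \<le> s"
    have A: "((\<lambda>x. \<alpha> (x - a)) has_real_derivative \<alpha>' (x - a)) (at x within {c..s})"
    proof (rule has_field_derivative_at_within)
      have "((\<lambda>x. x - a) has_real_derivative 1) (at x)" by (auto intro!: derivative_eq_intros)
      from DERIV_chain2[OF deriv this] show "((\<lambda>x. \<alpha> (x - a)) has_real_derivative \<alpha>' (x - a)) (at x)" by simp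
    qed
    have "((\<lambda>z. exp (- (\<i> * (z * \<xi>)))) has_field_derivative (exp (- (\<i> * (of_real x * \<xi>))) * (- (\<i> * \<xi>)))) (at (of_real x))"
      by (auto intro!: derivative_eq_intros)
    from has_vector_derivative_real_field[OF this]
    have B: "((\<lambda>x. cis (- (x * \<xi>))) has_vector_derivative (cis (- (x * \<xi>)) * (- (\<i> * \<xi>)))) (at x within {c..s})"
      unfolding cis_conv_exp by simp
    show "((\<lambda>x. \<alpha> (x - a) *\<^sub>R cis (- (x * \<xi>))) has_vector_derivative (\<alpha>' (x - a) *\<^sub>R cis (- (x * \<xi>)) - \<i> * \<xi> * (\<alpha> (x - a) *\<^sub>R cis (- (x * \<xi>))))) (at x within {c..s})"
      using has_vector_derivative_scaleR[OF A B] by (simp add: algebra_simps)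
  next
    show "continuous_on {c..s} (\<lambda>x. \<alpha>' (x - a) *\<^sub>R cis (- (x * \<xi>)) - \<i> * \<xi> * (\<alpha> (x - a) *\<^sub>R cis (- (x * \<xi>))))"
      by (intro continuous_intros cc e)
  qed
  also have "(LINT x|lborel. indicator {c..s} x *\<^sub>R (\<alpha>' (x - a) *\<^sub>R cis (- (x * \<xi>)) - \<i> * \<xi> * (\<alpha> (x - a) *\<^sub>R cis (- (x * \<xi>)))))
    = (LINT x|lborel. indicator {c..s} x *\<^sub>R (\<alpha>' (x - a) *\<^sub>R cis (- (x * \<xi>)))) - \<i> * \<xi> * (LINT x|lborel. indicator {c..s} x *\<^sub>R (\<alpha> (x - a) *\<^sub>R cis (- (x * \<xi>))))"
    unfolding integral_mult_right_zero[symmetric] Bochner_Integration.integral_diff[OF i1 i0, symmetric]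
    by (simp add: scaleR_diff_right)
  finally show ?thesis unfolding ind using c by (simp add: algebra_simps)
qed

text \<open>Once \<open>anti\<close> is written as an integral, the derivative falls on \<alpha>.
  The boundary term of \<open>cutoff_by_parts\<close> is, after integration against \<kappa> w,
  exactly the transform of the summand \<alpha> w of \<open>g1\<close>, and the two cancel.\<close>

lemma ft1_g1:
  assumes w: "lsq w"
  shows "(LINT x|lborel. g1 a w x *\<^sub>R cis (- (x * \<xi>))) = \<i> * \<xi> * (LINT x|lborel. g0 a w x *\<^sub>R cis (- (x * \<xi>)))"
proof -
  note [measurable] = lsq_measurable[OF w]
  have sp: "x < a - R \<or> a + 2 * R < x \<Longrightarrow> \<alpha> (x - a) = 0" "x < a - R \<or> a + 2 * R < x \<Longrightarrow> \<alpha>' (x - a) = 0" for x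
    using supp[of "x - a"] by auto
  note k0 = anti_kernel[OF w _ _ sp(1), where \<xi>=\<xi>, OF _ bounds(1)]
  note k1 = anti_kernel[OF w _ _ sp(2), where \<xi>=\<xi>, OF _ bounds(2)]
  have aw: "integrable lborel (\<lambda>s. (\<alpha> (s - a) * w s) *\<^sub>R cis (- (s * \<xi>)))"
  proof (rule Bochner_Integration.integrable_bound)
    show "integrable lborel (\<lambda>s. M * (indicator {a - R..a + 2 * R} s * w s))" using lsq_integrable[OF w] by simp
    have "norm ((\<alpha> (s - a) * w s) *\<^sub>R cis (- (s * \<xi>))) \<le> norm (M * (indicator {a - R..a + 2 * R} s * w s))" for s
      using sp(1)[of s] bounds(1)[of "s - a"] M by (cases "s \<in> {a - R..a + 2 * R}") (auto simp: abs_mult mult_right_mono)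
    then show "AE s in lborel. norm ((\<alpha> (s - a) * w s) *\<^sub>R cis (- (s * \<xi>))) \<le> norm (M * (indicator {a - R..a + 2 * R} s * w s))" by simp
  qed measurable
  have "(LINT x|lborel. g1 a w x *\<^sub>R cis (- (x * \<xi>))) = (LINT x|lborel. (\<alpha>' (x - a) * anti a w x) *\<^sub>R cis (- (x * \<xi>)) + (\<alpha> (x - a) * w x) *\<^sub>R cis (- (x * \<xi>)))"
    by (simp only: g1_def scaleR_add_left)
  also have "\<dots> = (LINT x|lborel. (\<alpha>' (x - a) * anti a w x) *\<^sub>R cis (- (x * \<xi>))) + (LINT x|lborel. (\<alpha> (x - a) * w x) *\<^sub>R cis (- (x * \<xi>)))"
    by (intro Bochner_Integration.integral_add k1(3) aw) measurable
  also have "\<dots> = - ((LINT s|lborel. (\<kappa> (s - a) * w s) *\<^sub>R (LINT x|lborel. indicator {..s} x *\<^sub>R (\<alpha>' (x - a) *\<^sub>R cis (- (x * \<xi>))))) - (LINT x|lborel. (\<alpha> (x - a) * w x) *\<^sub>R cis (- (x * \<xi>))))"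
    by (subst k1(1)) simp_all
  also have "\<dots> = - (LINT s|lborel. (\<kappa> (s - a) * w s) *\<^sub>R (LINT x|lborel. indicator {..s} x *\<^sub>R (\<alpha>' (x - a) *\<^sub>R cis (- (x * \<xi>)))) - (\<alpha> (s - a) * w s) *\<^sub>R cis (- (s * \<xi>)))"
    by (subst Bochner_Integration.integral_diff[OF k1(2) aw]) simp_all
  also have "(LINT s|lborel. (\<kappa> (s - a) * w s) *\<^sub>R (LINT x|lborel. indicator {..s} x *\<^sub>R (\<alpha>' (x - a) *\<^sub>R cis (- (x * \<xi>)))) - (\<alpha> (s - a) * w s) *\<^sub>R cis (- (s * \<xi>)))
    = (LINT s|lborel. \<i> * \<xi> * ((\<kappa> (s - a) * w s) *\<^sub>R (LINT x|lborel. indicator {..s} x *\<^sub>R (\<alpha> (x - a) *\<^sub>R cis (- (x * \<xi>))))))"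
  proof (intro Bochner_Integration.integral_cong refl)
    fix s :: real
    \<comment> \<open>The weight \<kappa> equals 1 on the support of \<alpha>, since 2R <
      3R.\<close>
    have "\<alpha> (s - a) * w s = \<kappa> (s - a) * w s * \<alpha> (s - a)"
      using \<kappa>_one[of "s - a"] sp(1)[of s] R by (cases "s \<le> a + 2 * R") auto
    then have "(\<alpha> (s - a) * w s) *\<^sub>R cis (- (s * \<xi>)) = (\<kappa> (s - a) * w s) *\<^sub>R (\<alpha> (s - a) *\<^sub>R cis (- (s * \<xi>)))"
      unfolding scaleR_scaleR by (rule arg_cong[where f="\<lambda>c. c *\<^sub>R cis (- (s * \<xi>))"])
    then show "(\<kappa> (s - a) * w s) *\<^sub>R (LINT x|lborel. indicator {..s} x *\<^sub>R (\<alpha>' (x - a) *\<^sub>R cis (- (x * \<xi>)))) - (\<alpha> (s - a) * w s) *\<^sub>R cis (- (s * \<xi>))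
      = \<i> * \<xi> * ((\<kappa> (s - a) * w s) *\<^sub>R (LINT x|lborel. indicator {..s} x *\<^sub>R (\<alpha> (x - a) *\<^sub>R cis (- (x * \<xi>)))))"
      by (simp only: cutoff_by_parts scaleR_add_right add_diff_cancel_left' mult_scaleR_right)
  qed
  also have "\<dots> = \<i> * \<xi> * (LINT s|lborel. (\<kappa> (s - a) * w s) *\<^sub>R (LINT x|lborel. indicator {..s} x *\<^sub>R (\<alpha> (x - a) *\<^sub>R cis (- (x * \<xi>)))))"
    by (rule integral_mult_right_zero)
  also have "- (\<i> * \<xi> * (LINT s|lborel. (\<kappa> (s - a) * w s) *\<^sub>R (LINT x|lborel. indicator {..s} x *\<^sub>R (\<alpha> (x - a) *\<^sub>R cis (- (x * \<xi>)))))) = \<i> * \<xi> * (LINT x|lborel. (\<alpha> (x - a) * anti a w x) *\<^sub>R cis (- (x * \<xi>)))"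
    by (subst k0(1)) simp_all
  finally show ?thesis by (simp only: g0_def)
qed

end

section \<open>The localised extension\<close>

lemma plane_iterated:
  fixes F :: "pt \<Rightarrow> ennreal"
  assumes [measurable]: "F \<in> borel_measurable borel"
  shows "(\<integral>\<^sup>+p. F p \<partial>lborel) = (\<integral>\<^sup>+y. (\<integral>\<^sup>+x. F (x, y) \<partial>lborel) \<partial>lborel)"
proof -
  have "F \<in> borel_measurable (lborel \<Otimes>\<^sub>M lborel)" unfolding lborel_prod by simp
  from pair_sigma_finite.nn_integral_snd[OF lborel_psf this] show ?thesis by (simp add: lborel_prod)
qed

lemma ft_iterated:
  assumes "integrable lborel f"
  shows "ft f \<xi> = (LINT y|lborel. cis (- (y * snd \<xi>)) * (LINT x|lborel. f (x, y) *\<^sub>R cis (- (x * fst \<xi>))))"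
proof -
  have "integrable (lborel \<Otimes>\<^sub>M lborel) (\<lambda>p. f p *\<^sub>R cis (- (p \<bullet> \<xi>)))"
    unfolding lborel_prod by (rule integrable_ft[OF assms])
  then have i: "integrable (lborel \<Otimes>\<^sub>M lborel) (\<lambda>(x, y). f (x, y) *\<^sub>R cis (- ((x, y) \<bullet> \<xi>)))"
    by (simp add: case_prod_beta')
  have "ft f \<xi> = integral\<^sup>L (lborel \<Otimes>\<^sub>M lborel) (\<lambda>(x, y). f (x, y) *\<^sub>R cis (- ((x, y) \<bullet> \<xi>)))"
    unfolding ft_def lborel_prod by (simp add: case_prod_beta')
  also have "\<dots> = (LINT y|lborel. (LINT x|lborel. f (x, y) *\<^sub>R cis (- ((x, y) \<bullet> \<xi>))))"
    by (rule pair_sigma_finite.integral_snd[OF lborel_psf i, symmetric])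
  also have "\<dots> = (LINT y|lborel. cis (- (y * snd \<xi>)) * (LINT x|lborel. f (x, y) *\<^sub>R cis (- (x * fst \<xi>))))"
    unfolding integral_mult_right_zero[symmetric]
    by (intro Bochner_Integration.integral_cong refl) (simp add: inner_prod_def cis_mult add_ac mult_ac)
  finally show ?thesis .
qed

text \<open>The lower Gagliardo bound expresses |\<xi>| by horizontal differences, and Plancherel is
  applied for each step k separately. The resulting plane integral splits into sections because the
  differences are purely horizontal.\<close>

lemma gagliardo_ft_le:
  assumes f: "L12 f"
  shows "(\<integral>\<^sup>+\<xi>. ennreal ((cmod (ft f \<xi>))\<^sup>2 * \<bar>fst \<xi>\<bar>) \<partial>lborel) \<le> 4 * (ennreal ((2 * pi)\<^sup>2) * (\<integral>\<^sup>+y. gagl (\<lambda>x. f (x, y)) \<partial>lborel))"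
proof -
  note [measurable] = L12_measurable[OF f]
  let ?F = "\<lambda>\<xi>. ennreal ((cmod (ft f \<xi>))\<^sup>2)"
  have "(\<integral>\<^sup>+\<xi>. ennreal ((cmod (ft f \<xi>))\<^sup>2 * \<bar>fst \<xi>\<bar>) \<partial>lborel) \<le> (\<integral>\<^sup>+\<xi>. ?F \<xi> * (4 * (\<integral>\<^sup>+k. indicator {0<..} k * ennreal ((cmod (cis (k * fst \<xi>) - 1))\<^sup>2 / k\<^sup>2) \<partial>lborel)) \<partial>lborel)"
    by (intro nn_integral_mono) (simp add: ennreal_mult mult_left_mono[OF gagliardo_lower])
  also have "\<dots> = (\<integral>\<^sup>+\<xi>. (\<integral>\<^sup>+k. 4 * ?F \<xi> * (indicator {0<..} k * ennreal ((cmod (cis (k * fst \<xi>) - 1))\<^sup>2 / k\<^sup>2)) \<partial>lborel) \<partial>lborel)"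
    by (intro nn_integral_cong, subst nn_integral_cmult) (auto simp: mult_ac)
  also have "\<dots> = (\<integral>\<^sup>+k. (\<integral>\<^sup>+\<xi>. 4 * ?F \<xi> * (indicator {0<..} k * ennreal ((cmod (cis (k * fst \<xi>) - 1))\<^sup>2 / k\<^sup>2)) \<partial>lborel) \<partial>lborel)"
    by (rule pair_sigma_finite.Fubini'[OF lborel_psf]) measurable
  also have "\<dots> \<le> (\<integral>\<^sup>+k. 4 * ennreal ((2 * pi)\<^sup>2) * (indicator {0<..} k * (ennreal (1 / k\<^sup>2) * (sq_norm (shiftx k f)))) \<partial>lborel)"
  proof (intro nn_integral_mono)
    fix k :: real
    have "(\<integral>\<^sup>+\<xi>. 4 * ?F \<xi> * (indicator {0<..} k * ennreal ((cmod (cis (k * fst \<xi>) - 1))\<^sup>2 / k\<^sup>2)) \<partial>lborel)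
      = (\<integral>\<^sup>+\<xi>. (4 * (indicator {0<..} k * ennreal (1 / k\<^sup>2))) * ennreal ((cmod (ft (shiftx k f) \<xi>))\<^sup>2) \<partial>lborel)"
    proof (intro nn_integral_cong)
      fix \<xi> :: pt
      have "ennreal ((cmod (cis (k * fst \<xi>) - 1))\<^sup>2 / k\<^sup>2) = ennreal (1 / k\<^sup>2) * ennreal ((cmod (cis (k * fst \<xi>) - 1))\<^sup>2)"
        by (subst ennreal_mult[symmetric]) auto
      moreover have "ennreal ((cmod (ft (shiftx k f) \<xi>))\<^sup>2) = ennreal ((cmod (cis (k * fst \<xi>) - 1))\<^sup>2) * ?F \<xi>"
        using f by (simp add: ft_shiftx L12_def norm_mult power_mult_distrib ennreal_mult)
      ultimately show "4 * ?F \<xi> * (indicator {0<..} k * ennreal ((cmod (cis (k * fst \<xi>) - 1))\<^sup>2 / k\<^sup>2)) = (4 * (indicator {0<..} k * ennreal (1 / k\<^sup>2))) * ennreal ((cmod (ft (shiftx k f) \<xi>))\<^sup>2)"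
        by (simp only: mult_ac)
    qed
    also have "\<dots> = (4 * (indicator {0<..} k * ennreal (1 / k\<^sup>2))) * (sq_norm (\<lambda>\<xi>. cmod (ft (shiftx k f) \<xi>)))"
      by (rule nn_integral_cmult) measurable
    also have "\<dots> \<le> (4 * (indicator {0<..} k * ennreal (1 / k\<^sup>2))) * (ennreal ((2 * pi)\<^sup>2) * (sq_norm (shiftx k f)))"
      using L12_shiftx[OF f, of k] by (intro mult_left_mono plancherel_le) (auto simp: L12_def)
    finally show "(\<integral>\<^sup>+\<xi>. 4 * ?F \<xi> * (indicator {0<..} k * ennreal ((cmod (cis (k * fst \<xi>) - 1))\<^sup>2 / k\<^sup>2)) \<partial>lborel) \<le> 4 * ennreal ((2 * pi)\<^sup>2) * (indicator {0<..} k * (ennreal (1 / k\<^sup>2) * (sq_norm (shiftx k f))))"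
      by (simp only: mult_ac)
  qed
  also have "\<dots> = 4 * ennreal ((2 * pi)\<^sup>2) * (\<integral>\<^sup>+k. indicator {0<..} k * (ennreal (1 / k\<^sup>2) * (sq_norm (shiftx k f))) \<partial>lborel)"
    unfolding shiftx_def by (rule nn_integral_cmult) measurable
  also have "(\<integral>\<^sup>+k. indicator {0<..} k * (ennreal (1 / k\<^sup>2) * (sq_norm (shiftx k f))) \<partial>lborel)
    = (\<integral>\<^sup>+k. (\<integral>\<^sup>+y. indicator {0<..} k * (ennreal (1 / k\<^sup>2) * (sq_norm (\<lambda>x. f (x + k, y) - f (x, y)))) \<partial>lborel) \<partial>lborel)"
  proof (intro nn_integral_cong)
    fix k :: real
    have "(sq_norm (shiftx k f)) = (\<integral>\<^sup>+y. (sq_norm (\<lambda>x. f (x + k, y) - f (x, y))) \<partial>lborel)"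
      by (subst plane_iterated) (simp_all add: shiftx_def)
    then show "indicator {0<..} k * (ennreal (1 / k\<^sup>2) * (sq_norm (shiftx k f))) = (\<integral>\<^sup>+y. indicator {0<..} k * (ennreal (1 / k\<^sup>2) * (sq_norm (\<lambda>x. f (x + k, y) - f (x, y)))) \<partial>lborel)"
      by (simp add: nn_integral_cmult)
  qed
  also have "\<dots> = (\<integral>\<^sup>+y. gagl (\<lambda>x. f (x, y)) \<partial>lborel)"
    unfolding gagl_def by (rule pair_sigma_finite.Fubini'[OF lborel_psf, symmetric]) measurable
  finally show ?thesis by (simp only: mult.assoc)
qed

text \<open>Every section, not almost every one, is required to be square integrable: the section
  estimates then hold for all y, also at the shifted ordinate y + h, with no exceptional sets to
  track.\<close>

definition nice :: "(pt \<Rightarrow> real) \<Rightarrow> bool" where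
  "nice f \<longleftrightarrow> f \<in> borel_measurable borel \<and> (\<forall>y. lsq (\<lambda>x. f (x, y))) \<and> (sq_norm f) < \<infinity>"

lemma nice_measurable: "nice f \<Longrightarrow> f \<in> borel_measurable borel" by (simp add: nice_def)
lemma nice_lsq: "nice f \<Longrightarrow> lsq (\<lambda>x. f (x, y))" by (simp add: nice_def)

lemma lsq_diff: assumes v: "lsq v" and w: "lsq w" shows "lsq (\<lambda>x. v x - w x)"
proof -
  note [measurable] = lsq_measurable[OF v] lsq_measurable[OF w]
  have "(sq_norm (\<lambda>s. v s - w s)) \<le> 2 * (sq_norm v) + 2 * (sq_norm w)"
    by (rule nn_integral_power2_sum_le) auto
  also have "\<dots> < \<infinity>" using v w by (auto simp: lsq_def ennreal_mult_less_top)
  finally show ?thesis unfolding lsq_def by auto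
qed

lemma nice_lsq_shifty: "nice f \<Longrightarrow> lsq (\<lambda>x. shifty h f (x, y))"
  using lsq_diff[OF nice_lsq nice_lsq, of f f "y + h" y] by (simp add: shifty_def)

context cutoff
begin

section \<open>The extension and its potential\<close>

definition psi :: "real \<Rightarrow> real \<Rightarrow> (pt \<Rightarrow> real) \<Rightarrow> pt \<Rightarrow> real" where
  "psi a b f p = \<alpha> (snd p - b) * g0 a (\<lambda>s. f (s, snd p)) (fst p)"

definition ext :: "real \<Rightarrow> real \<Rightarrow> (pt \<Rightarrow> real) \<Rightarrow> pt \<Rightarrow> real" where
  "ext a b f p = \<alpha> (snd p - b) * g1 a (\<lambda>s. f (s, snd p)) (fst p)"

text \<open>The margins in x are those of the section estimates. In y they have to hold the support
  of the cutoff after a shift by at most R; taking the same margins makes the set a square.\<close>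

definition Qb :: "real \<Rightarrow> real \<Rightarrow> pt set" where
  "Qb a b = cbox (a - 2 * R, b - 2 * R) (a + 9 * R, b + 9 * R)"

lemma indicator_Qb: "indicator (Qb a b) (x, y) = (indicator {a - 2 * R..a + 9 * R} x * indicator {b - 2 * R..b + 9 * R} y :: ennreal)"
  by (auto simp: Qb_def cbox_Pair_eq indicator_def)

lemma Qb_measurable [measurable]: "Qb a b \<in> sets borel" by (simp add: Qb_def)

lemma anti2_measurable [measurable]:
  assumes [measurable]: "f \<in> borel_measurable borel"
  shows "(\<lambda>p::pt. anti a (\<lambda>s. f (s, snd p)) (fst p)) \<in> borel_measurable borel"
proof -
  have [measurable]: "Measurable.pred (borel \<Otimes>\<^sub>M borel) (\<lambda>x::pt \<times> real. fst (fst x) \<le> snd x)" by measurable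
  show ?thesis unfolding anti_def[abs_def] indicator_def atLeast_iff by measurable
qed

lemma psi_measurable [measurable]:
  assumes [measurable]: "f \<in> borel_measurable borel" shows "psi a b f \<in> borel_measurable borel"
  unfolding psi_def[abs_def] g0_def by measurable

lemma ext_measurable [measurable]:
  assumes [measurable]: "f \<in> borel_measurable borel" shows "ext a b f \<in> borel_measurable borel"
proof -
  have "(\<lambda>p::pt. f (fst p, snd p)) \<in> borel_measurable borel" by measurable
  then show ?thesis unfolding ext_def[abs_def] g1_def by measurable
qed

lemma ext_eq:
  assumes "p \<in> box (a, b) (a + R, b + R)" shows "ext a b f p = f p"
proof -
  have "0 < fst p - a" "fst p - a < R" "0 < snd p - b" "snd p - b < R"
    using assms by (auto simp: box_def Basis_prod_def inner_prod_def)
  then show ?thesis using one[of "fst p - a"] one[of "snd p - b"] by (simp add: ext_def g1_def)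
qed

lemma psi_ext_zero:
  assumes "p \<notin> cbox (a - R, b - R) (a + 2 * R, b + 2 * R)"
  shows "psi a b f p = 0" "ext a b f p = 0"
proof -
  have "fst p - a < - R \<or> 2 * R < fst p - a \<or> snd p - b < - R \<or> 2 * R < snd p - b"
    using assms by (cases p) (auto simp: cbox_Pair_eq not_le)
  then show "psi a b f p = 0" "ext a b f p = 0"
    using supp[of "fst p - a"] supp[of "snd p - b"] by (auto simp: psi_def ext_def g0_def g1_def)
qed

lemma alpha_square_le: "ennreal ((\<alpha> (y - b))\<^sup>2) \<le> ennreal (M\<^sup>2) * indicator {b - 2 * R..b + 9 * R} y"
proof (cases "y \<in> {b - 2 * R..b + 9 * R}")
  case True then show ?thesis using square_le_M[of _ 1] bounds by (simp add: ennreal_leI)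
next
  case False then show ?thesis using supp[of "y - b"] R by auto
qed

lemma integral_sqI:
  fixes f :: "pt \<Rightarrow> real"
  assumes [measurable]: "f \<in> borel_measurable borel"
  shows "(\<integral>\<^sup>+y. indicator {b - 2 * R..b + 9 * R} y * sqI a (\<lambda>x. f (x, y)) \<partial>lborel) = (sq_norm_on (Qb a b) f)"
proof -
  have "(sq_norm_on (Qb a b) f) = (\<integral>\<^sup>+y. (\<integral>\<^sup>+x. indicator {b - 2 * R..b + 9 * R} y * (indicator {a - 2 * R..a + 9 * R} x * ennreal ((f (x, y))\<^sup>2)) \<partial>lborel) \<partial>lborel)"
    by (subst plane_iterated, measurable) (simp only: indicator_Qb mult_ac)
  also have "\<dots> = (\<integral>\<^sup>+y. indicator {b - 2 * R..b + 9 * R} y * sqI a (\<lambda>x. f (x, y)) \<partial>lborel)"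
    unfolding sqI_def by (intro nn_integral_cong nn_integral_cmult) measurable
  finally show ?thesis ..
qed

lemma sqI_measurable2 [measurable]:
  fixes f :: "pt \<Rightarrow> real"
  assumes [measurable]: "f \<in> borel_measurable borel"
  shows "(\<lambda>y. sqI a (\<lambda>x. f (x, y))) \<in> borel_measurable borel"
  unfolding sqI_def by measurable

lemma integral_section_le:
  assumes [measurable]: "f \<in> borel_measurable borel" and C: "\<And>y. sqint (G y) \<le> C * sqI a (\<lambda>x. f (x, y))"
    and [measurable]: "(\<lambda>p::pt. G (snd p) (fst p)) \<in> borel_measurable borel"
  shows "(sq_norm (\<lambda>p. \<alpha> (snd p - b) * G (snd p) (fst p))) \<le> ennreal (M\<^sup>2) * C * (sq_norm_on (Qb a b) f)"
proof -
  have Gy [measurable]: "(\<lambda>x. G y x) \<in> borel_measurable borel" for y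
    using measurable_compose[OF _ assms(3), of "\<lambda>x. (x, y)" borel] by simp
  have "(sq_norm (\<lambda>p. \<alpha> (snd p - b) * G (snd p) (fst p))) = (\<integral>\<^sup>+y. ennreal ((\<alpha> (y - b))\<^sup>2) * sqint (G y) \<partial>lborel)"
    unfolding sqint_def by (subst plane_iterated) (auto simp: power_mult_distrib ennreal_mult nn_integral_cmult intro!: nn_integral_cong)
  also have "\<dots> \<le> (\<integral>\<^sup>+y. (ennreal (M\<^sup>2) * indicator {b - 2 * R..b + 9 * R} y) * (C * sqI a (\<lambda>x. f (x, y))) \<partial>lborel)"
    by (intro nn_integral_mono mult_mono alpha_square_le C) auto
  also have "\<dots> = (\<integral>\<^sup>+y. ennreal (M\<^sup>2) * C * (indicator {b - 2 * R..b + 9 * R} y * sqI a (\<lambda>x. f (x, y))) \<partial>lborel)"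
    by (intro nn_integral_cong) (simp only: mult_ac)
  also have "\<dots> = ennreal (M\<^sup>2) * C * (sq_norm_on (Qb a b) f)"
    unfolding integral_sqI[OF assms(1), symmetric] by (rule nn_integral_cmult) measurable
  finally show ?thesis .
qed

definition V1_const :: ennreal where "V1_const = ennreal (36 * R\<^sup>2) * ennreal (6 * R)"

lemma V1_sqI: "lsq w \<Longrightarrow> V1 a w \<le> V1_const * sqI a w"
  unfolding V1_const_def mult.assoc by (rule order_trans[OF V1_le], assumption, rule mult_left_mono[OF V2_le]) simp_all

lemma ext_sqint_le:
  assumes f: "nice f"
  shows "(sq_norm (ext a b f)) \<le> ennreal (M\<^sup>2) * K * (sq_norm_on (Qb a b) f)"
proof -
  note [measurable] = nice_measurable[OF f]
  have "(\<lambda>p::pt. f (fst p, snd p)) \<in> borel_measurable borel" by measurable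
  then have [measurable]: "(\<lambda>p::pt. g1 a (\<lambda>s. f (s, snd p)) (fst p)) \<in> borel_measurable borel" unfolding g1_def by measurable
  show ?thesis unfolding ext_def
    by (intro integral_section_le[where G="\<lambda>y. g1 a (\<lambda>s. f (s, y))"] section_bounds(1) nice_lsq f) measurable
qed

lemma psi_sqint_le:
  assumes f: "nice f"
  shows "(sq_norm (psi a b f)) \<le> ennreal (M\<^sup>2) * (K * V1_const) * (sq_norm_on (Qb a b) f)"
proof -
  note [measurable] = nice_measurable[OF f]
  have [measurable]: "(\<lambda>p::pt. g0 a (\<lambda>s. f (s, snd p)) (fst p)) \<in> borel_measurable borel" unfolding g0_def by measurable
  have "sqint (g0 a (\<lambda>s. f (s, y))) \<le> K * V1_const * sqI a (\<lambda>s. f (s, y))" for y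
    unfolding mult.assoc by (rule order_trans[OF section_bounds(4)[OF nice_lsq[OF f]]], rule mult_left_mono[OF V1_sqI[OF nice_lsq[OF f]]]) simp
  then show ?thesis unfolding psi_def
    by (intro integral_section_le[where G="\<lambda>y. g0 a (\<lambda>s. f (s, y))"]) measurable
qed

lemma integral_Qb_finite:
  assumes "nice f" shows "(sq_norm_on (Qb a b) f) < \<infinity>"
proof -
  have "(sq_norm_on (Qb a b) f) \<le> (sq_norm f)"
    by (intro nn_integral_mono) (auto simp: indicator_def)
  then show ?thesis using assms by (auto simp: nice_def)
qed

lemma L12_psi_ext:
  assumes f: "nice f" shows "L12 (psi a b f)" "L12 (ext a b f)"
proof -
  note [measurable] = nice_measurable[OF f]
  let ?B = "cbox (a - R, b - R) (a + 2 * R, b + 2 * R)"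
  have V1_const: "V1_const < \<infinity>" by (simp add: V1_const_def ennreal_mult_less_top)
  show "L12 (psi a b f)"
  proof (rule L12_bounded_support[where B="?B"])
    show "(sq_norm (psi a b f)) < \<infinity>"
      by (rule le_less_trans[OF psi_sqint_le[OF f]]) (use K_finite V1_const integral_Qb_finite[OF f, of a b] in \<open>simp add: ennreal_mult_less_top\<close>)
  qed (auto simp: psi_ext_zero intro: bounded_cbox)
  show "L12 (ext a b f)"
  proof (rule L12_bounded_support[where B="?B"])
    show "(sq_norm (ext a b f)) < \<infinity>"
      by (rule le_less_trans[OF ext_sqint_le[OF f]]) (use K_finite integral_Qb_finite[OF f, of a b] in \<open>simp add: ennreal_mult_less_top\<close>)
  qed (auto simp: psi_ext_zero intro: bounded_cbox)
qed

lemma ft_ext: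
  assumes f: "nice f" shows "ft (ext a b f) \<xi> = \<i> * fst \<xi> * ft (psi a b f) \<xi>"
proof -
  have "integrable lborel (ext a b f)" "integrable lborel (psi a b f)" using L12_psi_ext[OF f] by (auto simp: L12_def)
  then have i: "ft (ext a b f) \<xi> = (LINT y|lborel. cis (- (y * snd \<xi>)) * (LINT x|lborel. ext a b f (x, y) *\<^sub>R cis (- (x * fst \<xi>))))"
    "ft (psi a b f) \<xi> = (LINT y|lborel. cis (- (y * snd \<xi>)) * (LINT x|lborel. psi a b f (x, y) *\<^sub>R cis (- (x * fst \<xi>))))"
    by (simp_all only: ft_iterated)
  have "(LINT x|lborel. ext a b f (x, y) *\<^sub>R cis (- (x * fst \<xi>))) = \<i> * fst \<xi> * (LINT x|lborel. psi a b f (x, y) *\<^sub>R cis (- (x * fst \<xi>)))" for y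
    unfolding ext_def psi_def fst_conv snd_conv scaleR_scaleR[symmetric] integral_scaleR_right ft1_g1[OF nice_lsq[OF f]] by simp
  then have "ft (ext a b f) \<xi> = (LINT y|lborel. \<i> * fst \<xi> * (cis (- (y * snd \<xi>)) * (LINT x|lborel. psi a b f (x, y) *\<^sub>R cis (- (x * fst \<xi>)))))"
    unfolding i by (intro Bochner_Integration.integral_cong refl) (simp only: mult_ac)
  also have "\<dots> = \<i> * fst \<xi> * ft (psi a b f) \<xi>" unfolding i by (rule integral_mult_right_zero)
  finally show ?thesis .
qed

section \<open>From section energies to energies on the enlarged square\<close>

definition primQ :: "(real \<Rightarrow> ennreal) \<Rightarrow> real \<Rightarrow> real \<Rightarrow> (pt \<Rightarrow> real) \<Rightarrow> ennreal" where
  "primQ \<omega> a b v = (\<integral>\<^sup>+k. indicator {0<..6 * R} k * (\<omega> k * (sq_norm_on (Qb a b) (primx k v))) \<partial>lborel)"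

definition shiftQ :: "real \<Rightarrow> real \<Rightarrow> (pt \<Rightarrow> real) \<Rightarrow> ennreal" where
  "shiftQ a b f = (\<integral>\<^sup>+k. indicator {0<..} k * (ennreal (1 / k\<^sup>2) * (sq_norm_on (Qb a b) (shiftx k f))) \<partial>lborel)"

lemma anti_diff_fun:
  assumes "lsq v" "lsq w" shows "anti a (\<lambda>x. v x - w x) x = anti a v x - anti a w x"
  unfolding anti_def by (simp add: right_diff_distrib Bochner_Integration.integral_diff integrable_anti assms)

lemma primJ_measurable2:
  fixes v :: "pt \<Rightarrow> real"
  assumes [measurable]: "v \<in> borel_measurable borel"
  shows "(\<lambda>(k, y). primJ a (\<lambda>x. v (x, y)) k) \<in> borel_measurable (borel \<Otimes>\<^sub>M borel)"
proof -
  note pm [measurable] = primx_measurable2[OF assms(1)]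
  have "(\<lambda>((k, y), x). primx k v (x, y)) \<in> borel_measurable ((borel \<Otimes>\<^sub>M borel) \<Otimes>\<^sub>M borel)"
    using measurable_compose[OF _ pm, of "\<lambda>((k, y), x). (k, (x, y))" "(borel \<Otimes>\<^sub>M borel) \<Otimes>\<^sub>M borel"] by (simp add: case_prod_beta')
  then have [measurable]: "(\<lambda>p. prim1 (fst (fst p)) (\<lambda>s. v (s, snd (fst p))) (snd p)) \<in> borel_measurable ((borel \<Otimes>\<^sub>M borel) \<Otimes>\<^sub>M borel)"
    by (simp add: primx_section case_prod_beta')
  show ?thesis unfolding primJ_def case_prod_beta' by measurable
qed

text \<open>The weight is a parameter because it is used twice: with 1/k^2 for the term with
  \<lambda> and with 1 for the term with \<mu>.\<close>

lemma primJ_weight_le: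
  fixes v :: "pt \<Rightarrow> real"
  assumes [measurable]: "v \<in> borel_measurable borel" "\<omega> \<in> borel_measurable borel"
  shows "(\<integral>\<^sup>+y. indicator {b - 2 * R..b + 9 * R} y * (\<integral>\<^sup>+k. indicator {0<..6 * R} k * (\<omega> k * primJ a (\<lambda>x. v (x, y)) k) \<partial>lborel) \<partial>lborel) \<le> primQ \<omega> a b v"
proof -
  note pm [measurable] = primx_measurable2[OF assms(1)]
  note [measurable] = primJ_measurable2[OF assms(1)]
  have "(\<integral>\<^sup>+y. indicator {b - 2 * R..b + 9 * R} y * (\<integral>\<^sup>+k. indicator {0<..6 * R} k * (\<omega> k * primJ a (\<lambda>x. v (x, y)) k) \<partial>lborel) \<partial>lborel)
    = (\<integral>\<^sup>+y. (\<integral>\<^sup>+k. indicator {b - 2 * R..b + 9 * R} y * (indicator {0<..6 * R} k * (\<omega> k * primJ a (\<lambda>x. v (x, y)) k)) \<partial>lborel) \<partial>lborel)"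
    by (intro nn_integral_cong nn_integral_cmult[symmetric]) measurable
  also have "\<dots> = (\<integral>\<^sup>+k. (\<integral>\<^sup>+y. indicator {b - 2 * R..b + 9 * R} y * (indicator {0<..6 * R} k * (\<omega> k * primJ a (\<lambda>x. v (x, y)) k)) \<partial>lborel) \<partial>lborel)"
    by (rule pair_sigma_finite.Fubini'[OF lborel_psf]) measurable
  also have "\<dots> \<le> primQ \<omega> a b v"
    unfolding primQ_def
  proof (intro nn_integral_mono)
    fix k :: real
    have "(\<integral>\<^sup>+y. indicator {b - 2 * R..b + 9 * R} y * (indicator {0<..6 * R} k * (\<omega> k * primJ a (\<lambda>x. v (x, y)) k)) \<partial>lborel)
      = (\<integral>\<^sup>+y. (indicator {0<..6 * R} k * \<omega> k) * (indicator {b - 2 * R..b + 9 * R} y * primJ a (\<lambda>x. v (x, y)) k) \<partial>lborel)"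
      by (intro nn_integral_cong) (simp only: mult_ac)
    also have "\<dots> = (indicator {0<..6 * R} k * \<omega> k) * (\<integral>\<^sup>+y. indicator {b - 2 * R..b + 9 * R} y * primJ a (\<lambda>x. v (x, y)) k \<partial>lborel)"
      by (rule nn_integral_cmult) measurable
    also have "(\<integral>\<^sup>+y. indicator {b - 2 * R..b + 9 * R} y * primJ a (\<lambda>x. v (x, y)) k \<partial>lborel) \<le> (sq_norm_on (Qb a b) (primx k v))"
    proof (subst plane_iterated, measurable, intro nn_integral_mono)
      fix y :: real
      show "indicator {b - 2 * R..b + 9 * R} y * primJ a (\<lambda>x. v (x, y)) k \<le> (\<integral>\<^sup>+x. indicator (Qb a b) (x, y) * ennreal ((primx k v (x, y))\<^sup>2) \<partial>lborel)"
      proof (cases "y \<in> {b - 2 * R..b + 9 * R}")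
        case True
        then show ?thesis unfolding primJ_def primx_section indicator_Qb using J_subset[of a]
          by (auto intro!: nn_integral_mono mult_right_mono simp: indicator_def)
      qed simp
    qed
    finally show "(\<integral>\<^sup>+y. indicator {b - 2 * R..b + 9 * R} y * (indicator {0<..6 * R} k * (\<omega> k * primJ a (\<lambda>x. v (x, y)) k)) \<partial>lborel) \<le> indicator {0<..6 * R} k * (\<omega> k * (sq_norm_on (Qb a b) (primx k v)))"
      by (simp add: mult_left_mono mult.assoc)
  qed
  finally show ?thesis .
qed

lemma ext_gagl_le:
  assumes f: "nice f"
  shows "(\<integral>\<^sup>+y. gagl (\<lambda>x. ext a b f (x, y)) \<partial>lborel) \<le> ennreal (M\<^sup>2) * K * ((sq_norm_on (Qb a b) f) + shiftQ a b f)"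
proof -
  note [measurable] = nice_measurable[OF f]
  let ?I = "{b - 2 * R..b + 9 * R}"
  have [measurable]: "(\<lambda>y. gaglI a (\<lambda>x. f (x, y))) \<in> borel_measurable borel"
    unfolding gaglI_def by measurable
  have "(\<integral>\<^sup>+y. gagl (\<lambda>x. ext a b f (x, y)) \<partial>lborel) \<le> (\<integral>\<^sup>+y. ennreal (M\<^sup>2) * K * (indicator ?I y * sqI a (\<lambda>x. f (x, y)) + indicator ?I y * gaglI a (\<lambda>x. f (x, y))) \<partial>lborel)"
  proof (intro nn_integral_mono)
    fix y :: real
    have "gagl (\<lambda>x. ext a b f (x, y)) = ennreal ((\<alpha> (y - b))\<^sup>2) * gagl (g1 a (\<lambda>x. f (x, y)))"
      unfolding ext_def fst_conv snd_conv by (rule gagl_cmult) measurable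
    also have "\<dots> \<le> (ennreal (M\<^sup>2) * indicator ?I y) * (K * (sqI a (\<lambda>x. f (x, y)) + gaglI a (\<lambda>x. f (x, y))))"
      by (intro mult_mono alpha_square_le section_bounds(2) nice_lsq f) auto
    also have "\<dots> = ennreal (M\<^sup>2) * K * (indicator ?I y * sqI a (\<lambda>x. f (x, y)) + indicator ?I y * gaglI a (\<lambda>x. f (x, y)))"
      by (simp only: distrib_left mult_ac)
    finally show "gagl (\<lambda>x. ext a b f (x, y)) \<le> \<dots>" .
  qed
  also have "\<dots> = ennreal (M\<^sup>2) * K * (\<integral>\<^sup>+y. indicator ?I y * sqI a (\<lambda>x. f (x, y)) + indicator ?I y * gaglI a (\<lambda>x. f (x, y)) \<partial>lborel)"
    by (rule nn_integral_cmult) measurable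
  also have "(\<integral>\<^sup>+y. indicator ?I y * sqI a (\<lambda>x. f (x, y)) + indicator ?I y * gaglI a (\<lambda>x. f (x, y)) \<partial>lborel) = (\<integral>\<^sup>+y. indicator ?I y * sqI a (\<lambda>x. f (x, y)) \<partial>lborel) + (\<integral>\<^sup>+y. indicator ?I y * gaglI a (\<lambda>x. f (x, y)) \<partial>lborel)"
    by (rule nn_integral_add) measurable
  also have "(\<integral>\<^sup>+y. indicator ?I y * gaglI a (\<lambda>x. f (x, y)) \<partial>lborel) =
     (\<integral>\<^sup>+y. (\<integral>\<^sup>+k. indicator ?I y * (indicator {0<..} k * (ennreal (1 / k\<^sup>2) * (\<integral>\<^sup>+x. indicator {a - 2 * R..a + 9 * R} x * ennreal ((f (x + k, y) - f (x, y))\<^sup>2) \<partial>lborel))) \<partial>lborel) \<partial>lborel)"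
    unfolding gaglI_def by (intro nn_integral_cong nn_integral_cmult[symmetric]) measurable
  also have "\<dots> = (\<integral>\<^sup>+k. (\<integral>\<^sup>+y. indicator ?I y * (indicator {0<..} k * (ennreal (1 / k\<^sup>2) * (\<integral>\<^sup>+x. indicator {a - 2 * R..a + 9 * R} x * ennreal ((f (x + k, y) - f (x, y))\<^sup>2) \<partial>lborel))) \<partial>lborel) \<partial>lborel)"
    by (rule pair_sigma_finite.Fubini'[OF lborel_psf]) measurable
  also have "\<dots> = shiftQ a b f"
    unfolding shiftQ_def
  proof (intro nn_integral_cong)
    fix k :: real
    have "(sq_norm_on (Qb a b) (shiftx k f)) = (\<integral>\<^sup>+y. (\<integral>\<^sup>+x. indicator ?I y * (indicator {a - 2 * R..a + 9 * R} x * ennreal ((f (x + k, y) - f (x, y))\<^sup>2)) \<partial>lborel) \<partial>lborel)"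
      by (subst plane_iterated, measurable) (simp add: indicator_Qb shiftx_def mult_ac)
    also have "\<dots> = (\<integral>\<^sup>+y. indicator ?I y * (\<integral>\<^sup>+x. indicator {a - 2 * R..a + 9 * R} x * ennreal ((f (x + k, y) - f (x, y))\<^sup>2) \<partial>lborel) \<partial>lborel)"
      by (intro nn_integral_cong nn_integral_cmult) measurable
    finally have e: "(sq_norm_on (Qb a b) (shiftx k f)) = \<dots>" .
    have "(\<integral>\<^sup>+y. indicator ?I y * (indicator {0<..} k * (ennreal (1 / k\<^sup>2) * (\<integral>\<^sup>+x. indicator {a - 2 * R..a + 9 * R} x * ennreal ((f (x + k, y) - f (x, y))\<^sup>2) \<partial>lborel))) \<partial>lborel)
      = (\<integral>\<^sup>+y. (indicator {0<..} k * ennreal (1 / k\<^sup>2)) * (indicator ?I y * (\<integral>\<^sup>+x. indicator {a - 2 * R..a + 9 * R} x * ennreal ((f (x + k, y) - f (x, y))\<^sup>2) \<partial>lborel)) \<partial>lborel)"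
      by (intro nn_integral_cong) (simp only: mult_ac)
    also have "\<dots> = (indicator {0<..} k * ennreal (1 / k\<^sup>2)) * (\<integral>\<^sup>+y. indicator ?I y * (\<integral>\<^sup>+x. indicator {a - 2 * R..a + 9 * R} x * ennreal ((f (x + k, y) - f (x, y))\<^sup>2) \<partial>lborel) \<partial>lborel)"
      by (rule nn_integral_cmult) measurable
    finally show "(\<integral>\<^sup>+y. indicator ?I y * (indicator {0<..} k * (ennreal (1 / k\<^sup>2) * (\<integral>\<^sup>+x. indicator {a - 2 * R..a + 9 * R} x * ennreal ((f (x + k, y) - f (x, y))\<^sup>2) \<partial>lborel))) \<partial>lborel)
      = indicator {0<..} k * (ennreal (1 / k\<^sup>2) * (sq_norm_on (Qb a b) (shiftx k f)))"
      unfolding e by (simp only: mult.assoc)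
  qed
  finally show ?thesis unfolding integral_sqI[OF nice_measurable[OF f]] .
qed

text \<open>The argument runs once for the pairs \<Phi> = \<open>gagl\<close>, V = \<open>V2\<close>
  and \<Phi> = \<open>sqint\<close>, V = \<open>V1\<close>. A vertical difference of \<psi> falls
  either on the cutoff, which gains h by the Lipschitz bound and leaves u itself, or on u, which
  leaves primitives of \<open>shifty h f\<close>. The first part is of order h^2 by itself; the
  second becomes so after summation, through \<open>gagliardo_primx\<close> or
  \<open>primx_local\<close>.\<close>

lemma psi_shifty_le:
  assumes f: "nice f" and h: "0 < h" "h \<le> R" and [measurable]: "\<omega> \<in> borel_measurable borel"
    and \<Phi>: "\<And>c d G H. G \<in> borel_measurable borel \<Longrightarrow> H \<in> borel_measurable borel \<Longrightarrow>
        \<Phi> (\<lambda>x. c * G x + d * H x) \<le> 2 * (ennreal (c\<^sup>2) * \<Phi> G) + 2 * (ennreal (d\<^sup>2) * \<Phi> H)"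
    and V: "\<And>w. V w = (\<integral>\<^sup>+k. indicator {0<..6 * R} k * (\<omega> k * primJ a w k) \<partial>lborel)"
    and \<Phi>V: "\<And>w. lsq w \<Longrightarrow> \<Phi> (g0 a w) \<le> K * V w"
    and VL: "\<And>w. lsq w \<Longrightarrow> V w \<le> L * sqI a w"
  shows "(\<integral>\<^sup>+y. \<Phi> (\<lambda>x. shifty h (psi a b f) (x, y)) \<partial>lborel) \<le>
     2 * (ennreal (M\<^sup>2) * K) * (ennreal (h\<^sup>2) * (L * (sq_norm_on (Qb a b) f)) + primQ \<omega> a b (shifty h f))"
proof -
  note [measurable] = nice_measurable[OF f]
  have pj: "(\<lambda>(k, y). primJ a (\<lambda>x. shifty h f (x, y)) k) \<in> borel_measurable (borel \<Otimes>\<^sub>M borel)"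
    by (rule primJ_measurable2) measurable
  have [measurable]: "(\<lambda>(y, k). primJ a (\<lambda>x. shifty h f (x, y)) k) \<in> borel_measurable (borel \<Otimes>\<^sub>M borel)"
    using measurable_compose[OF measurable_pair_swap' pj] by (simp add: case_prod_beta')
  let ?I = "{b - 2 * R..b + 9 * R}"
  let ?v = "\<lambda>y x. shifty h f (x, y)"
  let ?W = "\<lambda>y. indicator ?I y * (\<integral>\<^sup>+k. indicator {0<..6 * R} k * (\<omega> k * primJ a (?v y) k) \<partial>lborel)"
  have "(\<integral>\<^sup>+y. \<Phi> (\<lambda>x. shifty h (psi a b f) (x, y)) \<partial>lborel) \<le> (\<integral>\<^sup>+y. 2 * (ennreal (M\<^sup>2) * K) * (ennreal (h\<^sup>2) * (L * (indicator ?I (y + h) * sqI a (\<lambda>x. f (x, y + h)))) + ?W y) \<partial>lborel)"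
  proof (intro nn_integral_mono)
    fix y :: real
    let ?c = "\<alpha> (y + h - b) - \<alpha> (y - b)" and ?d = "\<alpha> (y - b)"
    note l = nice_lsq[OF f, of "y + h"] nice_lsq[OF f, of y] nice_lsq_shifty[OF f, of h y]
    \<comment> \<open>The discrete product rule in y, combined with linearity of
      \<open>anti\<close>.\<close>
    have "(\<lambda>x. shifty h (psi a b f) (x, y)) = (\<lambda>x. ?c * g0 a (\<lambda>x. f (x, y + h)) x + ?d * g0 a (?v y) x)"
    proof (rule HOL.ext)
      fix x
      have av: "anti a (?v y) x = anti a (\<lambda>x. f (x, y + h)) x - anti a (\<lambda>x. f (x, y)) x"
        using anti_diff_fun[OF l(1,2), of a x] by (simp add: shifty_def)
      show "shifty h (psi a b f) (x, y) = ?c * g0 a (\<lambda>x. f (x, y + h)) x + ?d * g0 a (?v y) x"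
        unfolding g0_def av by (simp add: shifty_def psi_def g0_def algebra_simps)
    qed
    then have "\<Phi> (\<lambda>x. shifty h (psi a b f) (x, y)) \<le> 2 * (ennreal (?c\<^sup>2) * \<Phi> (g0 a (\<lambda>x. f (x, y + h)))) + 2 * (ennreal (?d\<^sup>2) * \<Phi> (g0 a (?v y)))"
      by (simp only:) (rule \<Phi>, measurable)
    also have "\<dots> \<le> 2 * ((ennreal (M\<^sup>2) * ennreal (h\<^sup>2) * indicator ?I (y + h)) * (K * (L * sqI a (\<lambda>x. f (x, y + h))))) + 2 * ((ennreal (M\<^sup>2) * indicator ?I y) * (K * V (?v y)))"
    proof (intro add_mono mult_left_mono mult_mono)
      show "ennreal (?c\<^sup>2) \<le> ennreal (M\<^sup>2) * ennreal (h\<^sup>2) * indicator ?I (y + h)"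
      proof (cases "y + h \<in> ?I")
        case True
        have "?c\<^sup>2 \<le> M\<^sup>2 * h\<^sup>2" using lip(1)[of "y + h - b" "y - b"] h by (intro square_le_M) simp
        then show ?thesis using True by (simp add: ennreal_leI flip: ennreal_mult)
      next
        \<comment> \<open>If y + h leaves the interval, then by 0 < h \<le> R both y + h and y are
          outside the support [b - R, b + 2R] of the cutoff.\<close>
        case False
        then have "\<alpha> (y + h - b) = 0" "\<alpha> (y - b) = 0" using supp[of "y + h - b"] supp[of "y - b"] h R by auto
        then show ?thesis by simp
      qed
      show "\<Phi> (g0 a (\<lambda>x. f (x, y + h))) \<le> K * (L * sqI a (\<lambda>x. f (x, y + h)))"
        by (rule order_trans[OF \<Phi>V[OF l(1)]], rule mult_left_mono[OF VL[OF l(1)]]) simp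
    qed (auto intro: alpha_square_le \<Phi>V l)
    also have "\<dots> = 2 * (ennreal (M\<^sup>2) * K) * (ennreal (h\<^sup>2) * (L * (indicator ?I (y + h) * sqI a (\<lambda>x. f (x, y + h)))) + ?W y)"
      unfolding V by (simp only: distrib_left mult_ac)
    finally show "\<Phi> (\<lambda>x. shifty h (psi a b f) (x, y)) \<le> \<dots>" .
  qed
  also have "\<dots> = 2 * (ennreal (M\<^sup>2) * K) * (\<integral>\<^sup>+y. ennreal (h\<^sup>2) * (L * (indicator ?I (y + h) * sqI a (\<lambda>x. f (x, y + h)))) + ?W y \<partial>lborel)"
    by (rule nn_integral_cmult) measurable
  also have "(\<integral>\<^sup>+y. ennreal (h\<^sup>2) * (L * (indicator ?I (y + h) * sqI a (\<lambda>x. f (x, y + h)))) + ?W y \<partial>lborel) = ennreal (h\<^sup>2) * (L * (\<integral>\<^sup>+y. indicator ?I (y + h) * sqI a (\<lambda>x. f (x, y + h)) \<partial>lborel)) + (\<integral>\<^sup>+y. ?W y \<partial>lborel)"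
    by (simp add: nn_integral_add nn_integral_cmult)
  also have "(\<integral>\<^sup>+y. indicator ?I (y + h) * sqI a (\<lambda>x. f (x, y + h)) \<partial>lborel) = (\<integral>\<^sup>+y. indicator ?I y * sqI a (\<lambda>x. f (x, y)) \<partial>lborel)"
    by (rule nn_integral_translate_real) measurable
  also have "\<dots> = (sq_norm_on (Qb a b) f)"
    by (rule integral_sqI) measurable
  finally show ?thesis
    by (rule order_trans) (intro mult_left_mono add_left_mono primJ_weight_le, auto)
qed

end

section \<open>Existence of cutoffs, overlap and representatives\<close>

text \<open>A ramp from 0 to 1 over [0, 1] made of parabolas with knots 0, 1/2 and 1. Its derivative
  is a hat with slopes 4 and -4, hence Lipschitz, which is the regularity that \<open>cutoff\<close>
  asks for.\<close>

definition spline :: "real \<Rightarrow> real" where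
  "spline t = 2 * (max 0 t)\<^sup>2 - 4 * (max 0 (t - 1/2))\<^sup>2 + 2 * (max 0 (t - 1))\<^sup>2"

definition spline' :: "real \<Rightarrow> real" where
  "spline' t = 4 * max 0 t - 8 * max 0 (t - 1/2) + 4 * max 0 (t - 1)"

lemma DERIV_max_square: "((\<lambda>t::real. (max 0 t)\<^sup>2) has_real_derivative 2 * max 0 t) (at t)"
proof (cases "t = 0")
  case True
  have "((\<lambda>h::real. ((max 0 h)\<^sup>2 - 0) / h) \<longlongrightarrow> 0) (at 0)"
  proof (rule Lim_null_comparison)
    show "\<forall>\<^sub>F h in at 0. norm (((max 0 h)\<^sup>2 - 0) / h :: real) \<le> \<bar>h\<bar>"
      by (intro always_eventually allI) (auto simp: max_def power2_eq_square)
    show "((\<lambda>h::real. \<bar>h\<bar>) \<longlongrightarrow> 0) (at 0)" by (intro tendsto_eq_intros) auto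
  qed
  then show ?thesis using True by (simp add: has_field_derivative_iff)
next
  case False
  show ?thesis
  proof (cases "t > 0")
    case True
    have "((\<lambda>t. t\<^sup>2) has_real_derivative 2 * max 0 t) (at t)" using True by (auto intro!: derivative_eq_intros)
    then show ?thesis
      by (rule has_field_derivative_transform_within_open[of _ _ _ "{0<..}"]) (use True in auto)
  next
    case False
    with \<open>t \<noteq> 0\<close> have "t < 0" by simp
    have "((\<lambda>t. 0) has_real_derivative 2 * max 0 t) (at t)" using \<open>t < 0\<close> by (auto intro!: derivative_eq_intros)
    then show ?thesis
      by (rule has_field_derivative_transform_within_open[of _ _ _ "{..<0}"]) (use \<open>t < 0\<close> in auto)
  qed
qed

lemma DERIV_spline: "(spline has_real_derivative spline' t) (at t)"
proof -
  have 1: "((\<lambda>t. (max 0 (t - c))\<^sup>2) has_real_derivative 2 * max 0 (t - c)) (at t)" for c :: real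
  proof -
    have "((\<lambda>t. t - c) has_real_derivative 1) (at t)" by (auto intro!: derivative_eq_intros)
    from DERIV_chain2[OF DERIV_max_square this] show ?thesis by simp
  qed
  have "((\<lambda>t. 2 * (max 0 t)\<^sup>2 - 4 * (max 0 (t - 1/2))\<^sup>2 + 2 * (max 0 (t - 1))\<^sup>2) has_real_derivative
     2 * (2 * max 0 t) - 4 * (2 * max 0 (t - 1/2)) + 2 * (2 * max 0 (t - 1))) (at t)"
    by (intro DERIV_add DERIV_diff DERIV_cmult 1 DERIV_max_square)
  then show ?thesis by (simp add: spline_def[abs_def] spline'_def)
qed

lemma spline_zero: "t \<le> 0 \<Longrightarrow> spline t = 0 \<and> spline' t = 0"
  by (simp add: spline_def spline'_def max_def)

lemma spline_one: "t \<ge> 1 \<Longrightarrow> spline t = 1 \<and> spline' t = 0"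
  by (simp add: spline_def spline'_def max_def power2_eq_square algebra_simps)

text \<open>Each truncation is 1-Lipschitz, and the coefficients add up to 4 + 8 + 4 = 16.\<close>

lemma spline'_lipschitz: "\<bar>spline' s - spline' t\<bar> \<le> 16 * \<bar>s - t\<bar>"
proof -
  have "\<bar>max 0 (s - c) - max 0 (t - c)\<bar> \<le> \<bar>s - t\<bar>" for c :: real by (auto simp: max_def)
  from this[of 0] this[of "1/2"] this[of 1] show ?thesis unfolding spline'_def diff_zero abs_le_iff by argo
qed

lemma spline_bounds: "\<bar>spline' t\<bar> \<le> 16" "\<bar>spline t\<bar> \<le> 16"
proof -
  show b: "\<bar>spline' t\<bar> \<le> 16" for t
    using spline'_lipschitz[of t 0] spline_zero[of 0] spline_zero[of t] spline_one[of t]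
    by (cases "t \<le> 0"; cases "t \<ge> 1") auto
  have "\<bar>spline s - spline t\<bar> \<le> 16 * \<bar>s - t\<bar>" for s t
    using field_differentiable_bound[of UNIV spline spline' 16 s t] DERIV_spline b by auto
  from this[of t 0] show "\<bar>spline t\<bar> \<le> 16"
    using spline_zero[of 0] spline_zero[of t] spline_one[of t]
    by (cases "t \<le> 0"; cases "t \<ge> 1") auto
qed

lemma cutoff_exists:
  assumes R: "R > 0"
  obtains M \<alpha> \<alpha>' where "cutoff R M \<alpha> \<alpha>'"
proof -
  \<comment> \<open>The first ramp rises on [-R, 0] and the second is subtracted on [R, 2R].\<close>
  define \<alpha> where "\<alpha> t = spline (t / R + 1) - spline (t / R - 1)" for t
  define \<alpha>' where "\<alpha>' t = (spline' (t / R + 1) - spline' (t / R - 1)) / R" for t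
  \<comment> \<open>The three summands cover the size of \<alpha>, that of \<alpha>' and the
    Lipschitz constant of \<alpha>', which scale as 1, 1/R and 1/R^2; 32 is twice the bound 16 for
    one ramp.\<close>
  define M where "M = 32 * (1 + 1 / R + 1 / R\<^sup>2)"
  have M: "32 \<le> M" "32 / R \<le> M" "32 / R\<^sup>2 \<le> M" using R by (auto simp: M_def algebra_simps)
  have d: "(\<alpha> has_real_derivative \<alpha>' t) (at t)" for t
  proof -
    have "((\<lambda>t. spline (t / R + c)) has_real_derivative spline' (t / R + c) * (1 / R)) (at t)" for c
      by (rule DERIV_chain2[OF DERIV_spline]) (use R in \<open>auto intro!: derivative_eq_intros\<close>)
    from DERIV_diff[OF this[of 1] this[of "- 1"]] show ?thesis
      by (simp add: \<alpha>_def[abs_def] \<alpha>'_def diff_divide_distrib)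
  qed
  have b': "\<bar>\<alpha>' t\<bar> \<le> 32 / R" for t
  proof -
    have "\<bar>spline' (t / R + 1) - spline' (t / R - 1)\<bar> \<le> 32"
      using spline_bounds(1)[of "t / R + 1"] spline_bounds(1)[of "t / R - 1"] by linarith
    then show ?thesis using R by (simp add: \<alpha>'_def divide_right_mono)
  qed
  have "cutoff R M \<alpha> \<alpha>'"
  proof
    show "R > 0" "M > 0" using R M by auto
    show "(\<alpha> has_real_derivative \<alpha>' t) (at t)" for t by (rule d)
    show "\<bar>\<alpha> t\<bar> \<le> M" for t
      using spline_bounds(2)[of "t / R + 1"] spline_bounds(2)[of "t / R - 1"] M unfolding \<alpha>_def by linarith
    show "\<bar>\<alpha>' t\<bar> \<le> M" for t using b'[of t] M by linarith
    show "\<bar>\<alpha> s - \<alpha> t\<bar> \<le> M * \<bar>s - t\<bar>" for s t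
      using field_differentiable_bound[of UNIV \<alpha> \<alpha>' M s t] d order_trans[OF b' M(2)] by auto
    show "\<bar>\<alpha>' s - \<alpha>' t\<bar> \<le> M * \<bar>s - t\<bar>" for s t
    proof -
      have "\<bar>(spline' (s / R + 1) - spline' (s / R - 1)) - (spline' (t / R + 1) - spline' (t / R - 1))\<bar> \<le> 32 * \<bar>s / R - t / R\<bar>"
        using spline'_lipschitz[of "s / R + 1" "t / R + 1"] spline'_lipschitz[of "s / R - 1" "t / R - 1"] by simp
      also have "\<dots> = 32 / R * \<bar>s - t\<bar>" using R by (simp add: diff_divide_distrib[symmetric])
      finally have "\<bar>(spline' (s / R + 1) - spline' (s / R - 1)) - (spline' (t / R + 1) - spline' (t / R - 1))\<bar> / R \<le> 32 / R * \<bar>s - t\<bar> / R"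
        by (rule divide_right_mono) (use R in simp)
      then have "\<bar>\<alpha>' s - \<alpha>' t\<bar> \<le> 32 / R * \<bar>s - t\<bar> / R"
        unfolding \<alpha>'_def diff_divide_distrib[symmetric] abs_divide using R by (simp only: abs_of_pos)
      also have "\<dots> = 32 / R\<^sup>2 * \<bar>s - t\<bar>" by (simp add: power2_eq_square)
      also have "\<dots> \<le> M * \<bar>s - t\<bar>" using M by (intro mult_right_mono) auto
      finally show ?thesis .
    qed
    show "\<alpha> t = 0 \<and> \<alpha>' t = 0" if "t < - R \<or> 2 * R < t" for t
    proof -
      from that have "(t / R + 1 \<le> 0 \<and> t / R - 1 \<le> 0) \<or> (t / R + 1 \<ge> 1 \<and> t / R - 1 \<ge> 1)" using R by (auto simp: field_simps)
      then show ?thesis using spline_zero[of "t / R + 1"] spline_zero[of "t / R - 1"] spline_one[of "t / R + 1"] spline_one[of "t / R - 1"]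
        by (auto simp: \<alpha>_def \<alpha>'_def)
    qed
    show "\<alpha> t = 1 \<and> \<alpha>' t = 0" if "0 < t" "t < R" for t
    proof -
      have "t / R + 1 \<ge> 1" "t / R - 1 \<le> 0" using that R by (auto simp: field_simps)
      then show ?thesis using spline_one[of "t / R + 1"] spline_zero[of "t / R - 1"] by (auto simp: \<alpha>_def \<alpha>'_def)
    qed
  qed
  then show ?thesis by (rule that)
qed

section \<open>Areas of squares and overlap of the enlargements\<close>

lemma emeasure_square:
  assumes "r \<ge> 0"
  shows "emeasure lborel (box (a, b) (a + r, b + r)) = ennreal (r * r)" "emeasure lborel (cbox (a, b) (a + r, b + r)) = ennreal (r * r)"
proof -
  have "box (a, b) (a + r, b + r) = {a<..<a + r} \<times> {b<..<b + r}"
    by (auto simp: box_def Basis_prod_def inner_prod_def)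
  then have "emeasure lborel (box (a, b) (a + r, b + r)) = emeasure (lborel \<Otimes>\<^sub>M lborel) ({a<..<a + r} \<times> {b<..<b + r})"
    by (simp only: lborel_prod)
  also have "\<dots> = ennreal (r * r)" using assms by (subst lborel.emeasure_pair_measure_Times) (auto simp: ennreal_mult)
  finally show "emeasure lborel (box (a, b) (a + r, b + r)) = ennreal (r * r)" .
  have "emeasure lborel (cbox (a, b) (a + r, b + r)) = emeasure (lborel \<Otimes>\<^sub>M lborel) ({a..a + r} \<times> {b..b + r})"
    by (simp only: lborel_prod cbox_Pair_eq box_real)
  also have "\<dots> = ennreal (r * r)" using assms by (subst lborel.emeasure_pair_measure_Times) (auto simp: ennreal_mult)
  finally show "emeasure lborel (cbox (a, b) (a + r, b + r)) = ennreal (r * r)" .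
qed

text \<open>Area comparison: the squares whose enlargement meets p lie in a square of side \<open>18 * R\<close>, and \<open>972 = 3 * 18\<^sup>2\<close>.\<close>

lemma (in cutoff) overlap_enlarged:
  fixes a b :: "nat \<Rightarrow> real"
  assumes ov: "\<And>x. finite {i. x \<in> box (a i, b i) (a i + R, b i + R)} \<and> card {i. x \<in> box (a i, b i) (a i + R, b i + R)} \<le> 3"
  shows "(\<Sum>i. indicator (Qb (a i) (b i)) p :: ennreal) \<le> 972"
proof (rule suminf_le_const)
  fix n
  define S where "S = {i. i < n \<and> p \<in> Qb (a i) (b i)}"
  have S: "finite S" by (simp add: S_def)
  let ?O = "\<lambda>i. box (a i, b i) (a i + R, b i + R)"
  \<comment> \<open>If the enlargement contains p, then each corner coordinate lies between 9R below
    and 2R above that of p, so the square itself ends at most 3R above; the symmetric box of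
    half-side 9R contains it.\<close>
  let ?B = "cbox (fst p - 9 * R, snd p - 9 * R) (fst p - 9 * R + 18 * R, snd p - 9 * R + 18 * R)"
  have "of_nat (card S) * ennreal (R * R) = (\<Sum>i\<in>S. emeasure lborel (?O i))"
    using R by (simp add: emeasure_square)
  also have "\<dots> = (\<Sum>i\<in>S. \<integral>\<^sup>+x. indicator (?O i) x \<partial>lborel)" by simp
  also have "\<dots> = (\<integral>\<^sup>+x. (\<Sum>i\<in>S. indicator (?O i) x) \<partial>lborel)"
    by (rule nn_integral_sum[symmetric]) measurable
  also have "\<dots> \<le> (\<integral>\<^sup>+x. 3 * indicator ?B x \<partial>lborel)"
  proof (intro nn_integral_mono)
    fix x :: pt
    have sub: "x \<in> ?B" if "i \<in> S" "x \<in> ?O i" for i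
    proof -
      have "a i - 2 * R \<le> fst p" "fst p \<le> a i + 9 * R" "b i - 2 * R \<le> snd p" "snd p \<le> b i + 9 * R"
        using that by (auto simp: S_def Qb_def cbox_Pair_eq mem_Times_iff)
      moreover have "a i < fst x" "fst x < a i + R" "b i < snd x" "snd x < b i + R"
        using that by (auto simp: box_def Basis_prod_def inner_prod_def)
      ultimately show ?thesis using R by (auto simp: cbox_Pair_eq mem_Times_iff)
    qed
    show "(\<Sum>i\<in>S. indicator (?O i) x :: ennreal) \<le> 3 * indicator ?B x"
    proof (cases "x \<in> ?B")
      case True
      have "(\<Sum>i\<in>S. indicator (?O i) x :: ennreal) = of_nat (card (S \<inter> {i. x \<in> ?O i}))"
        using S by (simp add: indicator_def sum.If_cases)
      also have "card (S \<inter> {i. x \<in> ?O i}) \<le> card {i. x \<in> ?O i}" using ov[of x] by (intro card_mono) auto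
      then have "card (S \<inter> {i. x \<in> ?O i}) \<le> 3" using ov[of x] by linarith
      then have "(of_nat (card (S \<inter> {i. x \<in> ?O i})) :: ennreal) \<le> of_nat 3" by (rule of_nat_mono)
      finally show ?thesis using True by simp
    next
      case False
      then have "indicator (?O i) x = (0 :: ennreal)" if "i \<in> S" for i using sub[OF that] by (auto simp: indicator_def)
      then show ?thesis by simp
    qed
  qed
  also have "\<dots> = 3 * ennreal (18 * R * (18 * R))"
    using R emeasure_square(2)[of "18 * R" "fst p - 9 * R" "snd p - 9 * R"] by (simp add: nn_integral_cmult)
  also have "\<dots> = ennreal (3 * (18 * R * (18 * R)))" using R ennreal_mult[of 3 "18 * R * (18 * R)"] by simp
  finally have "ennreal (real (card S) * (R * R)) \<le> ennreal (972 * (R * R))"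
    using R by (simp add: ennreal_mult ennreal_of_nat_eq_real_of_nat mult_ac)
  then have "real (card S) * (R * R) \<le> 972 * (R * R)" using R by (subst (asm) ennreal_le_iff) auto
  then have "card S \<le> 972" using R by (subst (asm) mult_le_cancel_right) auto
  then have "(of_nat (card S) :: ennreal) \<le> of_nat 972" by (rule of_nat_mono)
  moreover have "(\<Sum>i<n. indicator (Qb (a i) (b i)) p :: ennreal) = of_nat (card S)"
    by (simp add: indicator_def sum.If_cases S_def lessThan_def Collect_conj_eq[symmetric])
  ultimately show "(\<Sum>i<n. indicator (Qb (a i) (b i)) p :: ennreal) \<le> 972" by simp
qed auto

text \<open>Changing u on a null set makes every horizontal section square integrable, so that antiderivatives exist on each of them.\<close>

lemma nice_representative:
  assumes u: "L2 u"
  obtains f where "nice f" "L2 f" "AE p in lborel. f p = u p" "\<And>F. fourier_L2 f F \<longleftrightarrow> fourier_L2 u F"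
proof -
  have [measurable]: "u \<in> borel_measurable borel" using u by (simp add: L2_def)
  define s where "s y = sq_norm (\<lambda>x. u (x, y))" for y
  have [measurable]: "s \<in> borel_measurable borel" unfolding s_def by measurable
  define f where "f p = (if s (snd p) < \<infinity> then u p else 0)" for p :: pt
  have [measurable]: "f \<in> borel_measurable borel" unfolding f_def by measurable
  have "(\<integral>\<^sup>+y. s y \<partial>lborel) = sq_norm u"
    unfolding s_def by (rule plane_iterated[symmetric]) measurable
  then have "(\<integral>\<^sup>+y. s y \<partial>lborel) \<noteq> \<infinity>" using L2_nn[OF u] by simp
  then have sfin: "AE y in lborel. s y \<noteq> \<infinity>" by (intro nn_integral_PInf_AE) auto
  have "(\<integral>\<^sup>+p. indicator {p::pt. s (snd p) = \<infinity>} p \<partial>lborel) = (\<integral>\<^sup>+y. (\<integral>\<^sup>+x. indicator {p::pt. s (snd p) = \<infinity>} (x, y) \<partial>lborel) \<partial>lborel)"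
    by (rule plane_iterated) measurable
  also have "\<dots> = (\<integral>\<^sup>+y. (0::ennreal) \<partial>(lborel::real measure))"
    by (rule nn_integral_cong_AE) (use sfin in eventually_elim, simp)
  finally have z: "(\<integral>\<^sup>+p. indicator {p::pt. s (snd p) = \<infinity>} p \<partial>lborel) = 0" by simp
  have "AE p in lborel. indicator {p::pt. s (snd p) = \<infinity>} p = (0::ennreal)"
    using z by (subst (asm) nn_integral_0_iff_AE) auto
  then have ae: "AE p in lborel. f p = u p"
    by eventually_elim (auto simp: f_def indicator_def top.not_eq_extremum split: if_splits)
  have le: "(sq_norm f) < \<infinity>"
    by (rule le_less_trans[OF nn_integral_mono L2_nn[OF u]]) (auto simp: f_def)
  have "lsq (\<lambda>x. f (x, y))" for y
    by (cases "s y < \<infinity>") (auto simp: lsq_def f_def s_def[symmetric])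
  then have "nice f" using le by (auto simp: nice_def)
  moreover have "L2 f" using le by (simp add: L2_def integrable_iff_bounded)
  \<comment> \<open>The truncated transforms are integrals, so they agree exactly for functions that
    agree almost everywhere.\<close>
  moreover have "trunc_fourier f n = trunc_fourier u n" for n
    unfolding trunc_fourier_eq ft_def trunc_def
    by (rule HOL.ext, rule integral_cong_AE, measurable) (use ae in \<open>auto elim!: eventually_mono\<close>)
  then have "fourier_L2 f F \<longleftrightarrow> fourier_L2 u F" for F by (simp add: fourier_L2_def)
  ultimately show ?thesis using that ae by blast
qed

text \<open>\<open>sqnormX\<close> picks a transform by \<open>SOME\<close>; uniqueness up to null
  sets, a consequence of the triangle inequality along the truncations, allows replacing that choice
  by any known transform.\<close>

lemma fourier_L2_unique:
  assumes [measurable]: "u \<in> borel_measurable borel" and F: "fourier_L2 u F" and G: "fourier_L2 u G"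
  shows "AE \<xi> in lborel. F \<xi> = G \<xi>"
proof -
  have [measurable]: "trunc_fourier u n \<in> borel_measurable borel" for n unfolding trunc_fourier_eq by measurable
  have [measurable]: "F \<in> borel_measurable borel" "G \<in> borel_measurable borel" using F G by (auto simp: fourier_L2_def)
  let ?e = "\<lambda>H n. \<integral>\<^sup>+\<xi>. ennreal ((cmod (H \<xi> - trunc_fourier u n \<xi>))\<^sup>2) \<partial>lborel"
  have "(\<lambda>n. 2 * ?e F n + 2 * ?e G n) \<longlonglongrightarrow> 2 * 0 + 2 * 0"
    using F G unfolding fourier_L2_def by (intro tendsto_add ennreal_tendsto_cmult) auto
  moreover have "(sq_norm (\<lambda>\<xi>. cmod (F \<xi> - G \<xi>))) \<le> 2 * ?e F n + 2 * ?e G n" for n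
  proof (rule nn_integral_power2_sum_le)
    show "\<bar>cmod (F \<xi> - G \<xi>)\<bar> \<le> \<bar>cmod (F \<xi> - trunc_fourier u n \<xi>)\<bar> + \<bar>cmod (G \<xi> - trunc_fourier u n \<xi>)\<bar>" for \<xi>
      using norm_triangle_ineq4[of "F \<xi> - trunc_fourier u n \<xi>" "G \<xi> - trunc_fourier u n \<xi>"] by simp
  qed measurable
  ultimately have "(sq_norm (\<lambda>\<xi>. cmod (F \<xi> - G \<xi>))) \<le> 0"
    by (intro LIMSEQ_le_const[where X="\<lambda>n. 2 * ?e F n + 2 * ?e G n"]) auto
  then have "AE \<xi> in lborel. ennreal ((cmod (F \<xi> - G \<xi>))\<^sup>2) = 0"
    by (subst (asm) le_zero_eq, subst (asm) nn_integral_0_iff_AE) auto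
  then show ?thesis by eventually_elim (auto simp: ennreal_eq_0_iff)
qed

text \<open>Once n exceeds the size of the support the truncation does nothing, so the approximating
  sequence is eventually constant.\<close>

lemma fourier_L2_compact:
  assumes f: "L12 f" and z: "\<And>p. p \<notin> cbox (- c, - c) (c, c) \<Longrightarrow> f p = 0"
  shows "fourier_L2 f (ft f)"
proof -
  note [measurable] = L12_measurable[OF f]
  obtain N :: nat where N: "c \<le> real N" using real_arch_simple by blast
  have "eventually (\<lambda>n. (sq_norm (\<lambda>\<xi>. cmod (ft f \<xi> - trunc_fourier f n \<xi>))) = 0) sequentially"
    unfolding eventually_sequentially
  proof (intro exI allI impI)
    fix n assume "N \<le> n"
    then have n: "c \<le> real n" using N by linarith
    have "trunc n f = f"
    proof
      fix p show "trunc n f p = f p"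
        using z[of p] n by (cases "p \<in> cbox (- c, - c) (c, c)") (auto simp: trunc_def cbox_Pair_eq indicator_def)
    qed
    then show "(sq_norm (\<lambda>\<xi>. cmod (ft f \<xi> - trunc_fourier f n \<xi>))) = 0" by (simp add: trunc_fourier_eq)
  qed
  then show ?thesis unfolding fourier_L2_def by (auto intro: tendsto_eventually)
qed

text \<open>The bound \<open>\<bar>cis t - 1\<bar> \<ge> \<bar>t\<bar> / 2\<close> near 0 replaces the limit of the difference quotients.\<close>

lemma vertical_limit:
  fixes W :: "pt \<Rightarrow> ennreal"
  assumes [measurable]: "W \<in> borel_measurable borel" and r: "r > 0"
    and le: "\<And>h. 0 < h \<Longrightarrow> h \<le> r \<Longrightarrow> (\<integral>\<^sup>+\<xi>. ennreal ((cmod (cis (h * snd \<xi>) - 1))\<^sup>2) * W \<xi> \<partial>lborel) \<le> ennreal (h\<^sup>2) * B"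
  shows "(\<integral>\<^sup>+\<xi>. ennreal ((snd \<xi>)\<^sup>2) * W \<xi> \<partial>lborel) \<le> 4 * B"
proof -
  define h where "h n = r / real (Suc n)" for n
  have h: "0 < h n" "h n \<le> r" for n using r by (auto simp: h_def field_simps)
  let ?f = "\<lambda>n \<xi>. ennreal (4 / (h n)\<^sup>2) * (ennreal ((cmod (cis (h n * snd \<xi>) - 1))\<^sup>2) * W \<xi>)"
  have "(\<integral>\<^sup>+\<xi>. ennreal ((snd \<xi>)\<^sup>2) * W \<xi> \<partial>lborel) \<le> (\<integral>\<^sup>+\<xi>. liminf (\<lambda>n. ?f n \<xi>) \<partial>lborel)"
  proof (intro nn_integral_mono Liminf_bounded)
    fix \<xi> :: pt
    have "h \<longlonglongrightarrow> 0" unfolding h_def using LIMSEQ_Suc[OF lim_const_over_n[of r]] by simp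
    then have "(\<lambda>n. \<bar>h n * snd \<xi>\<bar>) \<longlonglongrightarrow> \<bar>0 * snd \<xi>\<bar>" by (intro tendsto_intros)
    then have "eventually (\<lambda>n. \<bar>h n * snd \<xi>\<bar> < 1) sequentially" by (intro order_tendstoD) auto
    then show "eventually (\<lambda>n. ennreal ((snd \<xi>)\<^sup>2) * W \<xi> \<le> ?f n \<xi>) sequentially"
    proof eventually_elim
      case (elim n)
      have "(h n * snd \<xi>)\<^sup>2 / 4 \<le> (cmod (cis (h n * snd \<xi>) - 1))\<^sup>2" using elim by (intro cmod_cis_minus_one_ge) simp
      then have "(snd \<xi>)\<^sup>2 \<le> 4 / (h n)\<^sup>2 * (cmod (cis (h n * snd \<xi>) - 1))\<^sup>2"
        using h[of n] by (simp add: power_mult_distrib field_simps)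
      then have "ennreal ((snd \<xi>)\<^sup>2) \<le> ennreal (4 / (h n)\<^sup>2) * ennreal ((cmod (cis (h n * snd \<xi>) - 1))\<^sup>2)"
        by (simp add: ennreal_leI flip: ennreal_mult)
      from mult_right_mono[OF this, of "W \<xi>"] show ?case by (simp add: mult.assoc)
    qed
  qed
  also have "\<dots> \<le> liminf (\<lambda>n. \<integral>\<^sup>+\<xi>. ?f n \<xi> \<partial>lborel)" by (rule nn_integral_liminf) measurable
  also have "\<dots> \<le> 4 * B"
  proof (intro order_trans[OF Liminf_le_Limsup Limsup_bounded] always_eventually allI)
    fix n
    have "(\<integral>\<^sup>+\<xi>. ?f n \<xi> \<partial>lborel) = ennreal (4 / (h n)\<^sup>2) * (\<integral>\<^sup>+\<xi>. ennreal ((cmod (cis (h n * snd \<xi>) - 1))\<^sup>2) * W \<xi> \<partial>lborel)"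
      by (rule nn_integral_cmult) measurable
    also have "\<dots> \<le> ennreal (4 / (h n)\<^sup>2) * (ennreal ((h n)\<^sup>2) * B)" by (intro mult_left_mono le h) simp
    also have "\<dots> = 4 * B" using h[of n] by (simp add: mult.assoc[symmetric] ennreal_mult[symmetric])
    finally show "(\<integral>\<^sup>+\<xi>. ?f n \<xi> \<partial>lborel) \<le> 4 * B" .
  qed simp
  finally show ?thesis .
qed

section \<open>Summation over the cover\<close>

text \<open>This and the next two energies are the squared norms of D_x^{1/2} f, D_x^{-1/2} f_y and
  the x-antiderivative of f_y, up to the Plancherel factor \<open>cI\<close>.\<close>

definition half_energy :: "(pt \<Rightarrow> complex) \<Rightarrow> ennreal" where
  "half_energy F = (\<integral>\<^sup>+\<xi>. ennreal ((cmod (F \<xi>))\<^sup>2 * \<bar>fst \<xi>\<bar>) \<partial>lborel)"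

definition cross_energy :: "(pt \<Rightarrow> complex) \<Rightarrow> ennreal" where
  "cross_energy F = (\<integral>\<^sup>+\<xi>. ennreal ((cmod (F \<xi>))\<^sup>2 * (snd \<xi>)\<^sup>2 / \<bar>fst \<xi>\<bar>) \<partial>lborel)"

definition anti_energy :: "(pt \<Rightarrow> complex) \<Rightarrow> ennreal" where
  "anti_energy F = (\<integral>\<^sup>+\<xi>. ennreal ((cmod (F \<xi>))\<^sup>2 * (snd \<xi>)\<^sup>2 / (fst \<xi>)\<^sup>2) \<partial>lborel)"

abbreviation cF :: ennreal where "cF \<equiv> ennreal ((2 * pi)\<^sup>2)"
abbreviation cI :: ennreal where "cI \<equiv> ennreal (1 / (2 * pi)\<^sup>2)"

lemma cI_cF: "cI * cF = 1" "cF * cI = 1"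
proof -
  have "ennreal (1 / (2 * pi)\<^sup>2) * ennreal ((2 * pi)\<^sup>2) = ennreal (1 / (2 * pi)\<^sup>2 * (2 * pi)\<^sup>2)" by (rule ennreal_mult[symmetric]) auto
  also have "1 / (2 * pi)\<^sup>2 * (2 * pi)\<^sup>2 = 1" by simp
  finally show "cI * cF = 1" by simp
  then show "cF * cI = 1" by (simp only: mult.commute)
qed

lemma weighted_energy:
  assumes [measurable]: "F \<in> borel_measurable borel" and "lam \<ge> 0" "mu \<ge> 0"
  shows "(\<integral>\<^sup>+ \<xi>. ennreal ((cmod (F \<xi>))\<^sup>2 * (\<bar>fst \<xi>\<bar> + lam * (snd \<xi>)\<^sup>2 / \<bar>fst \<xi>\<bar> + mu * (snd \<xi>)\<^sup>2 / (fst \<xi>)\<^sup>2)) \<partial>lborel)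
    = half_energy F + ennreal lam * cross_energy F + ennreal mu * anti_energy F"
proof -
  have "(\<integral>\<^sup>+ \<xi>. ennreal ((cmod (F \<xi>))\<^sup>2 * (\<bar>fst \<xi>\<bar> + lam * (snd \<xi>)\<^sup>2 / \<bar>fst \<xi>\<bar> + mu * (snd \<xi>)\<^sup>2 / (fst \<xi>)\<^sup>2)) \<partial>lborel)
    = (\<integral>\<^sup>+ \<xi>. ennreal ((cmod (F \<xi>))\<^sup>2 * \<bar>fst \<xi>\<bar>) + ennreal lam * ennreal ((cmod (F \<xi>))\<^sup>2 * (snd \<xi>)\<^sup>2 / \<bar>fst \<xi>\<bar>) + ennreal mu * ennreal ((cmod (F \<xi>))\<^sup>2 * (snd \<xi>)\<^sup>2 / (fst \<xi>)\<^sup>2) \<partial>lborel)"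
  proof (intro nn_integral_cong)
    fix \<xi> :: pt
    have split: "ennreal (A + lam * B + mu * D) = ennreal A + ennreal lam * ennreal B + ennreal mu * ennreal D" if "0 \<le> A" "0 \<le> B" "0 \<le> D" for A B D
      using that assms(2,3) by (simp add: ennreal_mult)
    have "(cmod (F \<xi>))\<^sup>2 * (\<bar>fst \<xi>\<bar> + lam * (snd \<xi>)\<^sup>2 / \<bar>fst \<xi>\<bar> + mu * (snd \<xi>)\<^sup>2 / (fst \<xi>)\<^sup>2)
      = (cmod (F \<xi>))\<^sup>2 * \<bar>fst \<xi>\<bar> + lam * ((cmod (F \<xi>))\<^sup>2 * (snd \<xi>)\<^sup>2 / \<bar>fst \<xi>\<bar>) + mu * ((cmod (F \<xi>))\<^sup>2 * (snd \<xi>)\<^sup>2 / (fst \<xi>)\<^sup>2)"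
      by (simp add: distrib_left mult.left_commute)
    also have "ennreal \<dots> = ennreal ((cmod (F \<xi>))\<^sup>2 * \<bar>fst \<xi>\<bar>) + ennreal lam * ennreal ((cmod (F \<xi>))\<^sup>2 * (snd \<xi>)\<^sup>2 / \<bar>fst \<xi>\<bar>) + ennreal mu * ennreal ((cmod (F \<xi>))\<^sup>2 * (snd \<xi>)\<^sup>2 / (fst \<xi>)\<^sup>2)"
      by (rule split) auto
    finally show "ennreal ((cmod (F \<xi>))\<^sup>2 * (\<bar>fst \<xi>\<bar> + lam * (snd \<xi>)\<^sup>2 / \<bar>fst \<xi>\<bar> + mu * (snd \<xi>)\<^sup>2 / (fst \<xi>)\<^sup>2)) = \<dots>" .
  qed
  also have "\<dots> = half_energy F + ennreal lam * cross_energy F + ennreal mu * anti_energy F"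
    unfolding half_energy_def cross_energy_def anti_energy_def by (simp add: nn_integral_add nn_integral_cmult)
  finally show ?thesis .
qed

text \<open>At x = 0 both sides are 0 by the convention for division, so the cancellation in the
  cross term holds at every frequency.\<close>

lemma square_divide_abs: "(x::real)\<^sup>2 / \<bar>x\<bar> = \<bar>x\<bar>"
proof -
  have "x\<^sup>2 = \<bar>x\<bar> * \<bar>x\<bar>" by (simp add: power2_eq_square)
  then have "x\<^sup>2 / \<bar>x\<bar> = \<bar>x\<bar> * \<bar>x\<bar> / \<bar>x\<bar>" by (rule arg_cong[where f="\<lambda>t. t / \<bar>x\<bar>"])
  also have "\<dots> = \<bar>x\<bar>" by (cases "x = 0", simp, rule nonzero_mult_div_cancel_left, simp)
  finally show ?thesis .
qed

lemma suminf_mono_ennreal: "(\<And>i. f i \<le> g i) \<Longrightarrow> (\<Sum>i. f i) \<le> (\<Sum>i. g i :: ennreal)"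
  by (intro suminf_le summableI)

lemma term_le_suminf_ennreal: "f i \<le> (\<Sum>i. f i :: ennreal)"
  using sum_le_suminf[of f "{i}"] by (simp add: summableI)

section \<open>Sums of the energies of the extensions\<close>

locale cutoff_cover = cutoff +
  fixes a b :: "nat \<Rightarrow> real"
  assumes overlap: "\<And>x. finite {i. x \<in> box (a i, b i) (a i + R, b i + R)} \<and> card {i. x \<in> box (a i, b i) (a i + R, b i + R)} \<le> 3"
begin

definition S :: "(pt \<Rightarrow> real) \<Rightarrow> nat \<Rightarrow> ennreal" where
  "S f i = (sq_norm_on (Qb (a i) (b i)) f)"

abbreviation MK :: ennreal where "MK \<equiv> ennreal (M\<^sup>2) * K"

lemma MK_finite: "MK < \<infinity>" using K_finite by (simp add: ennreal_mult_less_top)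

text \<open>By monotone convergence the sum moves onto the indicators, where the overlap bound 972
  of the enlarged squares applies pointwise.\<close>

lemma sum_Qb:
  fixes F :: "pt \<Rightarrow> ennreal"
  assumes [measurable]: "F \<in> borel_measurable borel"
  shows "(\<Sum>i. \<integral>\<^sup>+p. indicator (Qb (a i) (b i)) p * F p \<partial>lborel) \<le> 972 * (\<integral>\<^sup>+p. F p \<partial>lborel)"
proof -
  have "(\<Sum>i. \<integral>\<^sup>+p. indicator (Qb (a i) (b i)) p * F p \<partial>lborel) = (\<integral>\<^sup>+p. (\<Sum>i. indicator (Qb (a i) (b i)) p * F p) \<partial>lborel)"
    by (rule nn_integral_suminf[symmetric]) measurable
  also have "\<dots> \<le> (\<integral>\<^sup>+p. 972 * F p \<partial>lborel)"
    unfolding ennreal_suminf_multc by (intro nn_integral_mono mult_right_mono overlap_enlarged overlap) simp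
  also have "\<dots> = 972 * (\<integral>\<^sup>+p. F p \<partial>lborel)" by (rule nn_integral_cmult) measurable
  finally show ?thesis .
qed

lemma sum_Qb_kernel:
  fixes v :: "real \<Rightarrow> ennreal" and F :: "real \<Rightarrow> pt \<Rightarrow> ennreal"
  assumes [measurable]: "v \<in> borel_measurable borel" "(\<lambda>(k, p). F k p) \<in> borel_measurable (borel \<Otimes>\<^sub>M borel)"
  shows "(\<Sum>i. \<integral>\<^sup>+k. v k * (\<integral>\<^sup>+p. indicator (Qb (a i) (b i)) p * F k p \<partial>lborel) \<partial>lborel) \<le> 972 * (\<integral>\<^sup>+k. v k * (\<integral>\<^sup>+p. F k p \<partial>lborel) \<partial>lborel)"
proof -
  have Fk: "F k \<in> borel_measurable borel" for k
    using measurable_compose[OF _ assms(2), of "\<lambda>p. (k, p)" borel] by simp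
  have "(\<Sum>i. \<integral>\<^sup>+k. v k * (\<integral>\<^sup>+p. indicator (Qb (a i) (b i)) p * F k p \<partial>lborel) \<partial>lborel) = (\<integral>\<^sup>+k. (\<Sum>i. v k * (\<integral>\<^sup>+p. indicator (Qb (a i) (b i)) p * F k p \<partial>lborel)) \<partial>lborel)"
    by (rule nn_integral_suminf[symmetric]) measurable
  also have "\<dots> \<le> (\<integral>\<^sup>+k. v k * (972 * (\<integral>\<^sup>+p. F k p \<partial>lborel)) \<partial>lborel)"
    unfolding ennreal_suminf_cmult by (intro nn_integral_mono mult_left_mono sum_Qb Fk) simp
  also have "\<dots> = (\<integral>\<^sup>+k. 972 * (v k * (\<integral>\<^sup>+p. F k p \<partial>lborel)) \<partial>lborel)" by (simp only: mult_ac)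
  also have "\<dots> = 972 * (\<integral>\<^sup>+k. v k * (\<integral>\<^sup>+p. F k p \<partial>lborel) \<partial>lborel)" by (rule nn_integral_cmult) measurable
  finally show ?thesis .
qed

lemma sum_S: "f \<in> borel_measurable borel \<Longrightarrow> (\<Sum>i. S f i) \<le> 972 * sq_norm f"
  unfolding S_def by (rule sum_Qb) measurable

lemma sum_sq_norm_ext:
  assumes f: "nice f"
  shows "(\<Sum>i. sq_norm (ext (a i) (b i) f)) \<le> MK * 972 * sq_norm f"
proof -
  have "(\<Sum>i. sq_norm (ext (a i) (b i) f)) \<le> (\<Sum>i. MK * S f i)"
    unfolding S_def by (intro suminf_mono_ennreal ext_sqint_le f)
  also have "\<dots> \<le> MK * (972 * sq_norm f)"
    unfolding ennreal_suminf_cmult by (intro mult_left_mono sum_S nice_measurable f) simp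
  finally show ?thesis by (simp only: mult.assoc)
qed

text \<open>\<open>gagliardo_ft_le\<close> turns the half derivative of each extension into local
  norms and horizontal differences of f, the overlap bound sums these, and
  \<open>gagliardo_shiftx\<close> returns to the frequency side; 160 = 4 * 40.\<close>

lemma sum_half_energy_ext:
  assumes f: "nice f" "L2 f" and F: "fourier_L2 f F"
  shows "cI * (\<Sum>i. half_energy (ft (ext (a i) (b i) f))) \<le> 160 * MK * 972 * (sq_norm f + cI * half_energy F)"
proof -
  note [measurable] = nice_measurable[OF f(1)]
  define GQ where "GQ = (\<integral>\<^sup>+k. (indicator {0<..} k * ennreal (1 / k\<^sup>2)) * (sq_norm (shiftx k f)) \<partial>lborel)"
  have GQ: "cF * GQ \<le> 40 * half_energy F"
    unfolding GQ_def half_energy_def mult.assoc by (rule gagliardo_shiftx[OF f(2) F])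
  have sQ: "(\<Sum>i. shiftQ (a i) (b i) f) \<le> 972 * GQ"
    unfolding shiftQ_def mult.assoc[symmetric] GQ_def
    by (rule sum_Qb_kernel) (auto simp: shiftx_def case_prod_beta')
  have "(\<Sum>i. half_energy (ft (ext (a i) (b i) f))) \<le> (\<Sum>i. 4 * (cF * (MK * (S f i + shiftQ (a i) (b i) f))))"
    unfolding half_energy_def S_def
    by (intro suminf_mono_ennreal order_trans[OF gagliardo_ft_le[OF L12_psi_ext(2)[OF f(1)]]] mult_left_mono ext_gagl_le f) auto
  also have "\<dots> = 4 * (cF * (MK * ((\<Sum>i. S f i) + (\<Sum>i. shiftQ (a i) (b i) f))))"
    by (simp add: ennreal_suminf_cmult suminf_add[symmetric] summableI del: power_mult_distrib)
  also have "\<dots> \<le> 4 * (cF * (MK * (972 * sq_norm f + 972 * GQ)))"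
    by (intro mult_left_mono add_mono sum_S sQ) auto
  finally have "cI * (\<Sum>i. half_energy (ft (ext (a i) (b i) f))) \<le> cI * (4 * (cF * (MK * (972 * sq_norm f + 972 * GQ))))"
    by (rule mult_left_mono) simp
  also have "\<dots> = 4 * MK * 972 * ((cI * cF) * sq_norm f + cI * (cF * GQ))"
    by (simp only: distrib_left mult_ac)
  also have "\<dots> \<le> 4 * MK * 972 * (40 * sq_norm f + cI * (40 * half_energy F))"
    unfolding cI_cF
  proof (intro mult_left_mono add_mono GQ)
    show "1 * sq_norm f \<le> 40 * sq_norm f" by (intro mult_right_mono) auto
  qed auto
  also have "\<dots> = (4 * 40) * MK * 972 * (sq_norm f + cI * half_energy F)" by (simp only: distrib_left mult_ac)
  finally show ?thesis by simp
qed

text \<open>Applying Fatou to the sum over all squares at once avoids any uniformity in i.\<close>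

lemma vertical_sum:
  fixes W :: "nat \<Rightarrow> pt \<Rightarrow> ennreal"
  assumes [measurable]: "\<And>i. W i \<in> borel_measurable borel" "f \<in> borel_measurable borel"
    and W: "\<And>h i. 0 < h \<Longrightarrow> h \<le> R \<Longrightarrow> (\<integral>\<^sup>+\<xi>. ennreal ((cmod (cis (h * snd \<xi>) - 1))\<^sup>2) * W i \<xi> \<partial>lborel) \<le> q * (cF * (ennreal (h\<^sup>2) * (L * S f i) + P h i))"
    and P: "\<And>h. (\<Sum>i. P h i) \<le> 972 * GP h" and GP: "\<And>h. cF * GP h \<le> \<kappa>' * (ennreal (h\<^sup>2) * w)"
  shows "cI * (\<Sum>i. \<integral>\<^sup>+\<xi>. ennreal ((snd \<xi>)\<^sup>2) * W i \<xi> \<partial>lborel) \<le> 4 * q * 972 * (L + \<kappa>') * (sq_norm f + cI * w)"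
proof -
  \<comment> \<open>The bound has to be free of h. The part with L comes from differences falling on
    the cutoff, the part with \<kappa>' and w from primitives of vertical differences; both are
    proportional to h^2, which cancels in \<open>vertical_limit\<close>.\<close>
  let ?B = "q * 972 * (L * (cF * sq_norm f) + \<kappa>' * w)"
  have sum: "(\<Sum>i. \<integral>\<^sup>+\<xi>. g \<xi> * W i \<xi> \<partial>lborel) = (\<integral>\<^sup>+\<xi>. g \<xi> * (\<Sum>i. W i \<xi>) \<partial>lborel)" if [measurable]: "g \<in> borel_measurable borel" for g :: "pt \<Rightarrow> ennreal"
    unfolding ennreal_suminf_cmult[symmetric] by (rule nn_integral_suminf[symmetric]) measurable
  have "(\<integral>\<^sup>+\<xi>. ennreal ((snd \<xi>)\<^sup>2) * (\<Sum>i. W i \<xi>) \<partial>lborel) \<le> 4 * ?B"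
  proof (rule vertical_limit[OF _ R])
    fix h :: real assume h: "0 < h" "h \<le> R"
    have "(\<integral>\<^sup>+\<xi>. ennreal ((cmod (cis (h * snd \<xi>) - 1))\<^sup>2) * (\<Sum>i. W i \<xi>) \<partial>lborel) = (\<Sum>i. \<integral>\<^sup>+\<xi>. ennreal ((cmod (cis (h * snd \<xi>) - 1))\<^sup>2) * W i \<xi> \<partial>lborel)"
      by (rule sum[symmetric]) measurable
    also have "\<dots> \<le> (\<Sum>i. q * (cF * (ennreal (h\<^sup>2) * (L * S f i) + P h i)))"
      by (intro suminf_mono_ennreal W h)
    also have "\<dots> = q * (cF * (ennreal (h\<^sup>2) * (L * (\<Sum>i. S f i)) + (\<Sum>i. P h i)))"
      by (simp add: ennreal_suminf_cmult suminf_add[symmetric] summableI del: power_mult_distrib)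
    also have "\<dots> \<le> q * (cF * (ennreal (h\<^sup>2) * (L * (972 * sq_norm f)) + 972 * GP h))"
      by (intro mult_left_mono add_mono sum_S P) auto
    also have "\<dots> = q * 972 * (ennreal (h\<^sup>2) * (L * (cF * sq_norm f)) + cF * GP h)"
      by (simp only: distrib_left mult_ac)
    also have "\<dots> \<le> q * 972 * (ennreal (h\<^sup>2) * (L * (cF * sq_norm f)) + \<kappa>' * (ennreal (h\<^sup>2) * w))"
      by (intro mult_left_mono add_mono GP) auto
    also have "\<dots> = ennreal (h\<^sup>2) * ?B"
      by (simp only: distrib_left mult_ac)
    finally show "(\<integral>\<^sup>+\<xi>. ennreal ((cmod (cis (h * snd \<xi>) - 1))\<^sup>2) * (\<Sum>i. W i \<xi>) \<partial>lborel) \<le> ennreal (h\<^sup>2) * ?B" .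
  qed measurable
  then have "cI * (\<Sum>i. \<integral>\<^sup>+\<xi>. ennreal ((snd \<xi>)\<^sup>2) * W i \<xi> \<partial>lborel) \<le> cI * (4 * ?B)"
    by (subst sum, measurable, intro mult_left_mono) simp_all
  also have "\<dots> = 4 * q * 972 * (L * ((cI * cF) * sq_norm f) + \<kappa>' * (cI * w))"
    by (simp only: distrib_left mult_ac)
  also have "\<dots> \<le> 4 * q * 972 * ((L + \<kappa>') * (sq_norm f + cI * w))"
  proof (rule mult_left_mono)
    have "L * (1 * sq_norm f) \<le> L * (sq_norm f + cI * w)" "\<kappa>' * (cI * w) \<le> \<kappa>' * (sq_norm f + cI * w)"
      by (rule mult_left_mono; simp)+
    then show "L * ((cI * cF) * sq_norm f) + \<kappa>' * (cI * w) \<le> (L + \<kappa>') * (sq_norm f + cI * w)"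
      unfolding cI_cF distrib_right by (rule add_mono)
  qed simp
  finally show ?thesis by (simp only: mult.assoc)
qed

text \<open>Since the transform of the extension is i\<xi> times that of \<psi>, the weight
  \<eta>^2/|\<xi>| on the extension is |\<xi>| \<eta>^2 on \<psi>: a half derivative in x of
  vertical differences of \<psi>. It is estimated by \<open>gagl\<close> on sections, with V =
  \<open>V2\<close>.\<close>

lemma sum_cross_energy_ext:
  assumes f: "nice f" "L2 f" and F: "fourier_L2 f F"
  shows "cI * (\<Sum>i. cross_energy (ft (ext (a i) (b i) f))) \<le> 4 * (8 * MK) * 972 * (ennreal (6 * R) + 40) * (sq_norm f + cI * cross_energy F)"
proof -
  note [measurable] = nice_measurable[OF f(1)]
  let ?\<omega> = "\<lambda>k::real. ennreal (1 / k\<^sup>2)"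
  let ?W = "\<lambda>i \<xi>. ennreal ((cmod (ft (ext (a i) (b i) f) \<xi>))\<^sup>2 / \<bar>fst \<xi>\<bar>)"
  define GP where "GP h = (\<integral>\<^sup>+k. (indicator {0<..6 * R} k * ?\<omega> k) * (sq_norm (primx k (shifty h f))) \<partial>lborel)" for h
  have w: "cross_energy (ft (ext (a i) (b i) f)) = (\<integral>\<^sup>+\<xi>. ennreal ((snd \<xi>)\<^sup>2) * ?W i \<xi> \<partial>lborel)" for i
    unfolding cross_energy_def by (intro nn_integral_cong, subst ennreal_mult[symmetric]) (simp_all add: mult.commute)
  show ?thesis
    unfolding w
  proof (rule vertical_sum[where GP=GP and P="\<lambda>h i. primQ ?\<omega> (a i) (b i) (shifty h f)"])
    fix h :: real and i assume h: "0 < h" "h \<le> R"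
    let ?P = "psi (a i) (b i) f"
    have P: "L12 (shifty h ?P)" by (intro L12_shifty L12_psi_ext f)
    \<comment> \<open>With \<eta> replaced by its difference multiplier, the identity of weights
      holds pointwise in \<xi>.\<close>
    have "(\<integral>\<^sup>+\<xi>. ennreal ((cmod (cis (h * snd \<xi>) - 1))\<^sup>2) * ?W i \<xi> \<partial>lborel) = (\<integral>\<^sup>+\<xi>. ennreal ((cmod (ft (shifty h ?P) \<xi>))\<^sup>2 * \<bar>fst \<xi>\<bar>) \<partial>lborel)"
    proof (intro nn_integral_cong)
      fix \<xi> :: pt
      have e: "(cmod (ft (ext (a i) (b i) f) \<xi>))\<^sup>2 = (fst \<xi>)\<^sup>2 * (cmod (ft ?P \<xi>))\<^sup>2"
        "(cmod (ft (shifty h ?P) \<xi>))\<^sup>2 = (cmod (cis (h * snd \<xi>) - 1))\<^sup>2 * (cmod (ft ?P \<xi>))\<^sup>2"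
        using L12_psi_ext(1)[OF f(1), of "a i" "b i"] unfolding ft_ext[OF f(1)]
        by (simp_all add: ft_shifty L12_def norm_mult power_mult_distrib)
      have "(cmod (cis (h * snd \<xi>) - 1))\<^sup>2 * ((cmod (ft (ext (a i) (b i) f) \<xi>))\<^sup>2 / \<bar>fst \<xi>\<bar>) = (cmod (ft (shifty h ?P) \<xi>))\<^sup>2 * \<bar>fst \<xi>\<bar>"
      proof -
        have "c * (x\<^sup>2 * p / \<bar>x\<bar>) = c * p * (x\<^sup>2 / \<bar>x\<bar>)" for c x p :: real by simp
        then show ?thesis unfolding e square_divide_abs .
      qed
      then show "ennreal ((cmod (cis (h * snd \<xi>) - 1))\<^sup>2) * ?W i \<xi> = ennreal ((cmod (ft (shifty h ?P) \<xi>))\<^sup>2 * \<bar>fst \<xi>\<bar>)"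
        by (subst ennreal_mult[symmetric]) auto
    qed
    also have "\<dots> \<le> 4 * (cF * (\<integral>\<^sup>+y. gagl (\<lambda>x. shifty h ?P (x, y)) \<partial>lborel))" by (rule gagliardo_ft_le[OF P])
    also have "\<dots> \<le> 4 * (cF * (2 * MK * (ennreal (h\<^sup>2) * (ennreal (6 * R) * S f i) + primQ ?\<omega> (a i) (b i) (shifty h f))))"
      unfolding S_def
      by (intro mult_left_mono psi_shifty_le[OF f(1) h _ gagl_combination, where V="V2 (a i)"] section_bounds(3) V2_le) (auto simp: V2_def)
    also have "\<dots> = (4 * 2) * MK * (cF * (ennreal (h\<^sup>2) * (ennreal (6 * R) * S f i) + primQ ?\<omega> (a i) (b i) (shifty h f)))"
      by (simp only: mult_ac)
    finally show "(\<integral>\<^sup>+\<xi>. ennreal ((cmod (cis (h * snd \<xi>) - 1))\<^sup>2) * ?W i \<xi> \<partial>lborel) \<le> 8 * MK * (cF * (ennreal (h\<^sup>2) * (ennreal (6 * R) * S f i) + primQ ?\<omega> (a i) (b i) (shifty h f)))"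
      by simp
  next
    fix h :: real
    have m: "(\<lambda>(k, p). ennreal ((primx k (shifty h f) p)\<^sup>2)) \<in> borel_measurable (borel \<Otimes>\<^sub>M borel)"
      using primx_measurable2[of "shifty h f"] by (simp add: case_prod_beta')
    show "(\<Sum>i. primQ ?\<omega> (a i) (b i) (shifty h f)) \<le> 972 * GP h"
      unfolding primQ_def mult.assoc[symmetric] GP_def by (rule sum_Qb_kernel[OF _ m]) measurable
    have "cF * GP h \<le> cF * (\<integral>\<^sup>+k. indicator {0<..} k * (?\<omega> k * (sq_norm (primx k (shifty h f)))) \<partial>lborel)"
      unfolding GP_def mult.assoc by (intro mult_left_mono nn_integral_mono mult_right_mono) (auto simp: indicator_def)
    also have "\<dots> \<le> 40 * (ennreal (h\<^sup>2) * cross_energy F)" unfolding cross_energy_def by (rule gagliardo_primx[OF f(2) F])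
    finally show "cF * GP h \<le> 40 * (ennreal (h\<^sup>2) * cross_energy F)" .
  qed measurable
qed

text \<open>Here the factor \<xi>^2 cancels completely, so \<eta>^2/\<xi>^2 on the extension is
  \<eta>^2 on \<psi> and plain L2 norms of vertical differences of \<psi> suffice. The functional is
  \<open>sqint\<close>, with V = \<open>V1\<close> and weight 1 in k.\<close>

lemma sum_anti_energy_ext:
  assumes f: "nice f" "L2 f" and F: "fourier_L2 f F"
  shows "cI * (\<Sum>i. anti_energy (ft (ext (a i) (b i) f))) \<le> 4 * (2 * MK) * 972 * (V1_const + ennreal (6 * R) * 32) * (sq_norm f + cI * anti_energy F)"
proof -
  note [measurable] = nice_measurable[OF f(1)]
  let ?\<omega> = "\<lambda>k::real. 1 :: ennreal"
  let ?W = "\<lambda>i \<xi>. ennreal ((cmod (ft (ext (a i) (b i) f) \<xi>))\<^sup>2 / (fst \<xi>)\<^sup>2)"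
  define GP where "GP h = (\<integral>\<^sup>+k. (indicator {0<..6 * R} k * ?\<omega> k) * (sq_norm (primx k (shifty h f))) \<partial>lborel)" for h
  have w: "anti_energy (ft (ext (a i) (b i) f)) = (\<integral>\<^sup>+\<xi>. ennreal ((snd \<xi>)\<^sup>2) * ?W i \<xi> \<partial>lborel)" for i
    unfolding anti_energy_def by (intro nn_integral_cong, subst ennreal_mult[symmetric]) (simp_all add: mult.commute)
  show ?thesis
    unfolding w
  proof (rule vertical_sum[where GP=GP and P="\<lambda>h i. primQ ?\<omega> (a i) (b i) (shifty h f)"])
    fix h :: real and i assume h: "0 < h" "h \<le> R"
    let ?P = "psi (a i) (b i) f"
    have P: "L12 (shifty h ?P)" by (intro L12_shifty L12_psi_ext f)
    note [measurable] = L12_measurable[OF P]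
    have "(\<integral>\<^sup>+\<xi>. ennreal ((cmod (cis (h * snd \<xi>) - 1))\<^sup>2) * ?W i \<xi> \<partial>lborel) \<le> (sq_norm (\<lambda>\<xi>. cmod (ft (shifty h ?P) \<xi>)))"
    proof (intro nn_integral_mono)
      fix \<xi> :: pt
      have e: "(cmod (ft (ext (a i) (b i) f) \<xi>))\<^sup>2 = (fst \<xi>)\<^sup>2 * (cmod (ft ?P \<xi>))\<^sup>2"
        "(cmod (ft (shifty h ?P) \<xi>))\<^sup>2 = (cmod (cis (h * snd \<xi>) - 1))\<^sup>2 * (cmod (ft ?P \<xi>))\<^sup>2"
        using L12_psi_ext(1)[OF f(1), of "a i" "b i"] unfolding ft_ext[OF f(1)]
        by (simp_all add: ft_shifty L12_def norm_mult power_mult_distrib)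
      \<comment> \<open>Equality holds off the line \<xi> = 0; on it the left side is 0 by the
        convention for division.\<close>
      have "(cmod (cis (h * snd \<xi>) - 1))\<^sup>2 * ((cmod (ft (ext (a i) (b i) f) \<xi>))\<^sup>2 / (fst \<xi>)\<^sup>2) \<le> (cmod (ft (shifty h ?P) \<xi>))\<^sup>2"
        unfolding e by (cases "fst \<xi> = 0") simp_all
      then show "ennreal ((cmod (cis (h * snd \<xi>) - 1))\<^sup>2) * ?W i \<xi> \<le> ennreal ((cmod (ft (shifty h ?P) \<xi>))\<^sup>2)"
        by (subst ennreal_mult[symmetric]) (auto intro: ennreal_leI)
    qed
    also have "\<dots> \<le> cF * (sq_norm (shifty h ?P))" using P by (intro plancherel_le) (simp add: L12_def)
    also have "(sq_norm (shifty h ?P)) = (\<integral>\<^sup>+y. sqint (\<lambda>x. shifty h ?P (x, y)) \<partial>lborel)"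
      unfolding sqint_def by (rule plane_iterated) measurable
    also have "cF * \<dots> \<le> cF * (2 * MK * (ennreal (h\<^sup>2) * (V1_const * S f i) + primQ ?\<omega> (a i) (b i) (shifty h f)))"
      unfolding S_def
      by (intro mult_left_mono psi_shifty_le[OF f(1) h _ sqint_combination, where V="V1 (a i)"] section_bounds(4) V1_sqI) (auto simp: V1_def)
    also have "\<dots> = 2 * MK * (cF * (ennreal (h\<^sup>2) * (V1_const * S f i) + primQ ?\<omega> (a i) (b i) (shifty h f)))"
      by (simp only: mult_ac)
    finally show "(\<integral>\<^sup>+\<xi>. ennreal ((cmod (cis (h * snd \<xi>) - 1))\<^sup>2) * ?W i \<xi> \<partial>lborel) \<le> 2 * MK * (cF * (ennreal (h\<^sup>2) * (V1_const * S f i) + primQ ?\<omega> (a i) (b i) (shifty h f)))" .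
  next
    fix h :: real
    have m: "(\<lambda>(k, p). ennreal ((primx k (shifty h f) p)\<^sup>2)) \<in> borel_measurable (borel \<Otimes>\<^sub>M borel)"
      using primx_measurable2[of "shifty h f"] by (simp add: case_prod_beta')
    then have [measurable]: "(\<lambda>k. \<integral>\<^sup>+p. ennreal ((primx k (shifty h f) p)\<^sup>2) \<partial>lborel) \<in> borel_measurable borel"
      by measurable
    show "(\<Sum>i. primQ ?\<omega> (a i) (b i) (shifty h f)) \<le> 972 * GP h"
      unfolding primQ_def mult.assoc[symmetric] GP_def by (rule sum_Qb_kernel[OF _ m]) measurable
    have "cF * GP h = (\<integral>\<^sup>+k. indicator {0<..6 * R} k * (cF * (sq_norm (primx k (shifty h f)))) \<partial>lborel)"
      unfolding GP_def by (subst nn_integral_cmult[symmetric], measurable) (auto intro!: nn_integral_cong simp: mult_ac)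
    \<comment> \<open>The bound of \<open>primx_local\<close> does not depend on k, so the range of
      k contributes just its length 6R.\<close>
    also have "\<dots> \<le> (\<integral>\<^sup>+k. indicator {0<..6 * R} k * (32 * (ennreal (h\<^sup>2) * anti_energy F)) \<partial>lborel)"
    proof (intro nn_integral_mono)
      fix k :: real
      show "indicator {0<..6 * R} k * (cF * (sq_norm (primx k (shifty h f)))) \<le> indicator {0<..6 * R} k * (32 * (ennreal (h\<^sup>2) * anti_energy F))"
        using primx_local[OF f(2) F, of k h] unfolding anti_energy_def by (cases "0 < k") (auto intro!: mult_left_mono simp: indicator_def)
    qed
    also have "\<dots> = ennreal (6 * R) * 32 * (ennreal (h\<^sup>2) * anti_energy F)" using R by (simp add: nn_integral_multc mult.assoc)
    finally show "cF * GP h \<le> ennreal (6 * R) * 32 * (ennreal (h\<^sup>2) * anti_energy F)" .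
  qed measurable
qed


section \<open>Norm and membership of the extensions, and the final bound\<close>

lemma ext_fourier:
  assumes f: "nice f" shows "fourier_L2 (ext a0 b0 f) (ft (ext a0 b0 f))"
proof (rule fourier_L2_compact)
  let ?c = "max (max \<bar>a0 - R\<bar> \<bar>a0 + 2 * R\<bar>) (max \<bar>b0 - R\<bar> \<bar>b0 + 2 * R\<bar>)"
  show "L12 (ext a0 b0 f)" by (rule L12_psi_ext[OF f])
  show "ext a0 b0 f p = 0" if "p \<notin> cbox (- ?c, - ?c) (?c, ?c)" for p
  proof (rule psi_ext_zero)
    have "cbox (a0 - R, b0 - R) (a0 + 2 * R, b0 + 2 * R) \<subseteq> cbox (- ?c, - ?c) (?c, ?c)"
      by (auto simp: cbox_Pair_eq)
    then show "p \<notin> cbox (a0 - R, b0 - R) (a0 + 2 * R, b0 + 2 * R)" using that by blast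
  qed
qed

lemma ext_sqnormX:
  assumes f: "nice f" and l: "lam \<ge> 0" "mu \<ge> 0"
  shows "sqnormX lam mu (ext a0 b0 f) = sq_norm (ext a0 b0 f) + cI * (half_energy (ft (ext a0 b0 f)) + ennreal lam * cross_energy (ft (ext a0 b0 f)) + ennreal mu * anti_energy (ft (ext a0 b0 f)))"
proof -
  let ?g = "ext a0 b0 f"
  note [measurable] = nice_measurable[OF f]
  have "fourier_L2 ?g (SOME F. fourier_L2 ?g F)" by (rule someI[where P="fourier_L2 ?g", OF ext_fourier[OF f]])
  from fourier_L2_unique[OF _ this ext_fourier[OF f]] have "AE \<xi> in lborel. (SOME F. fourier_L2 ?g F) \<xi> = ft ?g \<xi>" by simp
  then have "(\<integral>\<^sup>+ \<xi>. ennreal ((cmod ((SOME F. fourier_L2 ?g F) \<xi>))\<^sup>2 * (\<bar>fst \<xi>\<bar> + lam * (snd \<xi>)\<^sup>2 / \<bar>fst \<xi>\<bar> + mu * (snd \<xi>)\<^sup>2 / (fst \<xi>)\<^sup>2)) \<partial>lborel)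
    = (\<integral>\<^sup>+ \<xi>. ennreal ((cmod (ft ?g \<xi>))\<^sup>2 * (\<bar>fst \<xi>\<bar> + lam * (snd \<xi>)\<^sup>2 / \<bar>fst \<xi>\<bar> + mu * (snd \<xi>)\<^sup>2 / (fst \<xi>)\<^sup>2)) \<partial>lborel)"
    by (intro nn_integral_cong_AE) (auto elim!: eventually_mono)
  also have "\<dots> = half_energy (ft ?g) + ennreal lam * cross_energy (ft ?g) + ennreal mu * anti_energy (ft ?g)"
    by (rule weighted_energy) (use l in measurable)
  finally show ?thesis unfolding sqnormX_def by simp
qed

text \<open>A single energy is at most the sum over all squares, so the finiteness that membership
  demands is read off from the summed bounds.\<close>

lemma ext_inX:
  assumes f: "nice f" "L2 f" and F: "fourier_L2 f F" and fin: "half_energy F < \<infinity>" "cross_energy F < \<infinity>"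
  shows "inX (ext (a i) (b i) f)"
proof -
  let ?g = "ext (a i) (b i) f"
  have sq: "sq_norm f < \<infinity>" using L2_nn[OF f(2)] by simp
  have c0: "x < \<infinity>" if "cI * x < \<infinity>" for x using that by (auto simp: ennreal_mult_less_top)
  have "cI * half_energy (ft ?g) \<le> cI * (\<Sum>i. half_energy (ft (ext (a i) (b i) f)))"
    by (intro mult_left_mono term_le_suminf_ennreal) simp
  also have "\<dots> \<le> 160 * MK * 972 * (sq_norm f + cI * half_energy F)" by (rule sum_half_energy_ext[OF f F])
  also have "\<dots> < \<infinity>" using sq fin MK_finite by (simp add: ennreal_mult_less_top)
  finally have 2: "half_energy (ft ?g) < \<infinity>" by (rule c0)
  have "cI * cross_energy (ft ?g) \<le> cI * (\<Sum>i. cross_energy (ft (ext (a i) (b i) f)))"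
    by (intro mult_left_mono term_le_suminf_ennreal) simp
  also have "\<dots> \<le> 4 * (8 * MK) * 972 * (ennreal (6 * R) + 40) * (sq_norm f + cI * cross_energy F)" by (rule sum_cross_energy_ext[OF f F])
  also have "\<dots> < \<infinity>" using sq fin MK_finite by (simp add: ennreal_mult_less_top)
  finally have 3: "cross_energy (ft ?g) < \<infinity>" by (rule c0)
  have "L2 ?g" using L12_psi_ext(2)[OF f(1), of "a i" "b i"] by (auto simp: L2_def L12_def integrable_iff_bounded)
  then show ?thesis unfolding inX_def using ext_fourier[OF f(1)] 2 3 by (auto simp: half_energy_def cross_energy_def)
qed

text \<open>Each extension competes in the infimum that defines \<open>sqnormX_on\<close>, so the
  sum of the local norms is at most the sum of the norms of the extensions, which splits into the
  four sums estimated above.\<close>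

lemma cover_bound:
  assumes l: "lam \<ge> 0" "mu \<ge> 0"
  shows "\<exists>C::real. \<forall>u. inX u \<longrightarrow> (\<Sum>i. sqnormX_on lam mu (box (a i, b i) (a i + R, b i + R)) u) \<le> ennreal C * sqnormX lam mu u"
proof -
  define A1 where "A1 = MK * 972"
  define A2 where "A2 = 160 * MK * 972"
  define A3 where "A3 = 4 * (8 * MK) * 972 * (ennreal (6 * R) + 40)"
  define A4 where "A4 = 4 * (2 * MK) * 972 * (V1_const + ennreal (6 * R) * 32)"
  \<comment> \<open>The \<lambda>-term of the norm must absorb both \<lambda> times the L2 part and
    \<lambda> times the cross energy. The first is at most \<lambda> times the norm and the second
    at most the norm, whence \<lambda> + 1, and likewise \<mu> + 1.\<close>
  define C where "C = A1 + A2 + (ennreal lam + 1) * A3 + (ennreal mu + 1) * A4"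
  have C: "C < \<infinity>"
    using MK_finite unfolding C_def A1_def A2_def A3_def A4_def V1_const_def by (simp add: ennreal_mult_less_top)
  have "(\<Sum>i. sqnormX_on lam mu (box (a i, b i) (a i + R, b i + R)) u) \<le> C * sqnormX lam mu u" if u: "inX u" for u
  proof -
    have u2: "L2 u" using u by (simp add: inX_def)
    obtain f where f: "nice f" "L2 f" and fu: "AE p in lborel. f p = u p" and fF: "\<And>F. fourier_L2 f F \<longleftrightarrow> fourier_L2 u F"
      by (rule nice_representative[OF u2]) blast
    \<comment> \<open>Two transforms are in play: F' comes with the finite energies that
      \<open>ext_inX\<close> needs, while the F below is the one that \<open>sqnormX\<close>
      selects.\<close>
    obtain F' where F': "fourier_L2 f F'" "half_energy F' < \<infinity>" "cross_energy F' < \<infinity>"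
      using u unfolding inX_def fF half_energy_def cross_energy_def by blast
    define F where "F = (SOME F. fourier_L2 u F)"
    have F: "fourier_L2 f F" unfolding F_def fF by (rule someI[of _ F']) (use F' fF in simp)
    let ?g = "\<lambda>i. ext (a i) (b i) f"
    let ?E = "sq_norm f"
    define T where "T = ?E + cI * (half_energy F + ennreal lam * cross_energy F + ennreal mu * anti_energy F)"
    have sE: "(sq_norm u) = ?E"
      by (rule nn_integral_cong_AE) (use fu in \<open>auto elim!: eventually_mono\<close>)
    have T: "sqnormX lam mu u = T"
      unfolding sqnormX_def sE F_def[symmetric] T_def
      by (subst weighted_energy) (use F l in \<open>auto simp: fourier_L2_def\<close>)
    have "sqnormX_on lam mu (box (a i, b i) (a i + R, b i + R)) u \<le> sqnormX lam mu (?g i)" for i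
    proof -
      have "AE p in lborel. p \<in> box (a i, b i) (a i + R, b i + R) \<longrightarrow> ?g i p = u p"
        using fu by eventually_elim (simp add: ext_eq)
      then show ?thesis unfolding sqnormX_on_def using ext_inX[OF f F'] by (intro INF_lower) simp
    qed
    then have "(\<Sum>i. sqnormX_on lam mu (box (a i, b i) (a i + R, b i + R)) u) \<le> (\<Sum>i. sqnormX lam mu (?g i))"
      by (rule suminf_mono_ennreal)
    also have "\<dots> = (\<Sum>i. sq_norm (?g i)) + cI * (\<Sum>i. half_energy (ft (?g i))) + ennreal lam * (cI * (\<Sum>i. cross_energy (ft (?g i)))) + ennreal mu * (cI * (\<Sum>i. anti_energy (ft (?g i))))"
      unfolding ext_sqnormX[OF f(1) l]
      by (simp only: ennreal_suminf_cmult[symmetric] suminf_add[OF summableI summableI] distrib_left mult_ac add_ac)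
    also have "\<dots> \<le> A1 * ?E + A2 * (?E + cI * half_energy F) + ennreal lam * (A3 * (?E + cI * cross_energy F)) + ennreal mu * (A4 * (?E + cI * anti_energy F))"
      unfolding A1_def A2_def A3_def A4_def
      by (intro add_mono mult_left_mono sum_sq_norm_ext sum_half_energy_ext sum_cross_energy_ext sum_anti_energy_ext f F) auto
    also have "\<dots> \<le> A1 * T + A2 * T + A3 * ((ennreal lam + 1) * T) + A4 * ((ennreal mu + 1) * T)"
    proof -
      have e: "?E \<le> T" "?E + cI * half_energy F \<le> T"
        unfolding T_def by (auto intro!: add_left_mono mult_left_mono add_increasing2)
      have p: "cI * (ennreal lam * cross_energy F) \<le> T" "cI * (ennreal mu * anti_energy F) \<le> T"
        unfolding T_def by (rule add_increasing, simp, rule mult_left_mono, simp_all add: add_increasing add_increasing2)+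
      have "ennreal lam * (A3 * (?E + cI * cross_energy F)) = A3 * (ennreal lam * ?E + cI * (ennreal lam * cross_energy F))"
        by (simp only: distrib_left mult_ac)
      also have "\<dots> \<le> A3 * (ennreal lam * T + 1 * T)" unfolding mult_1_left by (intro mult_left_mono add_mono e p) auto
      finally have 3: "ennreal lam * (A3 * (?E + cI * cross_energy F)) \<le> A3 * ((ennreal lam + 1) * T)" by (simp only: distrib_right)
      have "ennreal mu * (A4 * (?E + cI * anti_energy F)) = A4 * (ennreal mu * ?E + cI * (ennreal mu * anti_energy F))"
        by (simp only: distrib_left mult_ac)
      also have "\<dots> \<le> A4 * (ennreal mu * T + 1 * T)" unfolding mult_1_left by (intro mult_left_mono add_mono e p) auto
      finally have 4: "ennreal mu * (A4 * (?E + cI * anti_energy F)) \<le> A4 * ((ennreal mu + 1) * T)" by (simp only: distrib_right)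
      show ?thesis by (intro add_mono 3 4 mult_left_mono e) auto
    qed
    also have "\<dots> = C * T" unfolding C_def by (simp only: distrib_left distrib_right mult_ac add_ac)
    finally show ?thesis unfolding T .
  qed
  then show ?thesis using C by (intro exI[of _ "enn2real C"]) simp
qed

end

theorem theorem2p11:
  fixes lam mu R :: real and \<Omega> :: "nat \<Rightarrow> pt set"
  assumes "lam \<ge> 0" and "mu \<ge> 0" and "\<not> (lam = 0 \<and> mu = 0)" and "R > 0"
    and squares: "\<forall>i. \<exists>a b. \<Omega> i = box (a, b) (a + R, b + R)"
    and cover: "(\<Union>i. \<Omega> i) = UNIV"
    and overlap: "\<forall>x. finite {i. x \<in> \<Omega> i} \<and> card {i. x \<in> \<Omega> i} \<le> 3"
  shows "\<exists>C::real. \<forall>u. inX u \<longrightarrow>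
           (\<Sum>i. sqnormX_on lam mu (\<Omega> i) u) \<le> ennreal C * sqnormX lam mu u"
proof -
  from squares obtain a b where ab: "\<And>i. \<Omega> i = box (a i, b i) (a i + R, b i + R)" by metis
  obtain M \<alpha> \<alpha>' where "cutoff R M \<alpha> \<alpha>'" by (rule cutoff_exists[OF \<open>R > 0\<close>])
  then interpret cutoff_cover R M \<alpha> \<alpha>' a b
    using overlap by (intro cutoff_cover.intro cutoff_cover_axioms.intro) (auto simp: ab)
  show ?thesis using cover_bound[OF \<open>lam \<ge> 0\<close> \<open>mu \<ge> 0\<close>] unfolding ab .
qed

end
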